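(* Let $U\subset X$ be $1$-quasiopen and let $u\in \widehat N^{1,1}(U)$ (an everywhere defined function on $U$). Then $u\in N^{1,1}(U)$ if and only if $u$ is $1$-quasicontinuous on $U$.
   Context: Standing assumptions: $(X,d,\mu)$ is a complete metric space with at least two points, $\mu$ is a Borel regular outer measure that is doubling ($0<\mu(B(y,2r))\le C_d\mu(B(y,r))<\infty$ for all balls), and $X$ supports a $(1,1)$-Poincaré inequality: there are $C_P>0$, $\lambda\ge1$ such that for every ball $B(y,r)$, every $u\in L^1_{\mathrm{loc}}(X)$ and every upper gradient $g$ of $u$, the mean of $|u-u_{B(y,r)}|$ over $B(y,r)$ is at most $C_P r$ times the mean of $g$ over $B(y,\lambda r)$. A nonnegative Borel $g$ is an upper gradient of $u$ if $|u(a)-u(b)|\le\int_\gamma g\,ds$ for every nonconstant rectifiable curve $\gamma$ with endpoints $a,b$; $g$ is a $1$-weak upper gradient (in $D$) if this holds for all curves (in $D$) outside a family of zero $1$-modulus (a family has zero $1$-modulus if some nonnegative Borel $\rho\in L^1(X)$ has $\int_\gamma\rho\,ds=\infty$ on each of its curves). For $\mu$-measurable $D$, $N^{1,1}(D)$ is the space of everywhere defined functions $u$ on $D$ with $\|u\|_{N^{1,1}(D)}:=\|u\|_{L^1(D)}+\inf_g\|g\|_{L^1(D)}<\infty$ (infimum over $1$-weak upper gradients in $D$). $\mathrm{Cap}_1(A):=\inf\|w\|_{N^{1,1}(X)}$ over $w\in N^{1,1}(X)$ with $w\ge1$ on $A$. $U$ is $1$-quasiopen if for every $\varepsilon>0$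 there is an open $G$ with $\mathrm{Cap}_1(G)<\varepsilon$ and $U\cup G$ open ($1$-quasiopen sets are $\mu$-measurable). A function $u$ on $U$ is $1$-quasicontinuous on $U$ if for every $\varepsilon>0$ there is an open $G$ with $\mathrm{Cap}_1(G)<\varepsilon$ and $u|_{U\setminus G}$ real-valued and continuous. $\widehat N^{1,1}(U):=\{u:\ u=v \text{ $\mu$-a.e. on } U \text{ for some } v\in N^{1,1}(U)\}$. *)

theory Defs
  imports "HOL-Analysis.Analysis"
begin

text \<open>Compact curves are parametrized on [0,1] (any compact curve reparametrizes
linearly to [0,1] without changing length or line integrals).\<close>

definition partition_sums :: "(real \<Rightarrow> 'a::metric_space) \<Rightarrow> real \<Rightarrow> real \<Rightarrow> real set" where
  "partition_sums \<gamma> a b =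
     {(\<Sum>i<n. dist (\<gamma> (t i)) (\<gamma> (t (Suc i)))) | n t.
        t 0 = a \<and> t n = b \<and> (\<forall>i<n. t i \<le> t (Suc i))}"

definition rectifiable_curve :: "(real \<Rightarrow> 'a::metric_space) \<Rightarrow> bool" where
  "rectifiable_curve \<gamma> \<longleftrightarrow> continuous_on {0..1} \<gamma> \<and> bdd_above (partition_sums \<gamma> 0 1)"

definition nonconstant_curve :: "(real \<Rightarrow> 'a) \<Rightarrow> bool" where
  "nonconstant_curve \<gamma> \<longleftrightarrow> (\<exists>t\<in>{0..1}. \<gamma> t \<noteq> \<gamma> 0)"

definition arclen :: "(real \<Rightarrow> 'a::metric_space) \<Rightarrow> real \<Rightarrow> real" where
  "arclen \<gamma> t = Sup (partition_sums \<gamma> 0 (max 0 (min 1 t)))"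

definition line_integral :: "(real \<Rightarrow> 'a::metric_space) \<Rightarrow> ('a \<Rightarrow> ennreal) \<Rightarrow> ennreal" where
  "line_integral \<gamma> g = (\<integral>\<^sup>+ t. g (\<gamma> t) * indicator {0..1} t \<partial>interval_measure (arclen \<gamma>))"

definition ediff :: "ereal \<Rightarrow> ereal \<Rightarrow> ennreal" where
  "ediff x y = (if \<bar>x\<bar> \<noteq> \<infinity> \<and> \<bar>y\<bar> \<noteq> \<infinity> then ennreal \<bar>real_of_ereal x - real_of_ereal y\<bar> else \<infinity>)"

definition ug_ineq :: "('a::metric_space \<Rightarrow> ereal) \<Rightarrow> ('a \<Rightarrow> ennreal) \<Rightarrow> (real \<Rightarrow> 'a) \<Rightarrow> bool" where
  "ug_ineq u g \<gamma> \<longleftrightarrow> ediff (u (\<gamma> 0)) (u (\<gamma> 1)) \<le> line_integral \<gamma> g"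

definition upper_gradient :: "('a::metric_space \<Rightarrow> ereal) \<Rightarrow> ('a \<Rightarrow> ennreal) \<Rightarrow> bool" where
  "upper_gradient u g \<longleftrightarrow> g \<in> borel_measurable borel \<and>
     (\<forall>\<gamma>. rectifiable_curve \<gamma> \<and> nonconstant_curve \<gamma> \<longrightarrow> ug_ineq u g \<gamma>)"

definition zero_1_modulus :: "'a::metric_space measure \<Rightarrow> (real \<Rightarrow> 'a) set \<Rightarrow> bool" where
  "zero_1_modulus M \<Gamma> \<longleftrightarrow> (\<exists>\<rho>::'a \<Rightarrow> ennreal. \<rho> \<in> borel_measurable borel \<and>
      (\<integral>\<^sup>+ x. \<rho> x \<partial>completion M) < \<infinity> \<and> (\<forall>\<gamma>\<in>\<Gamma>. line_integral \<gamma> \<rho> = \<infinity>))"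

definition weak_upper_gradient_in :: "'a::metric_space measure \<Rightarrow> 'a set \<Rightarrow> ('a \<Rightarrow> ereal) \<Rightarrow> ('a \<Rightarrow> ennreal) \<Rightarrow> bool" where
  "weak_upper_gradient_in M D u g \<longleftrightarrow> g \<in> borel_measurable borel \<and>
     (\<exists>\<Gamma>. zero_1_modulus M \<Gamma> \<and>
        (\<forall>\<gamma>. rectifiable_curve \<gamma> \<and> nonconstant_curve \<gamma> \<and> \<gamma> ` {0..1} \<subseteq> D \<and> \<gamma> \<notin> \<Gamma>
              \<longrightarrow> ug_ineq u g \<gamma>))"

text \<open>\<mu>-measurability / integrals are taken w.r.t. the completion of the Borel measure M.\<close>
definition N11 :: "'a::metric_space measure \<Rightarrow> 'a set \<Rightarrow> ('a \<Rightarrow> ereal) \<Rightarrow> bool" where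
  "N11 M D u \<longleftrightarrow> (\<lambda>x. if x \<in> D then u x else 0) \<in> borel_measurable (completion M) \<and>
     (\<integral>\<^sup>+ x\<in>D. e2ennreal \<bar>u x\<bar> \<partial>completion M) < \<infinity> \<and>
     (\<exists>g. weak_upper_gradient_in M D u g \<and> (\<integral>\<^sup>+ x\<in>D. g x \<partial>completion M) < \<infinity>)"

definition N11_hat :: "'a::metric_space measure \<Rightarrow> 'a set \<Rightarrow> ('a \<Rightarrow> ereal) \<Rightarrow> bool" where
  "N11_hat M U u \<longleftrightarrow> (\<exists>v. N11 M U v \<and> (AE x in completion M. x \<in> U \<longrightarrow> u x = v x))"

definition Cap1 :: "'a::metric_space measure \<Rightarrow> 'a set \<Rightarrow> ennreal" where
  "Cap1 M A = (INF (w, g) \<in> {(w, g). N11 M UNIV w \<and> weak_upper_gradient_in M UNIV w g \<and> (\<forall>x\<in>A. w x \<ge> 1)}.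
      (\<integral>\<^sup>+ x. e2ennreal \<bar>w x\<bar> \<partial>completion M) + (\<integral>\<^sup>+ x. g x \<partial>completion M))"

definition quasiopen1 :: "'a::metric_space measure \<Rightarrow> 'a set \<Rightarrow> bool" where
  "quasiopen1 M U \<longleftrightarrow> (\<forall>\<epsilon>>0. \<exists>G. open G \<and> Cap1 M G < ennreal \<epsilon> \<and> open (U \<union> G))"

definition quasicontinuous1_on :: "'a::metric_space measure \<Rightarrow> 'a set \<Rightarrow> ('a \<Rightarrow> ereal) \<Rightarrow> bool" where
  "quasicontinuous1_on M U u \<longleftrightarrow> (\<forall>\<epsilon>>0. \<exists>G. open G \<and> Cap1 M G < ennreal \<epsilon> \<and>
      (\<forall>x\<in>U - G. \<bar>u x\<bar> \<noteq> \<infinity>) \<and> continuous_on (U - G) (\<lambda>x. real_of_ereal (u x)))"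

definition L1_loc :: "'a::metric_space measure \<Rightarrow> ('a \<Rightarrow> real) \<Rightarrow> bool" where
  "L1_loc M u \<longleftrightarrow> u \<in> borel_measurable (completion M) \<and>
     (\<forall>x. \<exists>r>0. set_integrable (completion M) (ball x r) u)"

definition doubling :: "'a::metric_space measure \<Rightarrow> real \<Rightarrow> bool" where
  "doubling M Cd \<longleftrightarrow> (\<forall>y r. r > 0 \<longrightarrow>
      0 < emeasure M (ball y r) \<and> emeasure M (ball y r) < \<infinity> \<and>
      emeasure M (ball y (2*r)) \<le> ennreal Cd * emeasure M (ball y r))"

definition ball_mean :: "'a::metric_space measure \<Rightarrow> 'a set \<Rightarrow> ('a \<Rightarrow> real) \<Rightarrow> real" where
  "ball_mean M B u = (LINT x:B|completion M. u x) / measure (completion M) B"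

definition poincare_1_1 :: "'a::metric_space measure \<Rightarrow> real \<Rightarrow> real \<Rightarrow> bool" where
  "poincare_1_1 M CP lam \<longleftrightarrow> CP > 0 \<and> lam \<ge> 1 \<and>
     (\<forall>y r u g. r > 0 \<and> L1_loc M u \<and> upper_gradient (\<lambda>x. ereal (u x)) g \<longrightarrow>
        ennreal (ball_mean M (ball y r) (\<lambda>x. \<bar>u x - ball_mean M (ball y r) u\<bar>))
          \<le> ennreal (CP * r) * ((\<integral>\<^sup>+ x\<in>ball y (lam*r). g x \<partial>completion M)
                                  / emeasure (completion M) (ball y (lam*r))))"

end

theory Submission
  imports Defs "HOL-Probability.Distribution_Functions"
begin

text \<open>
  The heart of the matter is that a bounded Newton-Sobolev function \<open>f\<close> on the whole space, with
  integrable upper gradient \<open>g\<close>, is quasicontinuous for each of its representatives. Applying the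
  Poincare inequality at scale \<open>r\<close> to truncations of \<open>f\<close> yields \<open>\<bar>f x - f y\<bar> \<le> 4 \<eta>\<close> for
  \<open>dist x y < r\<close> off a set of measure \<open>o(r)\<close>. Put this set into an open set \<open>V\<close> and let \<open>h x\<close> be
  the infimum of \<open>\<integral> (g + C/r) ds\<close> over the curves from \<open>x\<close> to the complement of \<open>V\<close>. By
  compactness \<open>h\<close> is lower semicontinuous when \<open>g\<close> is, its superlevel sets are open of small capacity,
  and off them every point is joined to the complement of \<open>V\<close> by a curve which is short and
  along which \<open>f\<close> varies little.

  On a quasiopen set \<open>U\<close> with \<open>U \<union> G\<close> open, let \<open>w\<close> be a capacity test function of \<open>G\<close> and
  \<open>\<phi> = min (1 - w) d\<close>, where \<open>d\<close> is the distance to the complement of \<open>U \<union> G\<close>, cut off to have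
  bounded support. Clipping a Newton-Sobolev function \<open>v\<close> on \<open>U\<close> to \<open>[- n \<phi>, n \<phi>]\<close> gives
  Sobolev functions on the whole space that coincide with \<open>v\<close> for large \<open>n\<close>, off a set of small capacity. Conversely, two
  quasicontinuous functions that agree almost everywhere can only differ at points which are
  avoided by almost every curve.
\<close>

section \<open>Length of curves\<close>

text \<open>The claim concerns every representative, so values on null sets matter and can be
  reached only along curves. In \<open>Cap1_small_oscillation\<close> the constant
  \<open>l = 8 * s / r\<close> in the potential keeps cheap curves shorter than \<open>r/4\<close>,
  and the capacity bound then contains \<open>l\<close> times the measure of \<open>V\<close>. Hence
  the exceptional set must have measure o(r), and the Poincare inequality is used twice. Functions
  on the whole space are built from data on a subset by \<open>ug_glue\<close>: they are dominated
  by some \<open>\<phi>\<close>, and a curve leaves the region \<open>\<phi> > 0\<close> only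
  through zeros of \<open>\<phi>\<close>. A term \<open>\<theta> * k\<close> pays, at an arbitrarily
  small price, for the curves along which \<open>\<phi>\<close> may be discontinuous. Exceptional
  curve families are absorbed by adding to the gradient a function that is infinite along them.
  Functions are measurable for the completion, whereas gradients must be Borel and bounds must hold
  at every point of a curve; this accounts for the Borel hulls and pointwise majorants.\<close>

inductive psum :: "(real \<Rightarrow> 'a::metric_space) \<Rightarrow> real \<Rightarrow> real \<Rightarrow> real \<Rightarrow> bool" for \<gamma> a where
  psum_refl: "psum \<gamma> a a 0"
| psum_step: "psum \<gamma> a c S \<Longrightarrow> c \<le> b \<Longrightarrow> psum \<gamma> a b (S + dist (\<gamma> c) (\<gamma> b))"

lemma psum_le: "psum \<gamma> a b S \<Longrightarrow> a \<le> b"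
  by (induction rule: psum.induct) auto

lemma psum_trivial: "psum \<gamma> a b S \<Longrightarrow> b = a \<Longrightarrow> S = 0"
  by (induction rule: psum.induct) (auto dest: psum_le)

lemma psum_dist: "a \<le> b \<Longrightarrow> psum \<gamma> a b (dist (\<gamma> a) (\<gamma> b))"
  using psum_step[OF psum_refl, of a b] by simp

text \<open>The inductive form adds one subdivision point at the right end, so cutting, joining and
  transporting subdivisions become inductions without index shifts.\<close>

lemma partition_sums_eq: "partition_sums \<gamma> a b = {S. psum \<gamma> a b S}"
proof (intro set_eqI iffI)
  fix S assume "S \<in> partition_sums \<gamma> a b"
  then obtain n t where S: "S = (\<Sum>i<n. dist (\<gamma> (t i)) (\<gamma> (t (Suc i))))"
    and t: "t 0 = a" "t n = b" "\<forall>i<n. t i \<le> t (Suc i)"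
    unfolding partition_sums_def by blast
  have "m \<le> n \<Longrightarrow> psum \<gamma> a (t m) (\<Sum>i<m. dist (\<gamma> (t i)) (\<gamma> (t (Suc i))))" for m
  proof (induction m)
    case 0 then show ?case using t by (simp add: psum_refl)
  next
    case (Suc m) then show ?case using t by (auto intro!: psum_step)
  qed
  from this[of n] show "S \<in> {S. psum \<gamma> a b S}" using S t by simp
next
  fix S assume "S \<in> {S. psum \<gamma> a b S}"
  then have "psum \<gamma> a b S" by simp
  then show "S \<in> partition_sums \<gamma> a b"
  proof (induction rule: psum.induct)
    case psum_refl
    show ?case unfolding partition_sums_def
      by (rule CollectI, intro exI[of _ 0] exI[of _ "\<lambda>_. a"]) simp
  next
    case (psum_step c S b)
    then obtain n t where S: "S = (\<Sum>i<n. dist (\<gamma> (t i)) (\<gamma> (t (Suc i))))"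
      and t: "t 0 = a" "t n = c" "\<forall>i<n. t i \<le> t (Suc i)"
      unfolding partition_sums_def by blast
    define t' where "t' = t(Suc n := b)"
    have "(\<Sum>i<n. dist (\<gamma> (t' i)) (\<gamma> (t' (Suc i)))) = S"
      unfolding S by (rule sum.cong) (auto simp: t'_def)
    moreover have "\<forall>i<Suc n. t' i \<le> t' (Suc i)" using t psum_step by (auto simp: t'_def less_Suc_eq)
    ultimately show ?case unfolding partition_sums_def using t
      by (intro CollectI exI[of _ "Suc n"] exI[of _ t']) (auto simp: t'_def)
  qed
qed

lemma psum_concat: "psum \<gamma> b c T \<Longrightarrow> psum \<gamma> a b S \<Longrightarrow> psum \<gamma> a c (S + T)"
proof (induction rule: psum.induct)
  case (psum_step c T d)
  then have "psum \<gamma> a d ((S + T) + dist (\<gamma> c) (\<gamma> d))" by (intro psum.psum_step) auto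
  then show ?case by (simp add: add.assoc)
qed auto

text \<open>Inserting \<open>b\<close> into the interval that contains it can only increase the sum,
  by the triangle inequality; hence \<open>\<le>\<close> and not equality.\<close>

lemma psum_split:
  "psum \<gamma> a c S \<Longrightarrow> a \<le> b \<Longrightarrow> b \<le> c \<Longrightarrow> \<exists>S1 S2. psum \<gamma> a b S1 \<and> psum \<gamma> b c S2 \<and> S \<le> S1 + S2"
proof (induction rule: psum.induct)
  case psum_refl
  then show ?case by (intro exI[of _ 0]) (auto intro: psum.psum_refl)
next
  case (psum_step c S d)
  show ?case
  proof (cases "b \<le> c")
    case True
    then obtain S1 S2 where *: "psum \<gamma> a b S1" "psum \<gamma> b c S2" "S \<le> S1 + S2" using psum_step by auto
    show ?thesis using * psum.psum_step[OF *(2) \<open>c \<le> d\<close>]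
      by (intro exI[of _ S1] exI[of _ "S2 + dist (\<gamma> c) (\<gamma> d)"]) auto
  next
    case False
    have "psum \<gamma> a b (S + dist (\<gamma> c) (\<gamma> b))" using psum_step False by (intro psum.psum_step) auto
    moreover have "psum \<gamma> b d (dist (\<gamma> b) (\<gamma> d))" using psum_step by (intro psum_dist) auto
    ultimately show ?thesis using dist_triangle[of "\<gamma> c" "\<gamma> d" "\<gamma> b"]
      by (intro exI conjI) (assumption+, simp)
  qed
qed

lemma psum_cong:
  "psum \<gamma> a b S \<Longrightarrow> (\<And>t. a \<le> t \<Longrightarrow> t \<le> b \<Longrightarrow> \<gamma> t = \<sigma> t) \<Longrightarrow> psum \<sigma> a b S"
proof (induction rule: psum.induct)
  case psum_refl show ?case by (rule psum.psum_refl)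
next
  case (psum_step c S b)
  have "psum \<sigma> a c S" using psum_step by auto
  from psum.psum_step[OF this \<open>c \<le> b\<close>] show ?case using psum_step psum_le[OF psum_step(1)] by auto
qed

lemma psum_reparam:
  "psum (\<gamma> \<circ> \<alpha>) a b S \<Longrightarrow> (\<And>s t. a \<le> s \<Longrightarrow> s \<le> t \<Longrightarrow> t \<le> b \<Longrightarrow> \<alpha> s \<le> \<alpha> t) \<Longrightarrow> psum \<gamma> (\<alpha> a) (\<alpha> b) S"
proof (induction rule: psum.induct)
  case psum_refl show ?case by (rule psum.psum_refl)
next
  case (psum_step c S b)
  have "psum \<gamma> (\<alpha> a) (\<alpha> c) S" using psum_step by auto
  moreover have "\<alpha> c \<le> \<alpha> b" using psum_step psum_le[OF psum_step(1)] by auto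
  ultimately show ?case by (auto dest: psum.psum_step)
qed

text \<open>The intermediate value theorem lifts the subdivision points to parameters, one at a time
  from the right.\<close>

lemma psum_reparam_conv:
  "psum \<gamma> p q S \<Longrightarrow> p = \<alpha> a \<Longrightarrow> a \<le> b \<Longrightarrow> \<alpha> b = q \<Longrightarrow> continuous_on {a..b} \<alpha> \<Longrightarrow> psum (\<gamma> \<circ> \<alpha>) a b S"
proof (induction arbitrary: b rule: psum.induct)
  case psum_refl
  \<comment> \<open>Here \<open>\<alpha> a = \<alpha> b\<close>, so the single chord over
    \<open>{a..b}\<close> has length zero.\<close>
  then show ?case using psum_dist[of a b "\<gamma> \<circ> \<alpha>"] by (simp add: o_def)
next
  case (psum_step c S q)
  have "p \<le> c" using psum_le[OF psum_step(1)] .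
  then have "\<alpha> a \<le> c" "c \<le> \<alpha> b" using psum_step.prems psum_step.hyps by auto
  from IVT'[OF this \<open>a \<le> b\<close> \<open>continuous_on {a..b} \<alpha>\<close>]
  obtain t where t: "a \<le> t" "t \<le> b" "\<alpha> t = c" by auto
  have "continuous_on {a..t} \<alpha>"
    using \<open>continuous_on {a..b} \<alpha>\<close> by (rule continuous_on_subset) (use t in auto)
  then have "psum (\<gamma> \<circ> \<alpha>) a t S" by (intro psum_step.IH psum_step.prems(1) t)
  from psum.psum_step[OF this t(2)] show ?case using t psum_step.prems by (simp add: o_def)
qed

lemma psum_reverse:
  "psum \<gamma> a b S \<Longrightarrow> psum (\<lambda>t. \<gamma> (1 - t)) (1 - b) (1 - a) S"
proof (induction rule: psum.induct)
  case psum_refl show ?case by (rule psum.psum_refl)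
next
  case (psum_step c S b)
  have "psum (\<lambda>t. \<gamma> (1 - t)) (1 - b) (1 - c) (dist (\<gamma> c) (\<gamma> b))"
    using psum_dist[of "1 - b" "1 - c" "\<lambda>t. \<gamma> (1 - t)"] psum_step by (simp add: dist_commute)
  from psum_concat[OF psum_step.IH this] show ?case by (simp add: add.commute)
qed

definition plen :: "(real \<Rightarrow> 'a::metric_space) \<Rightarrow> real \<Rightarrow> real \<Rightarrow> real" where
  "plen \<gamma> a b = Sup {S. psum \<gamma> a b S}"

lemma rectifiable_curve_iff:
  "rectifiable_curve \<gamma> \<longleftrightarrow> continuous_on {0..1} \<gamma> \<and> bdd_above {S. psum \<gamma> 0 1 S}"
  unfolding rectifiable_curve_def partition_sums_eq ..

lemma arclen_plen: "arclen \<gamma> t = plen \<gamma> 0 (max 0 (min 1 t))"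
  unfolding arclen_def plen_def partition_sums_eq ..

lemma psum_bdd:
  assumes "rectifiable_curve \<gamma>" "0 \<le> a" "b \<le> 1"
  shows "bdd_above {S. psum \<gamma> a b S}"
proof -
  obtain B where B: "\<And>S. psum \<gamma> 0 1 S \<Longrightarrow> S \<le> B"
    using assms unfolding rectifiable_curve_iff bdd_above_def by auto
  have "S \<le> B" if S: "psum \<gamma> a b S" for S
  proof -
    have "psum \<gamma> 0 1 (dist (\<gamma> 0) (\<gamma> a) + (S + dist (\<gamma> b) (\<gamma> 1)))"
      using assms by (intro psum_concat[OF psum_concat[OF _ S]] psum_dist) auto
    from B[OF this] zero_le_dist[of "\<gamma> 0" "\<gamma> a"] zero_le_dist[of "\<gamma> b" "\<gamma> 1"] show ?thesis by linarith
  qed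
  then show ?thesis by (intro bdd_aboveI[of _ B]) auto
qed

lemma plen_upper:
  assumes "rectifiable_curve \<gamma>" "0 \<le> a" "b \<le> 1" "psum \<gamma> a b S"
  shows "S \<le> plen \<gamma> a b"
  unfolding plen_def using assms by (intro cSup_upper psum_bdd) auto

lemma plen_least:
  assumes "a \<le> b" "\<And>S. psum \<gamma> a b S \<Longrightarrow> S \<le> B"
  shows "plen \<gamma> a b \<le> B"
  unfolding plen_def using assms psum_dist[of a b \<gamma>] by (intro cSup_least) auto

lemma plen_approx:
  assumes "a \<le> b" "e > 0"
  obtains S where "psum \<gamma> a b S" "plen \<gamma> a b - e < S"
proof -
  have "\<not> (\<forall>S. psum \<gamma> a b S \<longrightarrow> S \<le> plen \<gamma> a b - e)"
    using plen_least[of a b \<gamma> "plen \<gamma> a b - e"] assms by auto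
  then show ?thesis using that by force
qed

lemma plen_add:
  assumes "rectifiable_curve \<gamma>" "0 \<le> a" "a \<le> b" "b \<le> c" "c \<le> 1"
  shows "plen \<gamma> a c = plen \<gamma> a b + plen \<gamma> b c"
proof (rule antisym)
  show "plen \<gamma> a c \<le> plen \<gamma> a b + plen \<gamma> b c"
  proof (rule plen_least)
    show "a \<le> c" using assms by auto
    fix S assume "psum \<gamma> a c S"
    from psum_split[OF this assms(3,4)] obtain S1 S2
      where "psum \<gamma> a b S1" "psum \<gamma> b c S2" "S \<le> S1 + S2" by auto
    then show "S \<le> plen \<gamma> a b + plen \<gamma> b c"
      using plen_upper[OF assms(1), of a b S1] plen_upper[OF assms(1), of b c S2] assms by auto
  qed
  show "plen \<gamma> a b + plen \<gamma> b c \<le> plen \<gamma> a c"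
  proof (rule field_le_epsilon)
    fix e :: real assume "e > 0"
    obtain S1 where S1: "psum \<gamma> a b S1" "plen \<gamma> a b - e/2 < S1" using plen_approx[of a b "e/2"] assms \<open>e > 0\<close> by auto
    obtain S2 where S2: "psum \<gamma> b c S2" "plen \<gamma> b c - e/2 < S2" using plen_approx[of b c "e/2"] assms \<open>e > 0\<close> by auto
    have "S1 + S2 \<le> plen \<gamma> a c" using psum_concat[OF S2(1) S1(1)] assms by (intro plen_upper) auto
    then show "plen \<gamma> a b + plen \<gamma> b c \<le> plen \<gamma> a c + e" using S1 S2 by auto
  qed
qed

lemma plen_ge_dist:
  assumes "rectifiable_curve \<gamma>" "0 \<le> a" "a \<le> b" "b \<le> 1"
  shows "dist (\<gamma> a) (\<gamma> b) \<le> plen \<gamma> a b"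
  using assms by (intro plen_upper psum_dist) auto

lemma plen_nonneg:
  assumes "rectifiable_curve \<gamma>" "0 \<le> a" "a \<le> b" "b \<le> 1"
  shows "0 \<le> plen \<gamma> a b"
  using plen_ge_dist[OF assms] zero_le_dist[of "\<gamma> a" "\<gamma> b"] by linarith

lemma plen_self [simp]: "plen \<gamma> a a = 0"
proof -
  have "{S. psum \<gamma> a a S} = {0}" using psum_trivial[of \<gamma> a a] by (auto intro: psum_refl)
  then show ?thesis by (simp add: plen_def)
qed

lemma plen_reverse: "plen (\<lambda>t. \<gamma> (1 - t)) a b = plen \<gamma> (1 - b) (1 - a)"
  unfolding plen_def using psum_reverse[of \<gamma> "1-b" "1-a"] psum_reverse[of "\<lambda>t. \<gamma> (1 - t)" a b]
  by (intro arg_cong[of _ _ Sup]) auto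

lemma rectifiable_reverse:
  assumes "rectifiable_curve \<gamma>" shows "rectifiable_curve (\<lambda>t. \<gamma> (1 - t))"
proof -
  have "{S. psum (\<lambda>t. \<gamma> (1 - t)) 0 1 S} = {S. psum \<gamma> 0 1 S}"
    using psum_reverse[of \<gamma> 0 1] psum_reverse[of "\<lambda>t. \<gamma> (1 - t)" 0 1] by auto
  moreover have "continuous_on {0..1} (\<lambda>t. \<gamma> (1 - t))"
    by (rule continuous_on_compose2[of "{0..1}" \<gamma>])
      (use assms in \<open>auto simp: rectifiable_curve_def intro!: continuous_intros\<close>)
  ultimately show ?thesis using assms unfolding rectifiable_curve_iff by simp
qed

text \<open>Isolates the first nontrivial chord: moving the start from \<open>t\<close> to any
  \<open>u\<close> up to the next subdivision point costs at most
  \<open>dist (\<gamma> t) (\<gamma> u)\<close>. With continuity of the curve this excludes a jump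
  of length at \<open>t\<close>.\<close>

lemma psum_split_right:
  "psum \<gamma> t b S \<Longrightarrow> t < b \<Longrightarrow>
    \<exists>p. t < p \<and> p \<le> b \<and> (\<forall>u. t < u \<and> u \<le> p \<longrightarrow> (\<exists>S'. psum \<gamma> u b S' \<and> S \<le> dist (\<gamma> t) (\<gamma> u) + S'))"
proof (induction rule: psum.induct)
  case (psum_step c S b)
  show ?case
  proof (cases "t < c")
    case True
    then obtain p where p: "t < p" "p \<le> c" and
      *: "\<And>u. t < u \<Longrightarrow> u \<le> p \<Longrightarrow> \<exists>S'. psum \<gamma> u c S' \<and> S \<le> dist (\<gamma> t) (\<gamma> u) + S'"
      using psum_step by auto
    show ?thesis
    proof (rule exI[of _ p], intro conjI allI impI)
      fix u assume "t < u \<and> u \<le> p"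
      then obtain S' where "psum \<gamma> u c S'" "S \<le> dist (\<gamma> t) (\<gamma> u) + S'" using * by auto
      then show "\<exists>S'. psum \<gamma> u b S' \<and> S + dist (\<gamma> c) (\<gamma> b) \<le> dist (\<gamma> t) (\<gamma> u) + S'"
        using psum.psum_step[of \<gamma> u c S' b] psum_step by (intro exI[of _ "S' + dist (\<gamma> c) (\<gamma> b)"]) auto
    qed (use p psum_step in auto)
  next
    case False
    then have c: "c = t" using psum_le[OF psum_step.hyps(1)] by linarith
    have "S = 0" by (rule psum_trivial[OF psum_step.hyps(1) c])
    note c = c this
    show ?thesis
    proof (rule exI[of _ b], intro conjI allI impI)
      fix u assume "t < u \<and> u \<le> b"
      then show "\<exists>S'. psum \<gamma> u b S' \<and> S + dist (\<gamma> c) (\<gamma> b) \<le> dist (\<gamma> t) (\<gamma> u) + S'"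
        using c dist_triangle[of "\<gamma> t" "\<gamma> b" "\<gamma> u"]
        by (intro exI[of _ "dist (\<gamma> u) (\<gamma> b)"]) (simp add: psum_dist)
    qed (use psum_step in auto)
  qed
qed auto

text \<open>A sum within \<open>e/2\<close> of the full length after \<open>t\<close> loses less
  than \<open>e/2\<close> when it is started at a nearby \<open>u\<close>, so almost all of that
  length lies after \<open>u\<close>.\<close>

lemma plen_right_small:
  assumes rc: "rectifiable_curve \<gamma>" and t: "0 \<le> t" "t < 1" and e: "e > 0"
  shows "\<exists>u>t. u \<le> 1 \<and> plen \<gamma> t u < e"
proof -
  obtain S where S: "psum \<gamma> t 1 S" "plen \<gamma> t 1 - e/2 < S" using plen_approx[of t 1 "e/2"] t e by auto
  obtain p where p: "t < p" "p \<le> 1"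
    "\<And>u. t < u \<Longrightarrow> u \<le> p \<Longrightarrow> \<exists>S'. psum \<gamma> u 1 S' \<and> S \<le> dist (\<gamma> t) (\<gamma> u) + S'"
    using psum_split_right[OF S(1) t(2)] by auto
  have "continuous_on {0..1} \<gamma>" using rc by (simp add: rectifiable_curve_def)
  then obtain d where d: "d > 0" "\<And>u. u \<in> {0..1} \<Longrightarrow> dist u t < d \<Longrightarrow> dist (\<gamma> u) (\<gamma> t) < e/2"
    using t e unfolding continuous_on_iff
    by (elim ballE[of _ _ t] allE[of _ "e/2"]) auto
  define u where "u = min p (t + d/2)"
  have u: "t < u" "u \<le> p" "u \<le> 1" "dist u t < d" using p d unfolding u_def dist_real_def by auto
  obtain S' where S': "psum \<gamma> u 1 S'" "S \<le> dist (\<gamma> t) (\<gamma> u) + S'" using p(3)[of u] u by auto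
  have "S' \<le> plen \<gamma> u 1" using plen_upper[OF rc _ _ S'(1)] u t by auto
  moreover have "plen \<gamma> t 1 = plen \<gamma> t u + plen \<gamma> u 1" using plen_add[OF rc, of t u 1] u t by auto
  moreover have "dist (\<gamma> t) (\<gamma> u) < e/2" using d(2)[of u] u t by (auto simp: dist_commute)
  ultimately have "plen \<gamma> t u < e" using S S' by linarith
  then show ?thesis using u by auto
qed

lemma plen_left_small:
  assumes rc: "rectifiable_curve \<gamma>" and t: "0 < t" "t \<le> 1" and e: "e > 0"
  shows "\<exists>u<t. 0 \<le> u \<and> plen \<gamma> u t < e"
proof -
  obtain u where u: "u > 1 - t" "u \<le> 1" "plen (\<lambda>t. \<gamma> (1 - t)) (1 - t) u < e"
    using plen_right_small[OF rectifiable_reverse[OF rc], of "1 - t" e] t e by auto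
  then show ?thesis by (intro exI[of _ "1 - u"]) (auto simp: plen_reverse)
qed

lemma plen_mono:
  assumes "rectifiable_curve \<gamma>" "0 \<le> a" "a \<le> a'" "a' \<le> b'" "b' \<le> b" "b \<le> 1"
  shows "plen \<gamma> a' b' \<le> plen \<gamma> a b"
  using plen_add[OF assms(1), of a a' b] plen_add[OF assms(1), of a' b' b]
    plen_nonneg[OF assms(1), of a a'] plen_nonneg[OF assms(1), of b' b] assms by auto

lemma continuous_plen:
  assumes rc: "rectifiable_curve \<gamma>"
  shows "continuous_on {0..1} (plen \<gamma> 0)"
  unfolding continuous_on_iff
proof (intro ballI allI impI)
  fix t e :: real assume t: "t \<in> {0..1}" and e: "e > 0"
  obtain d1 where d1: "d1 > 0" "\<And>u. t \<le> u \<Longrightarrow> u \<le> 1 \<Longrightarrow> u < t + d1 \<Longrightarrow> plen \<gamma> t u < e"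
  proof (cases "t < 1")
    case True
    then obtain w where w: "w > t" "w \<le> 1" "plen \<gamma> t w < e" using plen_right_small[OF rc, of t e] t e by auto
    show ?thesis
    proof (rule that[of "w - t"])
      fix u assume "t \<le> u" "u \<le> 1" "u < t + (w - t)"
      then have "plen \<gamma> t u \<le> plen \<gamma> t w" using plen_mono[OF rc, of t t u w] t w by auto
      then show "plen \<gamma> t u < e" using w by auto
    qed (use w in auto)
  next
    case False
    then have "t = 1" using t by auto
    then show ?thesis using e by (intro that[of 1]) auto
  qed
  obtain d2 where d2: "d2 > 0" "\<And>u. u \<le> t \<Longrightarrow> 0 \<le> u \<Longrightarrow> u > t - d2 \<Longrightarrow> plen \<gamma> u t < e"
  proof (cases "0 < t")
    case True
    then obtain w where w: "w < t" "0 \<le> w" "plen \<gamma> w t < e" using plen_left_small[OF rc, of t e] t e by auto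
    show ?thesis
    proof (rule that[of "t - w"])
      fix u assume "u \<le> t" "0 \<le> u" "u > t - (t - w)"
      then have "plen \<gamma> u t \<le> plen \<gamma> w t" using plen_mono[OF rc, of w u t t] t w by auto
      then show "plen \<gamma> u t < e" using w by auto
    qed (use w in auto)
  next
    case False
    then have "t = 0" using t by auto
    then show ?thesis using e by (intro that[of 1]) auto
  qed
  show "\<exists>d>0. \<forall>u\<in>{0..1}. dist u t < d \<longrightarrow> dist (plen \<gamma> 0 u) (plen \<gamma> 0 t) < e"
  proof (intro exI[of _ "min d1 d2"] conjI ballI impI)
    fix u assume u: "u \<in> {0..1}" "dist u t < min d1 d2"
    show "dist (plen \<gamma> 0 u) (plen \<gamma> 0 t) < e"
    proof (cases "t \<le> u")
      case True
      then show ?thesis using d1(2)[of u] plen_add[OF rc, of 0 t u] plen_nonneg[OF rc, of t u] u t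
        by (auto simp: dist_real_def)
    next
      case False
      then show ?thesis using d2(2)[of u] plen_add[OF rc, of 0 u t] plen_nonneg[OF rc, of u t] u t
        by (auto simp: dist_real_def)
    qed
  qed (use d1 d2 in auto)
qed

lemma continuous_arclen:
  assumes "rectifiable_curve \<gamma>" shows "continuous_on UNIV (arclen \<gamma>)"
  unfolding arclen_plen
  by (rule continuous_on_compose2[OF continuous_plen[OF assms]]) (auto intro!: continuous_intros)

lemma arclen_diff:
  assumes "rectifiable_curve \<gamma>" "0 \<le> a" "a \<le> b" "b \<le> 1"
  shows "arclen \<gamma> b - arclen \<gamma> a = plen \<gamma> a b"
  using plen_add[OF assms(1), of 0 a b] assms by (auto simp: arclen_plen)

lemma mono_arclen:
  assumes "rectifiable_curve \<gamma>" "a \<le> b" shows "arclen \<gamma> a \<le> arclen \<gamma> b"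
  unfolding arclen_plen using assms by (intro plen_mono) auto

section \<open>Line integrals\<close>

abbreviation seg :: "(real \<Rightarrow> 'a::metric_space) \<Rightarrow> real \<Rightarrow> real \<Rightarrow> ('a \<Rightarrow> ennreal) \<Rightarrow> ennreal" where
  "seg \<gamma> a b g \<equiv> (\<integral>\<^sup>+ t\<in>{a..b}. g (\<gamma> t) \<partial>interval_measure (arclen \<gamma>))"

lemma line_integral_seg: "line_integral \<gamma> g = seg \<gamma> 0 1 g"
  by (simp add: line_integral_def)

lemma emeasure_arclen_Ioc:
  assumes "rectifiable_curve \<gamma>" "a \<le> b"
  shows "emeasure (interval_measure (arclen \<gamma>)) {a<..b} = ennreal (arclen \<gamma> b - arclen \<gamma> a)"
  using assms continuous_arclen[OF assms(1)]
  by (intro emeasure_interval_measure_Ioc)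
    (auto intro: mono_arclen continuous_within_subset simp: continuous_on_eq_continuous_within)

lemma emeasure_arclen_Icc:
  assumes "rectifiable_curve \<gamma>" "a \<le> b"
  shows "emeasure (interval_measure (arclen \<gamma>)) {a..b} = ennreal (arclen \<gamma> b - arclen \<gamma> a)"
  using assms by (intro emeasure_interval_measure_Icc) (auto intro: mono_arclen continuous_arclen)

text \<open>\<open>arclen\<close> is constant to the right of 1, so the intervals that exhaust the
  ray eventually have the same mass.\<close>

lemma emeasure_arclen_Ioi:
  assumes rc: "rectifiable_curve \<gamma>"
  shows "emeasure (interval_measure (arclen \<gamma>)) {x<..} = ennreal (arclen \<gamma> 1 - arclen \<gamma> x)"
proof -
  let ?m = "interval_measure (arclen \<gamma>)"
  have eq: "{x<..} = (\<Union>n::nat. {x<..x + real n})"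
  proof safe
    fix t assume "x < t"
    obtain n where "t - x \<le> real n" using real_arch_simple by blast
    then show "t \<in> (\<Union>n::nat. {x<..x + real n})" using \<open>x < t\<close> by (intro UN_I[of n]) auto
  qed auto
  have "(\<lambda>n. emeasure ?m {x<..x + real n}) \<longlonglongrightarrow> emeasure ?m (\<Union>n::nat. {x<..x + real n})"
    by (intro Lim_emeasure_incseq) (auto simp: incseq_def)
  moreover have "(\<lambda>n. emeasure ?m {x<..x + real n}) \<longlonglongrightarrow> ennreal (arclen \<gamma> 1 - arclen \<gamma> x)"
  proof (rule tendsto_eventually)
    obtain N where N: "1 - x \<le> real N" using real_arch_simple by blast
    show "\<forall>\<^sub>F n in sequentially. emeasure ?m {x<..x + real n} = ennreal (arclen \<gamma> 1 - arclen \<gamma> x)"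
      using eventually_ge_at_top[of N]
    proof eventually_elim
      case (elim n)
      have "1 \<le> x + real n" using N elim by linarith
      then have "arclen \<gamma> (x + real n) = arclen \<gamma> 1" by (simp add: arclen_plen)
      then show ?case by (simp add: emeasure_arclen_Ioc[OF rc])
    qed
  qed
  ultimately show ?thesis unfolding eq by (rule LIMSEQ_unique)
qed

lemma emeasure_arclen_UNIV:
  assumes rc: "rectifiable_curve \<gamma>"
  shows "emeasure (interval_measure (arclen \<gamma>)) UNIV = ennreal (plen \<gamma> 0 1)"
proof -
  let ?m = "interval_measure (arclen \<gamma>)"
  have eq: "(UNIV::real set) = (\<Union>n::nat. {- real n<..})"
    using reals_Archimedean2 by (auto simp: minus_less_iff)
  have "(\<lambda>n. emeasure ?m {- real n<..}) \<longlonglongrightarrow> emeasure ?m (\<Union>n::nat. {- real n<..})"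
    by (intro Lim_emeasure_incseq) (auto simp: incseq_def)
  moreover have "emeasure ?m {- real n<..} = ennreal (plen \<gamma> 0 1)" for n
    unfolding emeasure_arclen_Ioi[OF rc] by (simp add: arclen_plen)
  ultimately show ?thesis unfolding eq by (simp add: LIMSEQ_unique)
qed

lemma finite_measure_arclen:
  assumes "rectifiable_curve \<gamma>" shows "finite_measure (interval_measure (arclen \<gamma>))"
  by standard (simp add: emeasure_arclen_UNIV[OF assms])

lemma AE_arclen:
  assumes rc: "rectifiable_curve \<gamma>"
  shows "AE t in interval_measure (arclen \<gamma>). t \<in> {0..1}"
proof (rule AE_I')
  let ?m = "interval_measure (arclen \<gamma>)"
  interpret finite_measure ?m by (rule finite_measure_arclen[OF rc])
  have "{..0::real} = UNIV - {0<..}" by auto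
  then have "emeasure ?m {..0} = emeasure ?m UNIV - emeasure ?m {0<..}"
    by (simp only:) (rule emeasure_Diff, auto simp: emeasure_arclen_Ioi[OF rc])
  also have "\<dots> = 0" by (simp add: emeasure_arclen_Ioi[OF rc] emeasure_arclen_UNIV[OF rc] arclen_plen)
  finally have 0: "{..0} \<in> null_sets ?m" by (auto simp: null_sets_def)
  have 1: "{1<..} \<in> null_sets ?m" by (auto simp: null_sets_def emeasure_arclen_Ioi[OF rc])
  show "{..0} \<union> {1<..} \<in> null_sets ?m" using 0 1 by auto
qed auto

text \<open>Continuity of arc length excludes atoms; therefore closed segments may share an endpoint
  in \<open>seg_split\<close>.\<close>

lemma null_sets_arclen_point:
  assumes "rectifiable_curve \<gamma>"
  shows "{x} \<in> null_sets (interval_measure (arclen \<gamma>))"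
  using emeasure_arclen_Icc[OF assms, of x x] by (auto simp: null_sets_def)

text \<open>A rectifiable curve is known to be continuous on \<open>{0..1}\<close> only; clamping
  the parameter extends it continuously to the line.\<close>

lemma borel_measurable_curve:
  fixes \<gamma> :: "real \<Rightarrow> 'a::metric_space"
  assumes "rectifiable_curve \<gamma>" "g \<in> borel_measurable borel" "A \<in> sets borel" "A \<subseteq> {0..1}"
  shows "(\<lambda>t. g (\<gamma> t) * indicator A t :: ennreal) \<in> borel_measurable borel"
proof -
  have "continuous_on UNIV (\<lambda>t. \<gamma> (max 0 (min 1 t)))"
    by (rule continuous_on_compose2[of "{0..1}" \<gamma>])
      (use assms in \<open>auto simp: rectifiable_curve_def intro!: continuous_intros\<close>)
  then have [measurable]: "(\<lambda>t. \<gamma> (max 0 (min 1 t))) \<in> borel_measurable borel"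
    by (rule borel_measurable_continuous_onI)
  note [measurable] = assms(2,3)
  have "(\<lambda>t. g (\<gamma> (max 0 (min 1 t))) * indicator A t) \<in> borel_measurable borel" by measurable
  also have "(\<lambda>t. g (\<gamma> (max 0 (min 1 t))) * indicator A t) = (\<lambda>t. g (\<gamma> t) * indicator A t)"
  proof
    fix t show "g (\<gamma> (max 0 (min 1 t))) * indicator A t = g (\<gamma> t) * indicator A t"
      using assms(4) by (cases "t \<in> A") auto
  qed
  finally show ?thesis .
qed

lemma seg_measurable [measurable (raw)]:
  assumes "rectifiable_curve \<gamma>" "g \<in> borel_measurable borel" "0 \<le> a" "b \<le> 1"
  shows "(\<lambda>t. g (\<gamma> t) * indicator {a..b} t :: ennreal) \<in> borel_measurable (interval_measure (arclen \<gamma>))"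
  using borel_measurable_curve[OF assms(1,2), of "{a..b}"] assms(3,4) by simp

lemma seg_split:
  assumes rc: "rectifiable_curve \<gamma>" and g: "g \<in> borel_measurable borel"
    and "0 \<le> a" "a \<le> b" "b \<le> c" "c \<le> 1"
  shows "seg \<gamma> a c g = seg \<gamma> a b g + seg \<gamma> b c g"
proof -
  have "seg \<gamma> a c g = (\<integral>\<^sup>+ t. (g (\<gamma> t) * indicator {a..b} t + g (\<gamma> t) * indicator {b..c} t) \<partial>interval_measure (arclen \<gamma>))"
    using assms by (intro nn_integral_cong_AE AE_I'[OF null_sets_arclen_point[OF rc, of b]])
      (auto simp: indicator_def)
  also have "\<dots> = seg \<gamma> a b g + seg \<gamma> b c g"
    using assms by (intro nn_integral_add seg_measurable) auto
  finally show ?thesis .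
qed

lemma line_integral_add:
  assumes "rectifiable_curve \<gamma>" "f \<in> borel_measurable borel" "g \<in> borel_measurable borel"
  shows "line_integral \<gamma> (\<lambda>x. f x + g x) = line_integral \<gamma> f + line_integral \<gamma> g"
  unfolding line_integral_def distrib_right using assms by (intro nn_integral_add seg_measurable) auto

lemma line_integral_cmult:
  assumes "rectifiable_curve \<gamma>" "g \<in> borel_measurable borel"
  shows "line_integral \<gamma> (\<lambda>x. c * g x) = c * line_integral \<gamma> g"
  unfolding line_integral_def mult.assoc using assms by (intro nn_integral_cmult seg_measurable) auto

lemma line_integral_mono:
  assumes "\<And>t. t \<in> {0..1} \<Longrightarrow> f (\<gamma> t) \<le> g (\<gamma> t)"
  shows "line_integral \<gamma> f \<le> line_integral \<gamma> g"
  unfolding line_integral_def using assms by (intro nn_integral_mono) (auto simp: indicator_def)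

lemma line_integral_mono':
  assumes "\<And>x. f x \<le> g x" shows "line_integral \<gamma> f \<le> line_integral \<gamma> g"
  using assms by (intro line_integral_mono) auto

lemma plen_cong: "(\<And>t. t \<in> {a..b} \<Longrightarrow> \<gamma> t = \<sigma> t) \<Longrightarrow> plen \<gamma> a b = plen \<sigma> a b"
  unfolding plen_def by (intro arg_cong[of _ _ Sup] Collect_cong iffI) (auto elim: psum_cong)

lemma line_integral_cong:
  assumes "\<And>t. t \<in> {0..1} \<Longrightarrow> \<gamma> t = \<sigma> t" shows "line_integral \<gamma> g = line_integral \<sigma> g"
proof -
  have "arclen \<gamma> = arclen \<sigma>" unfolding arclen_plen using assms by (intro ext plen_cong) auto
  moreover have "g (\<gamma> t) * indicator {0..1} t = g (\<sigma> t) * indicator {0..1} t" for t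
    using assms[of t] by (cases "t \<in> {0..1}") auto
  ultimately show ?thesis unfolding line_integral_def by simp
qed

section \<open>Monotone change of parameter\<close>

context
  fixes \<gamma> :: "real \<Rightarrow> 'a::metric_space" and \<alpha> :: "real \<Rightarrow> real"
  assumes rc: "rectifiable_curve \<gamma>" and cont: "continuous_on {0..1} \<alpha>"
    and mono: "\<And>s t. 0 \<le> s \<Longrightarrow> s \<le> t \<Longrightarrow> t \<le> 1 \<Longrightarrow> \<alpha> s \<le> \<alpha> t"
    and rng: "0 \<le> \<alpha> 0" "\<alpha> 1 \<le> 1"
begin

lemma plen_reparam: "0 \<le> t \<Longrightarrow> t \<le> 1 \<Longrightarrow> plen (\<gamma> \<circ> \<alpha>) 0 t = plen \<gamma> (\<alpha> 0) (\<alpha> t)"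
  unfolding plen_def
proof (intro arg_cong[of _ _ Sup] Collect_cong iffI)
  fix S assume t: "0 \<le> t" "t \<le> 1"
  show "psum \<gamma> (\<alpha> 0) (\<alpha> t) S" if "psum (\<gamma> \<circ> \<alpha>) 0 t S"
    using that by (rule psum_reparam) (use t mono in auto)
  show "psum (\<gamma> \<circ> \<alpha>) 0 t S" if "psum \<gamma> (\<alpha> 0) (\<alpha> t) S"
    using that by (rule psum_reparam_conv) (use t continuous_on_subset[OF cont] in auto)
qed

lemma rectifiable_reparam: "rectifiable_curve (\<gamma> \<circ> \<alpha>)"
  unfolding rectifiable_curve_iff
proof
  have "\<alpha> t \<in> {0..1}" if "t \<in> {0..1}" for t using mono[of 0 t] mono[of t 1] rng that by auto
  then show "continuous_on {0..1} (\<gamma> \<circ> \<alpha>)"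
    using rc cont unfolding rectifiable_curve_def
    by (intro continuous_on_compose) (auto elim: continuous_on_subset)
  have "S \<le> plen \<gamma> (\<alpha> 0) (\<alpha> 1)" if "psum (\<gamma> \<circ> \<alpha>) 0 1 S" for S
    using rng rc psum_reparam[OF that] mono by (intro plen_upper) auto
  then show "bdd_above {S. psum (\<gamma> \<circ> \<alpha>) 0 1 S}" by (intro bdd_aboveI[of _ "plen \<gamma> (\<alpha> 0) (\<alpha> 1)"]) auto
qed

text \<open>Finite measures on the line are determined by the rays \<open>{x<..}\<close>, and both
  sides give such a ray the length of the part of the curve beyond \<open>x\<close>.
  \<open>\<alpha>\<close> may have plateaus; they carry no length.\<close>

lemma distr_arclen_reparam:
  "distr (interval_measure (arclen (\<gamma> \<circ> \<alpha>))) borel (\<lambda>t. \<alpha> (max 0 (min 1 t)))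
    = density (interval_measure (arclen \<gamma>)) (indicator {\<alpha> 0..\<alpha> 1})" (is "?D = ?R")
proof -
  let ?a = "\<lambda>t. \<alpha> (max 0 (min 1 t))"
  note rc' = rectifiable_reparam
  have "continuous_on UNIV ?a"
    by (rule continuous_on_compose2[OF cont]) (auto intro!: continuous_intros)
  then have [measurable]: "?a \<in> borel_measurable borel" by (rule borel_measurable_continuous_onI)
  have D: "emeasure ?D {x<..} = emeasure (interval_measure (arclen (\<gamma> \<circ> \<alpha>))) {t. x < ?a t}" for x
    by (subst emeasure_distr) (auto simp: vimage_def)
  have R: "emeasure ?R {x<..} = emeasure (interval_measure (arclen \<gamma>)) ({\<alpha> 0..\<alpha> 1} \<inter> {x<..})" for x
    by (subst emeasure_density) (auto simp: indicator_inter_arith[symmetric])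
  have ab: "\<alpha> 0 \<le> \<alpha> 1" using mono[of 0 1] by auto
  have ar: "arclen \<gamma> t = plen \<gamma> 0 t" if "0 \<le> t" "t \<le> 1" for t using that by (simp add: arclen_plen)
  have ar': "arclen (\<gamma> \<circ> \<alpha>) t = plen \<gamma> (\<alpha> 0) (\<alpha> t)" if "0 \<le> t" "t \<le> 1" for t
    using that by (simp add: arclen_plen plen_reparam)
  have "emeasure ?D {x<..} = emeasure ?R {x<..}" for x
  proof -
    consider "x < \<alpha> 0" | "\<alpha> 1 \<le> x" | "\<alpha> 0 \<le> x" "x < \<alpha> 1" by linarith
    then show ?thesis
    proof cases
      case 1
      have "{t. x < ?a t} = UNIV" using mono[of 0] 1 by (force intro: less_le_trans)
      moreover have "{\<alpha> 0..\<alpha> 1} \<inter> {x<..} = {\<alpha> 0..\<alpha> 1}" using 1 by auto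
      ultimately show ?thesis unfolding D R
        using emeasure_arclen_UNIV[OF rc'] emeasure_arclen_Icc[OF rc ab] arclen_diff[OF rc rng(1) ab rng(2)]
          plen_reparam[of 1] by simp
    next
      case 2
      have "?a t \<le> x" for t using mono[of "max 0 (min 1 t)" 1] 2 by auto
      then have "{t. x < ?a t} = {}" by (auto simp: not_less)
      moreover have "{\<alpha> 0..\<alpha> 1} \<inter> {x<..} = {}" using 2 by auto
      ultimately show ?thesis unfolding D R by simp
    next
      case 3
      \<comment> \<open>The ray beyond \<open>x\<close> pulls back to the parameters after
        \<open>s\<close>, the last one with \<open>\<alpha> s \<le> x\<close>; if
        \<open>\<alpha>\<close> has a plateau at height \<open>x\<close>, this is its right
        end.\<close>
      define K where "K = {0..1} \<inter> \<alpha> -` {..x}"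
      have "closed K" unfolding K_def by (intro continuous_closed_preimage[OF cont] closed_atLeastAtMost closed_atMost)
      moreover have "bounded K" by (rule bounded_subset[of "{0..1}"]) (auto simp: K_def)
      ultimately have "compact K" by (simp add: compact_eq_bounded_closed)
      moreover have "0 \<in> K" using 3 by (auto simp: K_def)
      ultimately obtain s where "s \<in> K" and sup: "\<And>t. t \<in> K \<Longrightarrow> t \<le> s"
        using compact_attains_sup[of K] by blast
      then have s: "s \<in> {0..1}" "\<alpha> s \<le> x" "\<And>t. t \<in> {0..1} \<Longrightarrow> \<alpha> t \<le> x \<Longrightarrow> t \<le> s"
        by (auto simp: K_def)
      have "continuous_on {s..1} \<alpha>" using cont by (rule continuous_on_subset) (use s in auto)
      then obtain t where t: "s \<le> t" "t \<le> 1" "\<alpha> t = x"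
        using IVT'[of \<alpha> s x 1] s(1,2) 3 by auto
      have sx: "\<alpha> s = x" using s(3)[of t] t s(1) by auto
      have "{t. x < ?a t} = {s<..}"
      proof (intro set_eqI iffI)
        fix t assume "t \<in> {t. x < ?a t}"
        then have "x < ?a t" by simp
        then have "\<not> max 0 (min 1 t) \<le> s"
          using mono[of "max 0 (min 1 t)" s] s sx by auto
        then show "t \<in> {s<..}" using s(1) by auto
      next
        fix t assume "t \<in> {s<..}"
        then have t: "s < t" by simp
        show "t \<in> {t. x < ?a t}"
        proof (cases "t \<le> 1")
          case True
          then have "\<not> \<alpha> t \<le> x" "max 0 (min 1 t) = t" using s(1) s(3)[of t] t by auto
          then show ?thesis by simp
        next
          case False then show ?thesis using 3 by auto
        qed
      qed
      moreover have "{\<alpha> 0..\<alpha> 1} \<inter> {x<..} = {x<..\<alpha> 1}" using 3 by auto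
      moreover have "plen \<gamma> (\<alpha> 0) (\<alpha> 1) = plen \<gamma> (\<alpha> 0) x + plen \<gamma> x (\<alpha> 1)"
        using plen_add[OF rc rng(1), of x "\<alpha> 1"] 3 rng by auto
      moreover have "arclen \<gamma> (\<alpha> 1) - arclen \<gamma> x = plen \<gamma> x (\<alpha> 1)"
        using arclen_diff[OF rc, of x "\<alpha> 1"] 3 rng by auto
      moreover have "arclen (\<gamma> \<circ> \<alpha>) s = plen \<gamma> (\<alpha> 0) x" using ar'[of s] s sx by auto
      moreover have "arclen (\<gamma> \<circ> \<alpha>) 1 = plen \<gamma> (\<alpha> 0) (\<alpha> 1)" using ar'[of 1] by auto
      ultimately show ?thesis unfolding D R
        using emeasure_arclen_Ioc[OF rc, of x "\<alpha> 1"] 3 emeasure_arclen_Ioi[OF rc', of s] by simp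
    qed
  qed
  moreover have "emeasure ?D {x<..} < \<infinity>" for x
  proof -
    interpret finite_measure "interval_measure (arclen (\<gamma> \<circ> \<alpha>))" by (rule finite_measure_arclen[OF rc'])
    show ?thesis unfolding D using emeasure_finite[of "{t. x < ?a t}"] by (simp add: less_top[symmetric])
  qed
  ultimately show ?thesis by (intro measure_eqI_lessThan) auto
qed

text \<open>Serves both for subcurves and for the arc length parametrization, where the given curve
  is recovered as \<open>\<sigma> \<circ> \<alpha>\<close>.\<close>

lemma line_integral_reparam:
  assumes g: "g \<in> borel_measurable borel"
  shows "line_integral (\<gamma> \<circ> \<alpha>) g = seg \<gamma> (\<alpha> 0) (\<alpha> 1) g"
proof -
  let ?a = "\<lambda>t. \<alpha> (max 0 (min 1 t))"
  let ?G = "\<lambda>t. g (\<gamma> t) * indicator {0..1} t"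
  have "continuous_on UNIV ?a"
    by (rule continuous_on_compose2[OF cont]) (auto intro!: continuous_intros)
  then have [measurable]: "?a \<in> borel_measurable borel" by (rule borel_measurable_continuous_onI)
  have G[measurable]: "?G \<in> borel_measurable borel" by (intro borel_measurable_curve rc g) auto
  have "line_integral (\<gamma> \<circ> \<alpha>) g = (\<integral>\<^sup>+ t. ?G (?a t) \<partial>interval_measure (arclen (\<gamma> \<circ> \<alpha>)))"
    unfolding line_integral_def
  proof (rule nn_integral_cong_AE, use AE_arclen[OF rectifiable_reparam] in eventually_elim)
    case (elim t)
    have "\<alpha> t \<in> {0..1}" using mono[of 0 t] mono[of t 1] rng elim by auto
    moreover have "max 0 (min 1 t) = t" using elim by auto
    ultimately show ?case using elim by simp
  qed
  also have "\<dots> = (\<integral>\<^sup>+ t. ?G t \<partial>distr (interval_measure (arclen (\<gamma> \<circ> \<alpha>))) borel ?a)"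
    by (subst nn_integral_distr) auto
  also have "\<dots> = (\<integral>\<^sup>+ t. indicator {\<alpha> 0..\<alpha> 1} t * ?G t \<partial>interval_measure (arclen \<gamma>))"
    unfolding distr_arclen_reparam by (subst nn_integral_density) auto
  also have "\<dots> = seg \<gamma> (\<alpha> 0) (\<alpha> 1) g"
    using rng by (intro nn_integral_cong) (auto simp: indicator_def)
  finally show ?thesis .
qed

end

definition subcurve :: "real \<Rightarrow> real \<Rightarrow> (real \<Rightarrow> 'a) \<Rightarrow> real \<Rightarrow> 'a" where
  "subcurve a b \<gamma> = \<gamma> \<circ> (\<lambda>t. a + (b - a) * t)"

lemma subcurve_0 [simp]: "subcurve a b \<gamma> 0 = \<gamma> a" and subcurve_1 [simp]: "subcurve a b \<gamma> 1 = \<gamma> b"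
  by (auto simp: subcurve_def)

lemma subcurve_in:
  assumes "a \<le> b" "t \<in> {0..1}" shows "\<exists>s\<in>{a..b}. subcurve a b \<gamma> t = \<gamma> s"
proof (rule bexI[of _ "a + (b - a) * t"])
  have "0 \<le> (b - a) * t" "(b - a) * t \<le> b - a" using assms by (auto intro: mult_left_le)
  then show "a + (b - a) * t \<in> {a..b}" by auto
qed (simp add: subcurve_def)

lemma
  assumes "rectifiable_curve \<gamma>" "0 \<le> a" "a \<le> b" "b \<le> 1"
  shows rectifiable_subcurve: "rectifiable_curve (subcurve a b \<gamma>)"
    and line_integral_subcurve: "g \<in> borel_measurable borel \<Longrightarrow> line_integral (subcurve a b \<gamma>) g = seg \<gamma> a b g"
proof -
  let ?a = "\<lambda>t. a + (b - a) * t"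
  have 1: "continuous_on {0..1} ?a" by (intro continuous_intros)
  have 2: "?a s \<le> ?a t" if "s \<le> t" for s t using assms that by (simp add: mult_left_mono)
  show "rectifiable_curve (subcurve a b \<gamma>)" unfolding subcurve_def
    using assms by (intro rectifiable_reparam 1 2) auto
  show "g \<in> borel_measurable borel \<Longrightarrow> line_integral (subcurve a b \<gamma>) g = seg \<gamma> a b g" unfolding subcurve_def
    using assms by (subst line_integral_reparam[OF _ 1 2]) auto
qed

text \<open>Reversal is decreasing and so is not covered by \<open>line_integral_reparam\<close>.
  The measures are again compared on rays, now through complements, since \<open>1 - t\<close> turns
  right rays into left rays.\<close>

lemma line_integral_reverse:
  assumes rc: "rectifiable_curve \<gamma>" and g: "g \<in> borel_measurable borel"
  shows "line_integral (\<lambda>t. \<gamma> (1 - t)) g = line_integral \<gamma> g"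
proof -
  let ?r = "\<lambda>t::real. \<gamma> (1 - t)"
  let ?m = "interval_measure (arclen \<gamma>)" and ?m' = "interval_measure (arclen ?r)"
  let ?G = "\<lambda>t. g (\<gamma> t) * indicator {0..1} t"
  note rc' = rectifiable_reverse[OF rc]
  have G[measurable]: "?G \<in> borel_measurable borel" by (intro borel_measurable_curve rc g) auto
  have ar: "arclen ?r t = plen \<gamma> 0 1 - arclen \<gamma> (1 - t)" for t
  proof -
    define s where "s = max 0 (min 1 t)"
    have s: "0 \<le> s" "s \<le> 1" "max 0 (min 1 (1 - t)) = 1 - s" by (auto simp: s_def)
    have "plen \<gamma> 0 1 = plen \<gamma> 0 (1 - s) + plen \<gamma> (1 - s) 1" using s by (intro plen_add rc) auto
    then show ?thesis by (simp add: arclen_plen s(3) plen_reverse s_def[symmetric])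
  qed
  have "distr ?m' borel (\<lambda>t. 1 - t) = ?m"
  proof (rule measure_eqI_lessThan)
    interpret m: finite_measure ?m by (rule finite_measure_arclen[OF rc])
    interpret m': finite_measure ?m' by (rule finite_measure_arclen[OF rc'])
    fix x
    have 1: "emeasure (distr ?m' borel (\<lambda>t. 1 - t)) {x<..} = emeasure ?m' {..<1-x}"
      by (subst emeasure_distr) (auto intro!: arg_cong[of _ _ "emeasure ?m'"])
    have "emeasure ?m' {..<1-x} = emeasure ?m' {..1-x}"
      by (intro emeasure_eq_AE AE_I'[OF null_sets_arclen_point[OF rc', of "1-x"]]) auto
    also have "{..1-x} = UNIV - {1-x<..}" by auto
    also have "emeasure ?m' \<dots> = emeasure ?m' UNIV - emeasure ?m' {1-x<..}"
      by (rule emeasure_Diff) auto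
    also have "\<dots> = ennreal (plen ?r 0 1) - ennreal (arclen ?r 1 - arclen ?r (1 - x))"
      by (simp add: emeasure_arclen_Ioi[OF rc'] emeasure_arclen_UNIV[OF rc'])
    also have "\<dots> = ennreal (plen ?r 0 1 - (arclen ?r 1 - arclen ?r (1 - x)))"
      by (intro ennreal_minus) (auto simp: mono_arclen[OF rc'] arclen_plen intro!: plen_mono rc')
    also have "\<dots> = ennreal (arclen \<gamma> 1 - arclen \<gamma> x)"
      unfolding ar by (simp add: plen_reverse) (simp add: arclen_plen)
    also have "\<dots> = emeasure ?m {x<..}" by (simp add: emeasure_arclen_Ioi[OF rc])
    finally have 2: "emeasure ?m' {..<1-x} = emeasure ?m {x<..}" .
    show "emeasure (distr ?m' borel (\<lambda>t. 1 - t)) {x<..} = emeasure ?m {x<..}"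
      unfolding 1 2 ..
    then show "emeasure (distr ?m' borel (\<lambda>t. 1 - t)) {x<..} < \<infinity>"
      by (simp add: m.emeasure_finite less_top[symmetric])
  qed auto
  then have "line_integral \<gamma> g = (\<integral>\<^sup>+ t. ?G t \<partial>distr ?m' borel (\<lambda>t. 1 - t))"
    by (simp add: line_integral_def)
  also have "\<dots> = (\<integral>\<^sup>+ t. ?G (1 - t) \<partial>?m')" by (subst nn_integral_distr) auto
  also have "\<dots> = line_integral ?r g" unfolding line_integral_def
    by (intro nn_integral_cong) (auto simp: indicator_def)
  finally show ?thesis by simp
qed

section \<open>Lipschitz curves, arc length parametrization, concatenation\<close>

lemma lipschitz_rectifiable:
  assumes L: "\<And>s t. 0 \<le> s \<Longrightarrow> s \<le> t \<Longrightarrow> t \<le> 1 \<Longrightarrow> dist (\<gamma> s) (\<gamma> t) \<le> L * (t - s)"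
  shows "rectifiable_curve \<gamma>"
    and "0 \<le> a \<Longrightarrow> a \<le> b \<Longrightarrow> b \<le> 1 \<Longrightarrow> plen \<gamma> a b \<le> L * (b - a)"
proof -
  have 1: "psum \<gamma> a b S \<Longrightarrow> 0 \<le> a \<Longrightarrow> b \<le> 1 \<Longrightarrow> S \<le> L * (b - a)" for a b S
  proof (induction rule: psum.induct)
    case (psum_step c S b)
    have "dist (\<gamma> c) (\<gamma> b) \<le> L * (b - c)" using psum_step psum_le[OF psum_step.hyps(1)] by (intro L) auto
    moreover have "S \<le> L * (c - a)" using psum_step by auto
    ultimately show ?case by (simp add: algebra_simps)
  qed auto
  have "dist (\<gamma> s) (\<gamma> t) \<le> L * dist s t" if "s \<in> {0..1}" "t \<in> {0..1}" for s t
    using L[of s t] L[of t s] that by (cases "s \<le> t") (auto simp: dist_real_def dist_commute abs_if)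
  moreover have "0 \<le> L" using order_trans[OF zero_le_dist L[of 0 1]] by simp
  ultimately have "L-lipschitz_on {0..1} \<gamma>" by (intro lipschitz_onI) auto
  then have "continuous_on {0..1} \<gamma>" by (rule lipschitz_on_continuous_on)
  moreover have "bdd_above {S. psum \<gamma> 0 1 S}" using 1[of 0 1] by (intro bdd_aboveI[of _ L]) auto
  ultimately show "rectifiable_curve \<gamma>" by (simp add: rectifiable_curve_iff)
  show "0 \<le> a \<Longrightarrow> a \<le> b \<Longrightarrow> b \<le> 1 \<Longrightarrow> plen \<gamma> a b \<le> L * (b - a)"
    by (rule plen_least) (use 1 in auto)
qed

text \<open>\<open>\<sigma>\<close> is \<open>\<gamma>\<close> after a right inverse
  \<open>\<beta>\<close> of the normalized length \<open>\<alpha>\<close>. \<open>\<beta>\<close>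
  may jump, but \<open>\<gamma>\<close> is constant between parameters of equal length; so
  \<open>\<sigma>\<close> is Lipschitz and \<open>\<gamma> = \<sigma> \<circ> \<alpha>\<close> on
  \<open>{0..1}\<close>, which transfers the integrals.\<close>

lemma arclength_parametrization:
  fixes \<gamma> :: "real \<Rightarrow> 'a::metric_space"
  assumes rc: "rectifiable_curve \<gamma>"
  shows "\<exists>\<sigma>. rectifiable_curve \<sigma> \<and> \<sigma> 0 = \<gamma> 0 \<and> \<sigma> 1 = \<gamma> 1 \<and>
    (\<forall>s t. 0 \<le> s \<longrightarrow> s \<le> t \<longrightarrow> t \<le> 1 \<longrightarrow> dist (\<sigma> s) (\<sigma> t) \<le> plen \<gamma> 0 1 * (t - s)) \<and>
    (\<forall>g. g \<in> borel_measurable borel \<longrightarrow> line_integral \<sigma> g = line_integral \<gamma> g)"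
proof (cases "plen \<gamma> 0 1 = 0")
  case True
  have "dist (\<gamma> s) (\<gamma> t) \<le> plen \<gamma> 0 1 * (t - s)" if "0 \<le> s" "s \<le> t" "t \<le> 1" for s t
  proof -
    have "dist (\<gamma> s) (\<gamma> t) \<le> 0"
      using plen_ge_dist[OF rc that] plen_mono[OF rc, of 0 s t 1] that True by linarith
    then show ?thesis using True by simp
  qed
  then show ?thesis using rc by (intro exI[of _ \<gamma>]) auto
next
  case False
  define L where "L = plen \<gamma> 0 1"
  have L: "L > 0" using False plen_nonneg[OF rc, of 0 1] by (auto simp: L_def)
  define \<alpha> where "\<alpha> t = plen \<gamma> 0 t / L" for t
  have cont: "continuous_on {0..1} \<alpha>" unfolding \<alpha>_def using L
    by (intro continuous_intros continuous_plen rc) auto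
  have mono: "\<alpha> s \<le> \<alpha> t" if "0 \<le> s" "s \<le> t" "t \<le> 1" for s t
    unfolding \<alpha>_def using L plen_mono[OF rc, of 0 0 s t] that by (auto intro!: divide_right_mono)
  have \<alpha>01: "\<alpha> 0 = 0" "\<alpha> 1 = 1" using L by (auto simp: \<alpha>_def L_def)
  define \<beta> where "\<beta> y = (SOME t. t \<in> {0..1} \<and> \<alpha> t = y)" for y
  have \<beta>: "\<beta> y \<in> {0..1}" "\<alpha> (\<beta> y) = y" if "0 \<le> y" "y \<le> 1" for y
  proof -
    have "\<exists>t. t \<in> {0..1} \<and> \<alpha> t = y" using IVT'[of \<alpha> 0 y 1] that cont \<alpha>01 by auto
    then have "\<beta> y \<in> {0..1} \<and> \<alpha> (\<beta> y) = y" unfolding \<beta>_def by (rule someI_ex)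
    then show "\<beta> y \<in> {0..1}" "\<alpha> (\<beta> y) = y" by auto
  qed
  have d: "dist (\<gamma> s) (\<gamma> t) \<le> L * \<bar>\<alpha> t - \<alpha> s\<bar>" if "s \<in> {0..1}" "t \<in> {0..1}" for s t
  proof -
    have *: "dist (\<gamma> s) (\<gamma> t) \<le> L * \<bar>\<alpha> t - \<alpha> s\<bar>" if "0 \<le> s" "s \<le> t" "t \<le> 1" for s t
    proof -
      have "plen \<gamma> 0 t = plen \<gamma> 0 s + plen \<gamma> s t" using plen_add[OF rc, of 0 s t] that by auto
      then have "L * (\<alpha> t - \<alpha> s) = plen \<gamma> s t" using L by (simp add: \<alpha>_def field_simps)
      then have "plen \<gamma> s t \<le> L * \<bar>\<alpha> t - \<alpha> s\<bar>" using L by (metis abs_ge_self mult_left_mono less_imp_le)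
      then show ?thesis using plen_ge_dist[OF rc that] by linarith
    qed
    show ?thesis using *[of s t] *[of t s] that
      by (cases "s \<le> t") (auto simp: dist_commute abs_minus_commute)
  qed
  define \<sigma> where "\<sigma> = \<gamma> \<circ> \<beta>"
  have eq: "\<gamma> t = (\<sigma> \<circ> \<alpha>) t" if t: "t \<in> {0..1}" for t
  proof -
    have "0 \<le> \<alpha> t" "\<alpha> t \<le> 1" using mono[of 0 t] mono[of t 1] t \<alpha>01 by auto
    from \<beta>[OF this] d[of t "\<beta> (\<alpha> t)"] t show ?thesis by (simp add: \<sigma>_def)
  qed
  have lip: "dist (\<sigma> s) (\<sigma> t) \<le> L * (t - s)" if "0 \<le> s" "s \<le> t" "t \<le> 1" for s t
    using d[of "\<beta> s" "\<beta> t"] \<beta>[of s] \<beta>[of t] that by (simp add: \<sigma>_def)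
  have rc\<sigma>: "rectifiable_curve \<sigma>" by (rule lipschitz_rectifiable(1)[OF lip])
  show ?thesis
  proof (rule exI[of _ \<sigma>], intro conjI allI impI)
    show "\<sigma> 0 = \<gamma> 0" "\<sigma> 1 = \<gamma> 1" using eq[of 0] eq[of 1] \<alpha>01 by auto
    fix g :: "'a \<Rightarrow> ennreal" assume g: "g \<in> borel_measurable borel"
    have "line_integral \<gamma> g = line_integral (\<sigma> \<circ> \<alpha>) g" by (rule line_integral_cong) (rule eq)
    also have "\<dots> = seg \<sigma> (\<alpha> 0) (\<alpha> 1) g"
      using \<alpha>01 by (intro line_integral_reparam rc\<sigma> cont mono g) auto
    finally show "line_integral \<sigma> g = line_integral \<gamma> g" by (simp add: \<alpha>01 line_integral_seg)
  qed (use rc\<sigma> lip in \<open>auto simp: L_def\<close>)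
qed

lemma
  fixes \<gamma> \<sigma> :: "real \<Rightarrow> 'a::metric_space"
  assumes rc: "rectifiable_curve \<gamma>" "rectifiable_curve \<sigma>" and eq: "\<gamma> 1 = \<sigma> 0"
  shows rectifiable_join: "rectifiable_curve (\<gamma> +++ \<sigma>)"
    and line_integral_join: "g \<in> borel_measurable borel \<Longrightarrow>
      line_integral (\<gamma> +++ \<sigma>) g = line_integral \<gamma> g + line_integral \<sigma> g"
proof -
  let ?J = "\<gamma> +++ \<sigma>"
  have J1: "?J t = (\<gamma> \<circ> (\<lambda>t. 2 * t)) t" if "t \<le> 1/2" for t using that by (simp add: joinpaths_def)
  have J2: "?J t = (\<sigma> \<circ> (\<lambda>t. 2 * t - 1)) t" if "t \<ge> 1/2" for t
  proof (cases "t = 1/2")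
    case True
    show ?thesis unfolding True using eq by (simp add: joinpaths_def)
  qed (use that in \<open>simp add: joinpaths_def\<close>)
  have "path ?J" using rc eq by (simp add: path_def pathfinish_def pathstart_def rectifiable_curve_def path_join[unfolded path_def])
  moreover have "S \<le> plen \<gamma> 0 1 + plen \<sigma> 0 1" if S: "psum ?J 0 1 S" for S
  proof -
    obtain S1 S2 where *: "psum ?J 0 (1/2) S1" "psum ?J (1/2) 1 S2" "S \<le> S1 + S2"
      using psum_split[OF S, of "1/2"] by auto
    have "psum (\<gamma> \<circ> (\<lambda>t. 2 * t)) 0 (1/2) S1" using *(1) by (rule psum_cong) (use J1 in auto)
    from psum_reparam[OF this] have "psum \<gamma> 0 1 S1" by simp
    moreover have "psum (\<sigma> \<circ> (\<lambda>t. 2 * t - 1)) (1/2) 1 S2" using *(2) by (rule psum_cong) (use J2 in auto)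
    from psum_reparam[OF this] have "psum \<sigma> 0 1 S2" by simp
    ultimately show ?thesis using *(3) plen_upper[OF rc(1), of 0 1 S1] plen_upper[OF rc(2), of 0 1 S2] by auto
  qed
  ultimately show rJ: "rectifiable_curve ?J"
    unfolding rectifiable_curve_iff path_def by (auto intro!: bdd_aboveI[of _ "plen \<gamma> 0 1 + plen \<sigma> 0 1"])
  assume g: "g \<in> borel_measurable borel"
  have "line_integral \<gamma> g = line_integral (subcurve 0 (1/2) ?J) g"
    by (rule line_integral_cong) (simp add: subcurve_def J1)
  moreover have "line_integral \<sigma> g = line_integral (subcurve (1/2) 1 ?J) g"
    by (rule line_integral_cong) (simp add: subcurve_def J2)
  ultimately show "line_integral ?J g = line_integral \<gamma> g + line_integral \<sigma> g"
    using seg_split[OF rJ g, of 0 "1/2" 1]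
    by (simp add: line_integral_subcurve[OF rJ _ _ _ g] line_integral_seg[of ?J])
qed

section \<open>Absolute continuity along curves and gluing of upper gradients\<close>

lemma seg_modulus:
  assumes rc: "rectifiable_curve \<gamma>" and g: "g \<in> borel_measurable borel" and fin: "line_integral \<gamma> g < \<infinity>"
  obtains H where "continuous_on {0..1} H"
    "\<And>a b. 0 \<le> a \<Longrightarrow> a \<le> b \<Longrightarrow> b \<le> 1 \<Longrightarrow> H a \<le> H b \<and> seg \<gamma> a b g = ennreal (H b - H a)"
proof -
  let ?m = "interval_measure (arclen \<gamma>)"
  let ?G = "\<lambda>t. g (\<gamma> t) * indicator {0..1} t"
  have G[measurable]: "?G \<in> borel_measurable borel" by (intro borel_measurable_curve rc g) auto
  \<comment> \<open>The measure with density \<open>g\<close> along the curve is finite and has no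
    atoms, so its distribution function is a continuous primitive of the line integral.\<close>
  define N where "N = density ?m ?G"
  have N: "emeasure N A = (\<integral>\<^sup>+ t. ?G t * indicator A t \<partial>?m)" if "A \<in> sets borel" for A
    unfolding N_def using that by (subst emeasure_density) auto
  have [simp]: "sets N = sets borel" "space N = UNIV" by (auto simp: N_def)
  have "emeasure N UNIV = line_integral \<gamma> g" by (subst N) (auto simp: line_integral_def)
  then interpret finite_borel_measure N
    using fin by (intro finite_borel_measure.intro finite_measureI) (auto simp: finite_borel_measure_axioms_def less_top[symmetric])
  define H where "H = cdf N"
  have "emeasure N {x} = 0" for x
  proof -
    have ae: "AE t in ?m. \<not> t = x" using AE_not_in[OF null_sets_arclen_point[OF rc, of x]] by auto
    have "emeasure N {x} = (\<integral>\<^sup>+ t. ?G t * indicator {x} t \<partial>?m)" by (rule N) simp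
    also have "\<dots> = (\<integral>\<^sup>+ t. 0 \<partial>?m)"
      by (rule nn_integral_cong_AE, use ae in eventually_elim) auto
    finally show ?thesis by simp
  qed
  then have c: "isCont H x" for x unfolding H_def isCont_cdf by (simp add: measure_def)
  have seg: "seg \<gamma> a b g = ennreal (H b - H a)" if "0 \<le> a" "a \<le> b" "b \<le> 1" for a b
  proof -
    have "AE t in ?m. \<not> t = a" using AE_not_in[OF null_sets_arclen_point[OF rc, of a]] by auto
    then have "seg \<gamma> a b g = emeasure N {a<..b}"
      using that by (subst N) (auto intro!: nn_integral_cong_AE simp: indicator_def)
    also have "\<dots> = ennreal (H b - H a)"
    proof (cases "a < b")
      case True then show ?thesis unfolding H_def by (simp add: cdf_diff_eq emeasure_eq_measure)
    next
      case False then show ?thesis using that by simp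
    qed
    finally show ?thesis .
  qed
  show thesis
  proof (rule that[of H])
    show "continuous_on {0..1} H" using c by (simp add: continuous_at_imp_continuous_on)
  qed (auto simp: seg H_def intro!: cdf_nondecreasing)
qed

text \<open>Real values and no exceptional curves: a family of zero modulus is handled beforehand,
  by adding to \<open>g\<close> a multiple of a function that is infinite along it. Constant curves
  are harmless because both end values coincide.\<close>

definition ug :: "('a::metric_space \<Rightarrow> real) \<Rightarrow> ('a \<Rightarrow> ennreal) \<Rightarrow> bool" where
  "ug f g \<longleftrightarrow> g \<in> borel_measurable borel \<and>
     (\<forall>\<gamma>. rectifiable_curve \<gamma> \<longrightarrow> ennreal \<bar>f (\<gamma> 0) - f (\<gamma> 1)\<bar> \<le> line_integral \<gamma> g)"

lemma ug_borel: "ug f g \<Longrightarrow> g \<in> borel_measurable borel"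
  by (simp add: ug_def)

lemma ugD: "ug f g \<Longrightarrow> rectifiable_curve \<gamma> \<Longrightarrow> ennreal \<bar>f (\<gamma> 0) - f (\<gamma> 1)\<bar> \<le> line_integral \<gamma> g"
  by (simp add: ug_def)

lemma ug_seg:
  assumes "ug f g" "rectifiable_curve \<gamma>" "0 \<le> a" "a \<le> b" "b \<le> 1"
  shows "ennreal \<bar>f (\<gamma> a) - f (\<gamma> b)\<bar> \<le> seg \<gamma> a b g"
  using ugD[OF assms(1) rectifiable_subcurve[OF assms(2-)]] line_integral_subcurve[OF assms(2-) ug_borel[OF assms(1)]]
  by simp

text \<open>Differences of \<open>f\<close> along the curve are dominated by differences of the
  continuous primitive from \<open>seg_modulus\<close>.\<close>

lemma ug_continuous:
  assumes ug: "ug f g" and rc: "rectifiable_curve \<gamma>" and fin: "line_integral \<gamma> g < \<infinity>"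
  shows "continuous_on {0..1} (f \<circ> \<gamma>)"
proof -
  obtain H where H: "continuous_on {0..1} H"
    "\<And>a b. 0 \<le> a \<Longrightarrow> a \<le> b \<Longrightarrow> b \<le> 1 \<Longrightarrow> H a \<le> H b \<and> seg \<gamma> a b g = ennreal (H b - H a)"
    using seg_modulus[OF rc ug_borel[OF ug] fin] by metis
  have *: "\<bar>f (\<gamma> a) - f (\<gamma> b)\<bar> \<le> \<bar>H a - H b\<bar>" if ab: "0 \<le> a" "a \<le> b" "b \<le> 1" for a b
    using ug_seg[OF ug rc ab] H(2)[OF ab] by auto
  have **: "dist (f (\<gamma> a)) (f (\<gamma> b)) \<le> dist (H a) (H b)" if "a \<in> {0..1}" "b \<in> {0..1}" for a b
    using *[of a b] *[of b a] that by (cases "a \<le> b") (auto simp: dist_real_def abs_minus_commute)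
  show ?thesis unfolding continuous_on_iff o_def
    using H(1)[unfolded continuous_on_iff] ** by (meson le_less_trans)
qed

text \<open>A curve leaves the open set where \<open>\<phi> > 0\<close> through a zero of \<open>F\<close>.\<close>

lemma glue_end:
  assumes rc: "rectifiable_curve \<gamma>" and e: "e \<in> borel_measurable borel"
    and cont: "continuous_on {0..1} (\<phi> \<circ> \<gamma>)" and F: "\<And>x. \<bar>F x\<bar> \<le> \<phi> x"
    and pos: "\<And>t. 0 \<le> t \<Longrightarrow> t < 1 \<Longrightarrow> \<phi> (\<gamma> t) > 0" and "\<phi> (\<gamma> 1) = 0"
    and S: "S \<in> sets borel" "\<And>x. \<phi> x > 0 \<Longrightarrow> x \<in> S"
    and loc: "\<And>\<sigma>. rectifiable_curve \<sigma> \<Longrightarrow> (\<And>t. t \<in> {0..1} \<Longrightarrow> \<phi> (\<sigma> t) > 0) \<Longrightarrow>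
      ennreal \<bar>F (\<sigma> 0) - F (\<sigma> 1)\<bar> \<le> line_integral \<sigma> e"
  shows "ennreal \<bar>F (\<gamma> 0)\<bar> \<le> line_integral \<gamma> (\<lambda>x. e x * indicator S x)"
proof (cases "line_integral \<gamma> (\<lambda>x. e x * indicator S x)" rule: ennreal_cases)
  case (real I)
  have eS: "(\<lambda>x. e x * indicator S x) \<in> borel_measurable borel" using e S by measurable
  \<comment> \<open>Near the end \<open>F\<close> is controlled only through
    \<open>\<bar>F x\<bar> \<le> \<phi> x\<close>; the remainder \<open>\<phi> (\<gamma> b)\<close>
    vanishes as \<open>b\<close> tends to 1.\<close>
  have b: "\<bar>F (\<gamma> 0)\<bar> \<le> I + \<phi> (\<gamma> b)" if b: "0 \<le> b" "b < 1" for b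
  proof -
    let ?s = "subcurve 0 b \<gamma>"
    have rs: "rectifiable_curve ?s" using b by (intro rectifiable_subcurve rc) auto
    have ps: "\<phi> (?s t) > 0" if "t \<in> {0..1}" for t using subcurve_in[of 0 b t \<gamma>] b that pos by fastforce
    have "ennreal \<bar>F (\<gamma> 0) - F (\<gamma> b)\<bar> \<le> line_integral ?s e" using loc[OF rs ps] by simp
    also have "\<dots> \<le> line_integral ?s (\<lambda>x. e x * indicator S x)"
      using ps S by (intro line_integral_mono) auto
    also have "\<dots> = seg \<gamma> 0 b (\<lambda>x. e x * indicator S x)"
      using b eS rc by (subst line_integral_subcurve) auto
    also have "\<dots> \<le> line_integral \<gamma> (\<lambda>x. e x * indicator S x)"
      unfolding line_integral_def using b by (intro nn_integral_mono) (auto simp: indicator_def)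
    finally have "\<bar>F (\<gamma> 0) - F (\<gamma> b)\<bar> \<le> I" using real by simp
    then show ?thesis using F[of "\<gamma> b"] by linarith
  qed
  have "\<bar>F (\<gamma> 0)\<bar> \<le> I + r" if "r > 0" for r
  proof -
    obtain d where d: "d > 0" "\<And>t. t \<in> {0..1} \<Longrightarrow> dist t 1 < d \<Longrightarrow> dist (\<phi> (\<gamma> t)) (\<phi> (\<gamma> 1)) < r"
      using cont \<open>r > 0\<close> unfolding continuous_on_iff o_def by (elim ballE[of _ _ 1] allE[of _ r]) auto
    define t where "t = max 0 (1 - d/2)"
    have t: "0 \<le> t" "t < 1" "dist t 1 < d" using d(1) by (auto simp: t_def dist_real_def)
    then show ?thesis using b[of t] d(2)[of t] \<open>\<phi> (\<gamma> 1) = 0\<close> by (auto simp: dist_real_def)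
  qed
  then have "\<bar>F (\<gamma> 0)\<bar> \<le> I" by (rule field_le_epsilon)
  then show ?thesis using real by simp
qed simp

text \<open>Passes from curves inside \<open>{x. \<phi> x > 0}\<close> to all curves. A curve that
  meets zeros of \<open>\<phi>\<close> is cut at the first and the last one: \<open>F\<close>
  vanishes there, and the two outer arcs stay in the good region up to these ends. On curves with
  infinite integral of \<open>k\<close>, where continuity of \<open>\<phi>\<close> is not assumed,
  the term \<open>\<theta> * k\<close> makes the bound infinite; its total cost is as small as
  desired.\<close>

lemma ug_glue:
  fixes \<phi> F :: "'a::metric_space \<Rightarrow> real"
  assumes e: "e \<in> borel_measurable borel" and k: "k \<in> borel_measurable borel" and "\<theta> > 0"
    and F: "\<And>x. \<bar>F x\<bar> \<le> \<phi> x"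
    and cont: "\<And>\<gamma>. rectifiable_curve \<gamma> \<Longrightarrow> line_integral \<gamma> k < \<infinity> \<Longrightarrow> continuous_on {0..1} (\<phi> \<circ> \<gamma>)"
    and S: "S \<in> sets borel" "\<And>x. \<phi> x > 0 \<Longrightarrow> x \<in> S"
    and loc: "\<And>\<sigma>. rectifiable_curve \<sigma> \<Longrightarrow> (\<And>t. t \<in> {0..1} \<Longrightarrow> \<phi> (\<sigma> t) > 0) \<Longrightarrow>
      ennreal \<bar>F (\<sigma> 0) - F (\<sigma> 1)\<bar> \<le> line_integral \<sigma> e"
  shows "ug F (\<lambda>x. e x * indicator S x + ennreal \<theta> * k x)"
  unfolding ug_def
proof (intro conjI allI impI)
  let ?eS = "\<lambda>x. e x * indicator S x"
  have eS: "?eS \<in> borel_measurable borel" using e S by measurable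
  show "(\<lambda>x. e x * indicator S x + ennreal \<theta> * k x) \<in> borel_measurable borel" using eS k by measurable
  fix \<gamma> :: "real \<Rightarrow> 'a" assume rc: "rectifiable_curve \<gamma>"
  have split: "line_integral \<gamma> (\<lambda>x. e x * indicator S x + ennreal \<theta> * k x)
      = line_integral \<gamma> ?eS + ennreal \<theta> * line_integral \<gamma> k"
    using eS k by (simp add: line_integral_add[OF rc] line_integral_cmult[OF rc])
  show "ennreal \<bar>F (\<gamma> 0) - F (\<gamma> 1)\<bar> \<le> line_integral \<gamma> (\<lambda>x. e x * indicator S x + ennreal \<theta> * k x)"
  proof (cases "line_integral \<gamma> k < \<infinity>")
    case False
    then show ?thesis unfolding split using \<open>\<theta> > 0\<close> by (simp add: less_top[symmetric] ennreal_mult_top)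
  next
    case True
    from cont[OF rc this] have c: "continuous_on {0..1} (\<phi> \<circ> \<gamma>)" .
    have nn: "\<phi> x \<ge> 0" for x using F[of x] abs_ge_zero[of "F x"] by linarith
    have "ennreal \<bar>F (\<gamma> 0) - F (\<gamma> 1)\<bar> \<le> line_integral \<gamma> ?eS"
    proof (cases "\<forall>t\<in>{0..1}. \<phi> (\<gamma> t) > 0")
      case True
      then have "ennreal \<bar>F (\<gamma> 0) - F (\<gamma> 1)\<bar> \<le> line_integral \<gamma> e" by (intro loc rc) auto
      also have "\<dots> \<le> line_integral \<gamma> ?eS" using True S by (intro line_integral_mono) auto
      finally show ?thesis .
    next
      case False
      define Z where "Z = {0..1} \<inter> (\<phi> \<circ> \<gamma>) -` {..0}"
      have "closed Z" unfolding Z_def by (intro continuous_closed_preimage[OF c] closed_atLeastAtMost closed_atMost)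
      moreover have "bounded Z" by (rule bounded_subset[of "{0..1}"]) (auto simp: Z_def)
      ultimately have cZ: "compact Z" by (simp add: compact_eq_bounded_closed)
      have neZ: "Z \<noteq> {}" using False by (auto simp: Z_def not_less)
      obtain a where a: "a \<in> Z" "\<And>t. t \<in> Z \<Longrightarrow> a \<le> t" using compact_attains_inf[OF cZ neZ] by blast
      obtain b where b: "b \<in> Z" "\<And>t. t \<in> Z \<Longrightarrow> t \<le> b" using compact_attains_sup[OF cZ neZ] by blast
      have Z: "t \<in> Z \<longleftrightarrow> 0 \<le> t \<and> t \<le> 1 \<and> \<phi> (\<gamma> t) = 0" for t
        using nn[of "\<gamma> t"] by (auto simp: Z_def)
      have ab: "0 \<le> a" "a \<le> b" "b \<le> 1" using a b Z by auto
      have A: "ennreal \<bar>F (\<gamma> 0)\<bar> \<le> seg \<gamma> 0 a ?eS"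
      proof (cases "a = 0")
        case True then show ?thesis using a(1) Z[of a] F[of "\<gamma> 0"] by simp
      next
        case False
        let ?s = "subcurve 0 a \<gamma>"
        have a1: "a \<le> 1" using ab by auto
        have rs: "rectifiable_curve ?s" using ab by (intro rectifiable_subcurve rc) auto
        have "continuous_on {0..1} (\<phi> \<circ> ?s)"
          unfolding subcurve_def comp_assoc[symmetric]
          by (rule continuous_on_compose[OF _ continuous_on_subset[OF c]])
            (use ab a1 in \<open>auto intro!: continuous_intros mult_le_one\<close>)
        moreover have "\<phi> (?s t) > 0" if "0 \<le> t" "t < 1" for t
        proof -
          have "a * t < a" "0 \<le> a * t" using False ab that by auto
          then have "a * t \<notin> Z" using a(2)[of "a * t"] by (meson not_le)
          then have "\<phi> (\<gamma> (a * t)) \<noteq> 0" using Z[of "a * t"] \<open>a * t < a\<close> \<open>0 \<le> a * t\<close> ab by auto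
          then show ?thesis using nn[of "\<gamma> (a * t)"] by (auto simp: subcurve_def)
        qed
        ultimately have "ennreal \<bar>F (?s 0)\<bar> \<le> line_integral ?s ?eS"
          using a(1) Z[of a] by (intro glue_end[OF rs e _ F _ _ S loc]) auto
        then show ?thesis using line_integral_subcurve[OF rc, of 0 a ?eS] ab eS by simp
      qed
      have B: "ennreal \<bar>F (\<gamma> 1)\<bar> \<le> seg \<gamma> b 1 ?eS"
      proof (cases "b = 1")
        case True then show ?thesis using b(1) Z[of b] F[of "\<gamma> 1"] by simp
      next
        case False
        let ?r = "subcurve b 1 \<gamma>" let ?s = "\<lambda>t. ?r (1 - t)"
        have rr: "rectifiable_curve ?r" using ab by (intro rectifiable_subcurve rc) auto
        then have rs: "rectifiable_curve ?s" by (rule rectifiable_reverse)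
        have s: "?s t = \<gamma> (1 - (1 - b) * t)" for t by (simp add: subcurve_def algebra_simps)
        have "continuous_on {0..1} (\<lambda>t. (\<phi> \<circ> \<gamma>) (1 - (1 - b) * t))"
          by (rule continuous_on_compose2[OF c])
            (use ab in \<open>auto intro!: continuous_intros mult_le_one\<close>)
        then have "continuous_on {0..1} (\<phi> \<circ> ?s)" by (simp add: s o_def)
        moreover have "\<phi> (?s t) > 0" if "0 \<le> t" "t < 1" for t
        proof -
          have "(1 - b) * t < 1 - b" "0 \<le> (1 - b) * t" using False ab that by auto
          then have *: "1 - (1 - b) * t > b" "1 - (1 - b) * t \<le> 1" by auto
          then have "1 - (1 - b) * t \<notin> Z" using b(2)[of "1 - (1 - b) * t"] by (meson not_le)
          then have "\<phi> (\<gamma> (1 - (1 - b) * t)) \<noteq> 0" using Z[of "1 - (1 - b) * t"] * ab by auto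
          then show ?thesis using nn[of "\<gamma> (1 - (1 - b) * t)"] by (auto simp: s)
        qed
        ultimately have "ennreal \<bar>F (?s 0)\<bar> \<le> line_integral ?s ?eS"
          using b(1) Z[of b] by (intro glue_end[OF rs e _ F _ _ S loc]) auto
        then show ?thesis using line_integral_subcurve[OF rc, of b 1 ?eS] ab eS
          by (simp add: line_integral_reverse[OF rr eS])
      qed
      have "ennreal \<bar>F (\<gamma> 0) - F (\<gamma> 1)\<bar> \<le> ennreal (\<bar>F (\<gamma> 0)\<bar> + \<bar>F (\<gamma> 1)\<bar>)"
        by (intro ennreal_leI) auto
      also have "\<dots> = ennreal \<bar>F (\<gamma> 0)\<bar> + ennreal \<bar>F (\<gamma> 1)\<bar>" by simp
      also have "\<dots> \<le> seg \<gamma> 0 a ?eS + seg \<gamma> b 1 ?eS" by (rule add_mono[OF A B])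
      \<comment> \<open>The arc between the two zeros enters only to complete the sum to the whole
        curve.\<close>
      also have "\<dots> \<le> seg \<gamma> 0 a ?eS + (seg \<gamma> a b ?eS + seg \<gamma> b 1 ?eS)" by (intro add_left_mono) simp
      also have "\<dots> = line_integral \<gamma> ?eS"
        using ab by (simp add: line_integral_seg seg_split[OF rc eS, of 0 a 1] seg_split[OF rc eS, of a b 1])
      finally show ?thesis .
    qed
    then show ?thesis unfolding split by (rule order_trans) simp
  qed
qed

section \<open>Doubling spaces\<close>

text \<open>Being squeezed between a closed and an open set with a small gap is stable under
  complements, which swap the two, and under countable unions once the union of closed sets is cut
  to a finite one.\<close>

lemma finite_borel_regular:
  fixes N :: "'a::metric_space measure"
  assumes "finite_measure N" and N: "sets N = sets borel" and "E \<in> sets borel" "(e::real) > 0"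
  shows "\<exists>F V. closed F \<and> open V \<and> F \<subseteq> E \<and> E \<subseteq> V \<and> measure N (V - F) < e"
proof -
  interpret finite_measure N by fact
  note [measurable_cong] = N
  have "E \<in> sigma_sets UNIV {S. open S}" using assms(3) by (simp add: borel_def sets_measure_of_conv)
  then show ?thesis using \<open>e > 0\<close>
  proof (induction arbitrary: e rule: sigma_sets.induct)
    case (Basic U)
    then have "open U" by simp
    show ?case
    proof (cases "U = UNIV")
      case True then show ?thesis using Basic by (intro exI[of _ UNIV]) auto
    next
      case False
      \<comment> \<open>Points at distance at least \<open>1 / Suc n\<close> from the complement:
        closed sets that exhaust \<open>U\<close>.\<close>
      define F where "F n = {x. 1 / Suc n \<le> infdist x (-U)}" for n :: nat
      have cl: "closed (F n)" for n unfolding F_def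
        by (intro closed_Collect_le continuous_intros)
      have sub: "F n \<subseteq> U" for n
      proof
        fix x assume "x \<in> F n" then have "infdist x (-U) > 0" by (auto simp: F_def intro: less_le_trans[rotated])
        then show "x \<in> U" using infdist_zero[of x "-U"] by (cases "x \<in> U") auto
      qed
      have UF: "(\<Union>n. F n) = U"
      proof
        show "U \<subseteq> (\<Union>n. F n)"
        proof
          fix x assume "x \<in> U"
          then have "infdist x (-U) > 0" using False \<open>open U\<close>
            by (intro infdist_pos_not_in_closed) auto
          then obtain n where "1 / Suc n < infdist x (-U)" using nat_approx_posE by blast
          then show "x \<in> (\<Union>n. F n)" by (auto simp: F_def intro!: exI[of _ n])
        qed
      qed (use sub in auto)
      have "incseq F"
      proof (rule incseq_SucI)
        fix n have "1 / Suc (Suc n) \<le> 1 / Suc n" by (simp add: field_simps)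
        then show "F n \<subseteq> F (Suc n)" by (auto simp: F_def)
      qed
      then have "(\<lambda>n. measure N (F n)) \<longlonglongrightarrow> measure N U"
        using finite_Lim_measure_incseq[of F] UF cl N by (auto intro: borel_closed)
      then have "\<forall>\<^sub>F n in sequentially. measure N U - e < measure N (F n)"
        using Basic by (intro order_tendstoD(1)) auto
      then obtain n where n: "measure N U - e < measure N (F n)" by (auto simp: eventually_sequentially)
      have "measure N (U - F n) = measure N U - measure N (F n)"
        using cl sub \<open>open U\<close> N by (intro finite_measure_Diff) auto
      then show ?thesis using n cl sub \<open>open U\<close> by (intro exI[of _ "F n"] exI[of _ U]) auto
    qed
  next
    case Empty then show ?case by (intro exI[of _ "{}"]) auto
  next
    case (Compl A)
    from Compl.IH[OF Compl.prems] obtain F V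
      where "closed F" "open V" "F \<subseteq> A" "A \<subseteq> V" "measure N (V - F) < e" by auto
    moreover have "- F - (- V) = V - F" by auto
    ultimately show ?case by (intro exI[of _ "-V"] exI[of _ "-F"]) auto
  next
    case (Union A)
    \<comment> \<open>These gaps sum to \<open>e/2\<close>; the other half pays for replacing the
      infinite union of closed sets by a finite one.\<close>
    have "\<exists>F V. closed F \<and> open V \<and> F \<subseteq> A i \<and> A i \<subseteq> V \<and> measure N (V - F) < e/4 * (1/2)^i" for i
      using Union by (intro Union.IH) auto
    then obtain F V where *: "\<And>i. closed (F i)" "\<And>i. open (V i)" "\<And>i. F i \<subseteq> A i" "\<And>i. A i \<subseteq> V i"
      "\<And>i. measure N (V i - F i) < e/4 * (1/2)^i" by metis
    have [measurable]: "F i \<in> sets N" "V i \<in> sets N" for i using * N by auto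
    have sm: "summable (\<lambda>i. e/4 * (1/2::real)^i)" by (intro summable_mult summable_geometric) auto
    have sm': "summable (\<lambda>i. measure N (V i - F i))"
      using *(5) by (intro summable_comparison_test'[OF sm, of 0]) (auto intro: less_imp_le)
    have "measure N (\<Union>i. V i - F i) \<le> (\<Sum>i. measure N (V i - F i))"
      using sm' by (intro finite_measure_subadditive_countably) auto
    also have "\<dots> \<le> (\<Sum>i. e/4 * (1/2::real)^i)" using *(5) by (intro suminf_le sm sm') (auto intro: less_imp_le)
    also have "\<dots> = e/2" by (subst suminf_mult) (auto simp: suminf_geometric)
    finally have 1: "measure N (\<Union>i. V i - F i) \<le> e/2" .
    have "(\<lambda>n. measure N (\<Union>i<n. F i)) \<longlonglongrightarrow> measure N (\<Union>n. \<Union>i<n. F i)"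
    proof (rule finite_Lim_measure_incseq)
      show "incseq (\<lambda>n. \<Union>i<n. F i)" by (intro monoI UN_mono) auto
    qed auto
    also have "(\<Union>n. \<Union>i<n. F i) = (\<Union>i. F i)" by auto
    finally have "\<forall>\<^sub>F n in sequentially. measure N (\<Union>i. F i) - e/2 < measure N (\<Union>i<n. F i)"
      using Union by (intro order_tendstoD(1)) auto
    then obtain n where n: "measure N (\<Union>i. F i) - e/2 < measure N (\<Union>i<n. F i)"
      by (auto simp: eventually_sequentially)
    have "(\<Union>i. V i) - (\<Union>i<n. F i) \<subseteq> (\<Union>i. V i - F i) \<union> ((\<Union>i. F i) - (\<Union>i<n. F i))" by auto
    then have "measure N ((\<Union>i. V i) - (\<Union>i<n. F i)) \<le> measure N ((\<Union>i. V i - F i) \<union> ((\<Union>i. F i) - (\<Union>i<n. F i)))"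
      by (intro finite_measure_mono) auto
    also have "\<dots> \<le> measure N (\<Union>i. V i - F i) + measure N ((\<Union>i. F i) - (\<Union>i<n. F i))"
      by (intro measure_Un_le) auto
    also have "measure N ((\<Union>i. F i) - (\<Union>i<n. F i)) = measure N (\<Union>i. F i) - measure N (\<Union>i<n. F i)"
      by (intro finite_measure_Diff) auto
    finally have "measure N ((\<Union>i. V i) - (\<Union>i<n. F i)) < e" using 1 n by simp
    moreover have "closed (\<Union>i<n. F i)" "open (\<Union>i. V i)" using *(1,2) by auto
    moreover have "(\<Union>i<n. F i) \<subseteq> (\<Union>i. A i)" "(\<Union>i. A i) \<subseteq> (\<Union>i. V i)" using *(3,4) by blast+
    ultimately show ?case by blast
  qed
qed

text \<open>Split \<open>e\<close> at a level \<open>n\<close>: the part above has integral at most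
  \<open>\<epsilon>/2\<close>, and the part below is bounded by \<open>n\<close>.\<close>

lemma nn_integral_abs_cont:
  assumes e[measurable]: "e \<in> borel_measurable M" and fin: "(\<integral>\<^sup>+ x. e x \<partial>M) < \<infinity>" and "\<epsilon> > (0::real)"
  obtains \<delta> :: real where "\<delta> > 0"
    "\<And>A. A \<in> sets M \<Longrightarrow> emeasure M A \<le> ennreal \<delta> \<Longrightarrow> (\<integral>\<^sup>+ x. e x * indicator A x \<partial>M) \<le> ennreal \<epsilon>"
proof -
  have mc: "(\<integral>\<^sup>+ x. (SUP n::nat. min (e x) (of_nat n)) \<partial>M) = (SUP n::nat. \<integral>\<^sup>+ x. min (e x) (of_nat n) \<partial>M)"
    by (rule nn_integral_monotone_convergence_SUP) (auto simp: incseq_def le_fun_def min.coboundedI2)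
  have "(SUP n::nat. min (e x) (of_nat n)) = e x" for x
  proof -
    have "(SUP n::nat. min (e x) (of_nat n)) = min (e x) (SUP n::nat. of_nat n)"
      unfolding inf_min[symmetric] by (rule inf_SUP[symmetric])
    also have "(SUP n::nat. of_nat n) = (\<infinity>::ennreal)" by (simp add: ennreal_SUP_of_nat_eq_top)
    finally show ?thesis by simp
  qed
  then have eq: "(\<integral>\<^sup>+ x. e x \<partial>M) = (SUP n::nat. \<integral>\<^sup>+ x. min (e x) (of_nat n) \<partial>M)" using mc by simp
  have "\<exists>n::nat. (\<integral>\<^sup>+ x. e x \<partial>M) < (\<integral>\<^sup>+ x. min (e x) (of_nat n) \<partial>M) + ennreal (\<epsilon>/2)"
  proof (rule ccontr)
    assume "\<not> ?thesis"
    then have "(\<integral>\<^sup>+ x. min (e x) (of_nat n) \<partial>M) + ennreal (\<epsilon>/2) \<le> (\<integral>\<^sup>+ x. e x \<partial>M)" for n :: nat by (auto simp: not_less)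
    then have "(SUP n::nat. (\<integral>\<^sup>+ x. min (e x) (of_nat n) \<partial>M) + ennreal (\<epsilon>/2)) \<le> (\<integral>\<^sup>+ x. e x \<partial>M)"
      by (intro SUP_least)
    then have "(\<integral>\<^sup>+ x. e x \<partial>M) + ennreal (\<epsilon>/2) \<le> (\<integral>\<^sup>+ x. e x \<partial>M)"
      by (subst (asm) ennreal_SUP_add_left) (auto simp: eq[symmetric])
    then show False using fin \<open>\<epsilon> > 0\<close> by (cases "\<integral>\<^sup>+ x. e x \<partial>M" rule: ennreal_cases) (auto simp: ennreal_plus[symmetric] simp del: ennreal_plus)
  qed
  then obtain n :: nat where n: "(\<integral>\<^sup>+ x. e x \<partial>M) < (\<integral>\<^sup>+ x. min (e x) (of_nat n) \<partial>M) + ennreal (\<epsilon>/2)" ..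
  define I where "I = (\<integral>\<^sup>+ x. min (e x) (of_nat n) \<partial>M)"
  have dec: "(\<integral>\<^sup>+ x. e x \<partial>M) = I + (\<integral>\<^sup>+ x. (e x - min (e x) (of_nat n)) \<partial>M)"
    unfolding I_def by (subst nn_integral_add[symmetric]) (auto intro!: nn_integral_cong simp: add_diff_inverse_ennreal)
  have I: "I < \<infinity>" using dec fin by (metis ennreal_add_eq_top infinity_ennreal_def less_top)
  have small: "(\<integral>\<^sup>+ x. (e x - min (e x) (of_nat n)) \<partial>M) \<le> ennreal (\<epsilon>/2)"
    using n I unfolding dec I_def[symmetric] by (metis ennreal_add_left_cancel_less less_imp_le)
  \<comment> \<open>Gives \<open>n * \<delta> \<le> \<epsilon>/2\<close>; the \<open>+ 1\<close>
    covers the case \<open>n = 0\<close>.\<close>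
  define \<delta> where "\<delta> = \<epsilon> / (2 * (real n + 1))"
  show thesis
  proof (rule that[of \<delta>])
    show "\<delta> > 0" using \<open>\<epsilon> > 0\<close> by (simp add: \<delta>_def)
    fix A assume A[measurable]: "A \<in> sets M" and m: "emeasure M A \<le> ennreal \<delta>"
    have pt: "e x * indicator A x \<le> (e x - min (e x) (of_nat n)) + of_nat n * indicator A x" for x
    proof (cases "x \<in> A")
      case True
      have "e x = (e x - min (e x) (of_nat n)) + min (e x) (of_nat n)" by (simp add: diff_add_cancel_ennreal)
      also have "\<dots> \<le> (e x - min (e x) (of_nat n)) + of_nat n" by (intro add_left_mono) simp
      finally show ?thesis using True by simp
    qed simp
    have "(\<integral>\<^sup>+ x. e x * indicator A x \<partial>M) \<le> (\<integral>\<^sup>+ x. (e x - min (e x) (of_nat n)) + of_nat n * indicator A x \<partial>M)"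
      using pt by (intro nn_integral_mono)
    also have "\<dots> = (\<integral>\<^sup>+ x. (e x - min (e x) (of_nat n)) \<partial>M) + of_nat n * emeasure M A"
      by (subst nn_integral_add) (auto simp: nn_integral_cmult_indicator)
    also have "\<dots> \<le> ennreal (\<epsilon>/2) + of_nat n * ennreal \<delta>" using small m by (intro add_mono mult_left_mono) auto
    also have "\<dots> = ennreal (\<epsilon>/2 + real n * \<delta>)"
      using \<open>\<epsilon> > 0\<close> by (simp add: ennreal_of_nat_eq_real_of_nat ennreal_mult[symmetric] \<delta>_def)
    also have "\<dots> \<le> ennreal \<epsilon>" using \<open>\<epsilon> > 0\<close> by (intro ennreal_leI) (simp add: \<delta>_def field_simps)
    finally show "(\<integral>\<^sup>+ x. e x * indicator A x \<partial>M) \<le> ennreal \<epsilon>" .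
  qed
qed

section \<open>Separated sets, packing and compactness\<close>

definition separated :: "real \<Rightarrow> 'a::metric_space set \<Rightarrow> bool" where
  "separated r S \<longleftrightarrow> (\<forall>x\<in>S. \<forall>y\<in>S. x \<noteq> y \<longrightarrow> r \<le> dist x y)"

text \<open>Zorn yields a separated set that cannot be enlarged; a point at distance at least
  \<open>r\<close> from all of it could still be added.\<close>

lemma maximal_separated:
  assumes "r > 0"
  shows "\<exists>A::'a::metric_space set. separated r A \<and> (\<forall>x. \<exists>a\<in>A. dist a x < r)"
proof -
  have "\<exists>A\<in>{A::'a set. separated r A}. \<forall>X\<in>{A. separated r A}. A \<subseteq> X \<longrightarrow> X = A"
  proof (rule subset_Zorn')
    fix C assume C: "subset.chain {A::'a set. separated r A} C"
    have "r \<le> dist x y" if "x \<in> X" "X \<in> C" "y \<in> Y" "Y \<in> C" "x \<noteq> y" for x y X Y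
    proof -
      have "X \<subseteq> Y \<or> Y \<subseteq> X" using C that by (auto simp: subset.chain_def)
      moreover have "separated r X" "separated r Y" using C that by (auto simp: subset.chain_def)
      ultimately show ?thesis using that unfolding separated_def by blast
    qed
    then show "\<Union>C \<in> {A. separated r A}" by (auto simp: separated_def)
  qed
  then obtain A :: "'a set" where A: "separated r A" "\<And>X. separated r X \<Longrightarrow> A \<subseteq> X \<Longrightarrow> X = A" by auto
  have "\<exists>a\<in>A. dist a x < r" for x
  proof (rule ccontr)
    assume "\<not> (\<exists>a\<in>A. dist a x < r)"
    then have far: "\<And>a. a \<in> A \<Longrightarrow> r \<le> dist a x" by (auto simp: not_less)
    then have "separated r (insert x A)" using A(1) by (auto simp: separated_def dist_commute)
    then have "x \<in> A" using A(2)[of "insert x A"] by auto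
    then show False using far[of x] assms by simp
  qed
  then show ?thesis using A by auto
qed

lemma UN_ball: "(\<Union>n::nat. ball z (real n)) = UNIV"
proof -
  have "\<exists>n::nat. x \<in> ball z (real n)" for x using reals_Archimedean2[of "dist z x"] by simp
  then show ?thesis by blast
qed

locale doubling_space =
  fixes M :: "'a::{metric_space, complete_space} measure" and Cd :: real
  assumes sets_M[measurable_cong]: "sets M = sets borel" and dbl: "doubling M Cd"
begin

lemma space_M [simp]: "space M = UNIV"
  using sets_eq_imp_space_eq[OF sets_M] by simp

lemma ball_pos: "r > 0 \<Longrightarrow> 0 < emeasure M (ball y r)"
  and ball_finite: "emeasure M (ball y r) < \<infinity>"
proof -
  show "r > 0 \<Longrightarrow> 0 < emeasure M (ball y r)" using dbl by (simp add: doubling_def)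
  show "emeasure M (ball y r) < \<infinity>" using dbl by (cases "r > 0") (auto simp: doubling_def ball_empty)
qed

lemma Cd_pos: "Cd > 0"
proof (rule ccontr)
  fix y :: 'a
  assume "\<not> Cd > 0"
  then have "ennreal Cd = 0" by (simp add: ennreal_neg)
  then have "emeasure M (ball y (2 * 1)) \<le> 0"
    using dbl unfolding doubling_def by (metis mult_zero_left zero_less_one)
  then show False using ball_pos[of "2 * 1" y] by simp
qed

lemma doubling_iterate: "r > 0 \<Longrightarrow> emeasure M (ball y (2^n * r)) \<le> ennreal (Cd^n) * emeasure M (ball y r)"
proof (induction n)
  case (Suc n)
  have "emeasure M (ball y (2 * (2^n * r))) \<le> ennreal Cd * emeasure M (ball y (2^n * r))"
    using dbl Suc by (simp add: doubling_def)
  also have "\<dots> \<le> ennreal Cd * (ennreal (Cd^n) * emeasure M (ball y r))" using Suc by (intro mult_left_mono) auto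
  finally show ?case using Cd_pos by (simp add: ennreal_mult mult.assoc)
qed simp

text \<open>Packing: the balls of radius \<open>r/2\<close> are disjoint and lie in
  \<open>?B\<close>, while each has at least the fraction \<open>1 / Cd^n\<close> of the measure of
  \<open>?B\<close>. The last assumption says that \<open>n\<close> doublings of such a ball cover
  \<open>?B\<close>.\<close>

lemma separated_card_finite:
  fixes S :: "'a set"
  assumes S: "finite S" "S \<subseteq> ball z R" "separated r S" and "r > 0" "4 * R + r \<le> 2^n * r"
  shows "real (card S) \<le> Cd^n"
proof (cases "S = {}")
  case True then show ?thesis using Cd_pos by simp
next
  case False
  have "R > 0" using False S(2) by (cases "R > 0") (auto simp: ball_empty)
  let ?B = "ball z (R + r/2)"
  have B: "emeasure M ?B \<le> ennreal (Cd^n) * emeasure M (ball x (r/2))" if "x \<in> S" for x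
  proof -
    have "?B \<subseteq> ball x (2^n * (r/2))"
    proof
      fix y assume "y \<in> ?B"
      moreover have "dist z x < R" using S that by auto
      ultimately have "dist x y < 2 * R + r/2" using dist_triangle[of x y z] by (simp add: dist_commute)
      also have "\<dots> \<le> 2^n * (r/2)" using assms(5) by simp
      finally show "y \<in> ball x (2^n * (r/2))" by simp
    qed
    then have "emeasure M ?B \<le> emeasure M (ball x (2^n * (r/2)))" by (intro emeasure_mono) auto
    also have "\<dots> \<le> ennreal (Cd^n) * emeasure M (ball x (r/2))" using \<open>r > 0\<close> by (intro doubling_iterate) auto
    finally show ?thesis .
  qed
  have "of_nat (card S) * emeasure M ?B = (\<Sum>x\<in>S. emeasure M ?B)" by simp
  also have "\<dots> \<le> (\<Sum>x\<in>S. ennreal (Cd^n) * emeasure M (ball x (r/2)))" by (intro sum_mono B)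
  also have "\<dots> = ennreal (Cd^n) * (\<Sum>x\<in>S. emeasure M (ball x (r/2)))" by (simp add: sum_distrib_left)
  also have "(\<Sum>x\<in>S. emeasure M (ball x (r/2))) = emeasure M (\<Union>x\<in>S. ball x (r/2))"
  proof (rule sum_emeasure)
    show "disjoint_family_on (\<lambda>x. ball x (r/2)) S"
    proof (unfold disjoint_family_on_def, intro ballI impI)
      fix x y assume xy: "x \<in> S" "y \<in> S" "x \<noteq> y"
      then have "r \<le> dist x y" using S by (auto simp: separated_def)
      then show "ball x (r/2) \<inter> ball y (r/2) = {}"
        using dist_triangle_half_l[of x _ r y] by (force simp: dist_commute)
    qed
  qed (use S in auto)
  also have "\<dots> \<le> emeasure M ?B"
  proof (intro emeasure_mono subsetI)
    fix y assume "y \<in> (\<Union>x\<in>S. ball x (r/2))"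
    then obtain x where "x \<in> S" "dist x y < r/2" by auto
    moreover have "dist z x < R" using S \<open>x \<in> S\<close> by auto
    ultimately show "y \<in> ?B" using dist_triangle[of z y x] by simp
  qed simp
  finally have *: "of_nat (card S) * emeasure M ?B \<le> ennreal (Cd^n) * emeasure M ?B" by (simp add: mult_left_mono)
  have "emeasure M ?B > 0" "emeasure M ?B < \<infinity>" using ball_pos[of "R + r/2" z] ball_finite \<open>r > 0\<close> \<open>R > 0\<close> by auto
  then obtain b where b: "emeasure M ?B = ennreal b" "b > 0"
    by (cases "emeasure M ?B" rule: ennreal_cases) auto
  from * have "ennreal (real (card S) * b) \<le> ennreal (Cd^n * b)"
    using b Cd_pos by (simp add: ennreal_of_nat_eq_real_of_nat ennreal_mult[symmetric])
  then show ?thesis using b Cd_pos by (simp add: ennreal_le_iff)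
qed

lemma separated_card:
  fixes S :: "'a set"
  assumes S: "S \<subseteq> ball z R" "separated r S" and "r > 0" "4 * R + r \<le> 2^n * r"
  shows "finite S \<and> card S \<le> nat \<lfloor>Cd^n\<rfloor>"
proof (rule finite_if_finite_subsets_card_bdd)
  fix G assume G: "G \<subseteq> S" "finite G"
  have "real (card G) \<le> Cd^n"
    by (rule separated_card_finite[OF G(2) _ _ assms(3,4)]) (use G S in \<open>auto simp: separated_def\<close>)
  then show "card G \<le> nat \<lfloor>Cd^n\<rfloor>" by (simp add: le_nat_floor)
qed

lemma separated_finite:
  fixes S :: "'a set"
  assumes "S \<subseteq> ball z R" "separated r S" "r > 0"
  shows "finite S"
proof -
  obtain n where "(4 * R + r) / r < 2^n" using real_arch_pow[of 2] by auto
  then have "4 * R + r \<le> 2^n * r" using assms(3) by (simp add: field_simps)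
  then show ?thesis using separated_card[OF assms] by auto
qed

lemma separated_countable:
  fixes S :: "'a set"
  assumes "separated r S" "r > 0" shows "countable S"
proof -
  fix z :: 'a
  have "S = (\<Union>n::nat. S \<inter> ball z (real n))"
    using UN_ball[of z] by blast
  moreover have "finite (S \<inter> ball z (real n))" for n
    using assms by (intro separated_finite[of _ z n r]) (auto simp: separated_def)
  ultimately show ?thesis by (metis countable_UN countable_finite countableI_type)
qed

text \<open>A maximal \<open>e\<close>-separated set meets the slightly larger ball in a finite set,
  whose \<open>e\<close>-balls cover \<open>S\<close>; completeness does the rest.\<close>

lemma closed_bounded_compact:
  fixes S :: "'a set"
  assumes "closed S" "S \<subseteq> ball z R" shows "compact S"
  unfolding compact_eq_totally_bounded
proof (intro conjI allI impI)
  show "complete S" using assms by (simp add: complete_eq_closed)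
  fix e :: real assume "e > 0"
  obtain A :: "'a set" where A: "separated e A" "\<And>x. \<exists>a\<in>A. dist a x < e"
    using maximal_separated[OF \<open>e > 0\<close>] by blast
  have "finite (A \<inter> ball z (R + e))"
    using A(1) \<open>e > 0\<close> by (intro separated_finite[of _ z "R + e" e]) (auto simp: separated_def)
  moreover have "S \<subseteq> (\<Union>x\<in>A \<inter> ball z (R + e). ball x e)"
  proof
    fix x assume "x \<in> S"
    obtain a where a: "a \<in> A" "dist a x < e" using A by blast
    have "dist z a < R + e" using \<open>x \<in> S\<close> assms(2) a dist_triangle[of z a x] by (auto simp: dist_commute)
    then show "x \<in> (\<Union>x\<in>A \<inter> ball z (R + e). ball x e)" using a by auto
  qed
  ultimately show "\<exists>k. finite k \<and> S \<subseteq> (\<Union>x\<in>k. ball x e)" by blast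
qed

text \<open>\<open>M\<close> may be infinite, so regularity is applied to its restrictions to balls
  around a fixed center. Of each open set only the part in its ball is kept, and the errors add up
  to \<open>e\<close>.\<close>

lemma outer_regular:
  assumes E[measurable]: "E \<in> sets borel" and e: "e > 0"
  obtains V where "open V" "E \<subseteq> V" "emeasure M (V - E) \<le> ennreal e"
proof -
  fix z :: 'a
  let ?N = "\<lambda>n. density M (indicator (ball z (real n)))"
  have N: "emeasure (?N n) A = emeasure M (A \<inter> ball z (real n))" if "A \<in> sets borel" for A n
    using that by (subst emeasure_density)
      (auto simp: sets_M indicator_inter_arith[symmetric] Int_commute intro!: borel_measurable_indicator)
  have "\<exists>V. open V \<and> E \<subseteq> V \<and> emeasure M ((V - E) \<inter> ball z (real n)) \<le> ennreal (e/2 * (1/2)^n)" for n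
  proof -
    have fm: "finite_measure (?N n)"
      using ball_finite[of z n] by (intro finite_measureI) (simp add: N less_top[symmetric])
    obtain F V where FV: "closed F" "open V" "F \<subseteq> E" "E \<subseteq> V" "measure (?N n) (V - F) < e/2 * (1/2)^n"
      using finite_borel_regular[OF fm _ E, of "e/2 * (1/2)^n"] e by (auto simp: sets_M)
    have "emeasure M ((V - E) \<inter> ball z (real n)) = emeasure (?N n) (V - E)" using FV by (subst N) auto
    also have "\<dots> \<le> emeasure (?N n) (V - F)" using FV by (intro emeasure_mono) (auto simp: sets_M)
    also have "\<dots> \<le> ennreal (e/2 * (1/2)^n)"
      using FV(5) by (subst finite_measure.emeasure_eq_measure[OF fm]) (auto intro: ennreal_leI)
    finally show ?thesis using FV by blast
  qed
  then obtain V where V: "\<And>n. open (V n)" "\<And>n. E \<subseteq> V n"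
    "\<And>n. emeasure M ((V n - E) \<inter> ball z (real n)) \<le> ennreal (e/2 * (1/2)^n)" by metis
  define W where "W = (\<Union>n. V n \<inter> ball z (real n))"
  show thesis
  proof (rule that[of W])
    show "open W" using V by (auto simp: W_def)
    show "E \<subseteq> W"
    proof
      fix x assume "x \<in> E"
      obtain n :: nat where "dist z x < n" using reals_Archimedean2 by blast
      then show "x \<in> W" using V(2)[of n] \<open>x \<in> E\<close> by (auto simp: W_def)
    qed
    have [measurable]: "V n \<in> sets borel" for n using V by auto
    have "emeasure M (W - E) \<le> emeasure M (\<Union>n. (V n - E) \<inter> ball z (real n))"
      by (intro emeasure_mono) (auto simp: W_def sets_M)
    also have "\<dots> \<le> (\<Sum>n. emeasure M ((V n - E) \<inter> ball z (real n)))"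
      by (intro emeasure_subadditive_countably) (auto simp: sets_M)
    also have "\<dots> \<le> (\<Sum>n. ennreal (e/2 * (1/2)^n))" by (intro suminf_le V) auto
    also have "\<dots> = ennreal e"
    proof (rule suminf_ennreal_eq)
      have "(\<lambda>n. e/2 * (1/2)^n) sums (e/2 * (1 / (1 - 1/2)))" by (intro sums_mult geometric_sums) auto
      then show "(\<lambda>n. e/2 * (1/2)^n) sums e" by simp
    qed (use e in auto)
    finally show "emeasure M (W - E) \<le> ennreal e" .
  qed
qed

text \<open>The majorant is built from open supersets of the superlevel sets \<open>{g > n}\<close>.\<close>

lemma lsc_majorant:
  assumes g[measurable]: "g \<in> borel_measurable borel" and fin: "(\<integral>\<^sup>+ x. g x \<partial>M) < \<infinity>"
  obtains G :: "nat \<Rightarrow> 'a \<Rightarrow> real" and e where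
    "\<And>m. continuous_on UNIV (G m)" "\<And>m x. 0 \<le> G m x" "\<And>m n x. m \<le> n \<Longrightarrow> G m x \<le> G n x"
    "\<And>x. g x \<le> (SUP m. ennreal (G m x))" "\<And>x. (SUP m. ennreal (G m x)) \<le> 1 + e x"
    "e \<in> borel_measurable borel" "(\<integral>\<^sup>+ x. e x \<partial>M) < \<infinity>"
proof -
  \<comment> \<open>The shift to \<open>Suc n\<close> makes the number of \<open>n\<close> with
    \<open>x \<in> E n\<close> at most \<open>g x\<close>, while \<open>g x > N\<close> puts
    \<open>x\<close> into the first \<open>N\<close> of these sets.\<close>
  define E where "E n = {x. g x > of_nat (Suc n)}" for n
  have E[measurable]: "E n \<in> sets borel" for n unfolding E_def by measurable
  have "\<exists>V. open V \<and> E n \<subseteq> V \<and> emeasure M (V - E n) \<le> ennreal ((1/2)^Suc n)" for n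
    using outer_regular[OF E[of n], of "(1/2)^Suc n"] by (metis zero_less_power half_gt_zero zero_less_one)
  then obtain V where V: "\<And>n. open (V n)" "\<And>n. E n \<subseteq> V n"
    "\<And>n. emeasure M (V n - E n) \<le> ennreal ((1/2)^Suc n)" by metis
  have [measurable]: "V n \<in> sets borel" for n using V by auto
  \<comment> \<open>\<open>infdist\<close> to the empty set is 0, hence the separate case.\<close>
  define d where "d n x = (if V n = UNIV then 1 else infdist x (- V n))" for n x
  have d: "0 \<le> d n x" "x \<notin> V n \<Longrightarrow> d n x = 0" "x \<in> V n \<Longrightarrow> d n x > 0" for n x
    using infdist_pos_not_in_closed[of "- V n" x] V(1)[of n]
    by (auto simp: d_def infdist_nonneg)
  \<comment> \<open>Each summand increases to the indicator of the open set \<open>V n\<close>, so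
    the supremum counts the \<open>V n\<close> that contain \<open>x\<close>; the leading 1 makes up
    for rounding \<open>g x\<close> to an integer.\<close>
  define G where "G m x = 1 + (\<Sum>n<m. min 1 (real m * d n x))" for m x
  \<comment> \<open>The indicators count the surplus of the sets \<open>V n\<close> over
    \<open>E n\<close>; their integrals are bounded by a geometric series.\<close>
  define e where "e x = g x + (\<Sum>n. indicator (V n - E n) x)" for x
  show thesis
  proof (rule that[of G e])
    fix m n :: nat and x
    have "continuous_on UNIV (d n)" for n unfolding d_def by (cases "V n = UNIV") (auto intro!: continuous_intros)
    then show "continuous_on UNIV (G m)" unfolding G_def by (intro continuous_intros continuous_on_min) auto
    show "0 \<le> G m x" unfolding G_def using d by (intro add_nonneg_nonneg sum_nonneg) auto
    show "G m x \<le> G n x" if "m \<le> n"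
    proof -
      have "(\<Sum>i<m. min 1 (real m * d i x)) \<le> (\<Sum>i<m. min 1 (real n * d i x))"
        using that d by (intro sum_mono min.mono mult_right_mono) auto
      also have "\<dots> \<le> (\<Sum>i<n. min 1 (real n * d i x))" using that d by (intro sum_mono2) auto
      finally show ?thesis by (simp add: G_def)
    qed
  next
    fix x
    have N: "of_nat N + 1 \<le> (SUP m. ennreal (G m x))" if "of_nat N < g x" for N
    proof -
      have "x \<in> V n" if "n < N" for n
      proof -
        have "(of_nat (Suc n) :: ennreal) \<le> of_nat N" using that by (simp add: Suc_leI del: of_nat_Suc)
        then have "of_nat (Suc n) < g x" using \<open>of_nat N < g x\<close> by (rule le_less_trans)
        then show ?thesis using V(2)[of n] unfolding E_def by blast
      qed
      then have pos: "d n x > 0" if "n < N" for n using d that by auto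
      obtain m0 where m0: "\<forall>n<N. 1 \<le> real m0 * d n x"
      proof -
        have "\<exists>k::nat. 1 \<le> real k * d n x" if "n < N" for n
        proof -
          obtain k :: nat where "1 / d n x < k" using reals_Archimedean2 by blast
          then show ?thesis using pos[OF that] by (intro exI[of _ k]) (simp add: field_simps)
        qed
        then obtain k where k: "\<And>n. n < N \<Longrightarrow> 1 \<le> real (k n) * d n x" by metis
        have "1 \<le> real (\<Sum>n<N. k n) * d n x" if "n < N" for n
        proof -
          have "k n \<le> (\<Sum>n<N. k n)" using that by (intro member_le_sum) auto
          then have "real (k n) * d n x \<le> real (\<Sum>n<N. k n) * d n x" using d by (intro mult_right_mono) (auto simp del: of_nat_sum)
          then show ?thesis using k[OF that] by linarith
        qed
        then show thesis using that by blast
      qed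
      define m where "m = max m0 N"
      have "real N = (\<Sum>n<N. min 1 (real m * d n x))"
      proof -
        have "1 \<le> real m * d n x" if "n < N" for n
        proof -
          have "real m0 * d n x \<le> real m * d n x" using d by (intro mult_right_mono) (auto simp: m_def)
          then show ?thesis using m0 that by fastforce
        qed
        then show ?thesis by (simp add: min_absorb1)
      qed
      also have "\<dots> \<le> (\<Sum>n<m. min 1 (real m * d n x))" using d by (intro sum_mono2) (auto simp: m_def)
      finally have "ennreal (real N + 1) \<le> ennreal (G m x)" by (intro ennreal_leI) (simp add: G_def)
      also have "\<dots> \<le> (SUP m. ennreal (G m x))" by (intro SUP_upper) auto
      finally show ?thesis by (simp add: ennreal_of_nat_eq_real_of_nat)
    qed
    show "g x \<le> (SUP m. ennreal (G m x))"
    proof (cases "g x" rule: ennreal_cases)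
      case (real r)
      show ?thesis
      proof (cases "r \<le> 1")
        case True
        have "g x \<le> ennreal (G 0 x)" using real True by (auto simp: G_def intro: ennreal_leI)
        also have "\<dots> \<le> (SUP m. ennreal (G m x))" by (intro SUP_upper) auto
        finally show ?thesis .
      next
        case False
        define N where "N = nat (\<lceil>r\<rceil> - 1)"
        have NN: "real N < r" "r \<le> real N + 1" using False unfolding N_def by linarith+
        then have "of_nat N < g x" using real by (simp add: ennreal_of_nat_eq_real_of_nat ennreal_lessI)
        from N[OF this] have "ennreal (real N + 1) \<le> (SUP m. ennreal (G m x))"
          by (simp add: ennreal_of_nat_eq_real_of_nat)
        moreover have "g x \<le> ennreal (real N + 1)" unfolding real by (rule ennreal_leI) (rule NN)
        ultimately show ?thesis by (rule order_trans[rotated])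
      qed
    next
      case top
      have "of_nat N \<le> (SUP m. ennreal (G m x))" for N
        using N[of N] top by (auto intro: order_trans[rotated] simp: of_nat_less_top)
      then have "(SUP N::nat. of_nat N) \<le> (SUP m. ennreal (G m x))" by (intro SUP_least)
      then show ?thesis unfolding ennreal_SUP_of_nat_eq_top top .
    qed
    show "(SUP m. ennreal (G m x)) \<le> 1 + e x"
    proof (rule SUP_least)
      fix m
      have *: "(\<Sum>n<N. indicator (E n) x) \<le> g x" for N
      proof (induction N)
        case (Suc N)
        show ?case
        proof (cases "x \<in> E N")
          case True
          have "(\<Sum>n<Suc N. indicator (E n) x :: ennreal) \<le> (\<Sum>n<Suc N. 1)" by (intro sum_mono) (auto simp: indicator_def)
          also have "\<dots> = of_nat (Suc N)" by simp
          also have "\<dots> \<le> g x" using True by (auto simp: E_def)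
          finally show ?thesis .
        next
          case False then show ?thesis using Suc by simp
        qed
      qed simp
      have "ennreal (G m x) \<le> ennreal (1 + (\<Sum>n<m. indicator (V n) x))"
        unfolding G_def using d by (intro ennreal_leI add_left_mono sum_mono) (auto simp: indicator_def)
      also have "\<dots> = 1 + (\<Sum>n<m. indicator (V n) x)"
        by (simp add: ennreal_plus sum_nonneg sum_ennreal[symmetric] ennreal_indicator)
      also have "\<dots> \<le> 1 + (\<Sum>n<m. indicator (E n) x + indicator (V n - E n) x)"
        using V(2) by (intro add_left_mono sum_mono) (auto simp: indicator_def)
      also have "\<dots> \<le> 1 + e x" unfolding sum.distrib e_def
        by (intro add_left_mono add_mono * sum_le_suminf) auto
      finally show "ennreal (G m x) \<le> 1 + e x" .
    qed
  next
    show "e \<in> borel_measurable borel" unfolding e_def by measurable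
    have "(\<integral>\<^sup>+ x. e x \<partial>M) = (\<integral>\<^sup>+ x. g x \<partial>M) + (\<Sum>n. emeasure M (V n - E n))"
      unfolding e_def by (subst nn_integral_add) (auto simp: nn_integral_suminf)
    also have "(\<Sum>n. emeasure M (V n - E n)) \<le> (\<Sum>n. ennreal ((1/2)^Suc n))" by (intro suminf_le V) auto
    also have "\<dots> = ennreal 1" by (intro suminf_ennreal_eq power_half_series) auto
    finally have "(\<integral>\<^sup>+ x. e x \<partial>M) \<le> (\<integral>\<^sup>+ x. g x \<partial>M) + ennreal 1" by (simp add: add_left_mono)
    also have "\<dots> < \<infinity>" using fin by (simp add: ennreal_add_less_top)
    finally show "(\<integral>\<^sup>+ x. e x \<partial>M) < \<infinity>" .
  qed
qed

end

section \<open>Lower semicontinuous path potentials\<close>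

lemma seg_lower:
  assumes rc: "rectifiable_curve \<gamma>" and ab: "0 \<le> a" "a \<le> b" "b \<le> 1"
    and r: "0 \<le> r" "\<And>t. a \<le> t \<Longrightarrow> t \<le> b \<Longrightarrow> ennreal r \<le> g (\<gamma> t)"
  shows "ennreal (r * plen \<gamma> a b) \<le> seg \<gamma> a b g"
proof -
  have "ennreal (r * plen \<gamma> a b) = ennreal r * emeasure (interval_measure (arclen \<gamma>)) {a..b}"
    using emeasure_arclen_Icc[OF rc ab(2)] arclen_diff[OF rc ab] plen_nonneg[OF rc ab] r
    by (simp add: ennreal_mult)
  also have "\<dots> = (\<integral>\<^sup>+ t\<in>{a..b}. ennreal r \<partial>interval_measure (arclen \<gamma>))"
    by (simp add: nn_integral_cmult_indicator)
  also have "\<dots> \<le> seg \<gamma> a b g" using r by (intro nn_integral_mono) (auto simp: indicator_def)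
  finally show ?thesis .
qed

lemma seg_upper:
  assumes rc: "rectifiable_curve \<gamma>" and ab: "0 \<le> a" "a \<le> b" "b \<le> 1"
    and r: "0 \<le> r" "\<And>t. a \<le> t \<Longrightarrow> t \<le> b \<Longrightarrow> g (\<gamma> t) \<le> ennreal r"
  shows "seg \<gamma> a b g \<le> ennreal (r * plen \<gamma> a b)"
proof -
  have "seg \<gamma> a b g \<le> (\<integral>\<^sup>+ t\<in>{a..b}. ennreal r \<partial>interval_measure (arclen \<gamma>))"
    using r by (intro nn_integral_mono) (auto simp: indicator_def)
  also have "\<dots> = ennreal r * emeasure (interval_measure (arclen \<gamma>)) {a..b}"
    by (simp add: nn_integral_cmult_indicator)
  also have "\<dots> = ennreal (r * plen \<gamma> a b)"
    using emeasure_arclen_Icc[OF rc ab(2)] arclen_diff[OF rc ab] plen_nonneg[OF rc ab] r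
    by (simp add: ennreal_mult)
  finally show ?thesis .
qed

lemma line_integral_lower:
  assumes "rectifiable_curve \<gamma>" "0 \<le> r" "\<And>x. ennreal r \<le> g x"
  shows "ennreal (r * plen \<gamma> 0 1) \<le> line_integral \<gamma> g"
  unfolding line_integral_seg using assms by (intro seg_lower) auto

lemma line_integral_const_curve: "line_integral (\<lambda>_. x) g = 0" and rectifiable_const: "rectifiable_curve (\<lambda>_. x)"
proof -
  show rc: "rectifiable_curve (\<lambda>_. x)" by (rule lipschitz_rectifiable(1)[of _ 0]) simp
  have "plen (\<lambda>_. x) 0 1 \<le> 0 * (1 - 0)" by (rule lipschitz_rectifiable(2)) auto
  then have "plen (\<lambda>_. x) 0 1 = 0" using plen_nonneg[OF rc, of 0 1] by auto
  then have "emeasure (interval_measure (arclen (\<lambda>_. x))) UNIV = 0" using emeasure_arclen_UNIV[OF rc] by simp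
  then have "space (interval_measure (arclen (\<lambda>_. x))) \<in> null_sets (interval_measure (arclen (\<lambda>_. x)))"
    by (auto simp: null_sets_def)
  from nn_integral_null_set[OF this, of "\<lambda>t. g x * indicator {0..1} t"]
  show "line_integral (\<lambda>_. x) g = 0" by (simp add: line_integral_def)
qed

text \<open>An inscribed sum involves finitely many points and converges with them, and length is a
  supremum of such sums. A general filter is used because limit curves will come from Tychonoff
  compactness, without subsequences.\<close>

lemma plen_lsc:
  assumes "\<And>t. 0 \<le> t \<Longrightarrow> t \<le> 1 \<Longrightarrow> ((\<lambda>f. f t) \<longlongrightarrow> \<gamma> t) \<H>" and rc: "\<forall>\<^sub>F f in \<H>. rectifiable_curve f"
    and ab: "0 \<le> a" "a \<le> b" "b \<le> 1" and "e > 0"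
  shows "\<forall>\<^sub>F f in \<H>. plen \<gamma> a b - e < plen f a b"
proof -
  obtain S where S: "psum \<gamma> a b S" "plen \<gamma> a b - e/2 < S" using plen_approx[of a b "e/2"] ab \<open>e > 0\<close> by auto
  have "psum \<gamma> a b S \<Longrightarrow> b \<le> 1 \<Longrightarrow> e > 0 \<Longrightarrow> \<forall>\<^sub>F f in \<H>. \<exists>S'. psum f a b S' \<and> S - e < S'" for b S e
  proof (induction arbitrary: e rule: psum.induct)
    case psum_refl then show ?case by (auto intro!: always_eventually exI[of _ 0] psum.psum_refl)
  next
    case (psum_step c S b)
    have "a \<le> c" using psum_le psum_step by metis
    then have "((\<lambda>f. dist (f c) (f b)) \<longlongrightarrow> dist (\<gamma> c) (\<gamma> b)) \<H>"
      using ab psum_step.hyps psum_step.prems by (intro tendsto_dist assms(1)) auto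
    then have "\<forall>\<^sub>F f in \<H>. dist (\<gamma> c) (\<gamma> b) - e/2 < dist (f c) (f b)"
      using psum_step.prems by (intro order_tendstoD(1)) auto
    moreover have "\<forall>\<^sub>F f in \<H>. \<exists>S'. psum f a c S' \<and> S - e/2 < S'"
      using psum_step by (intro psum_step.IH) auto
    ultimately show ?case
    proof eventually_elim
      case (elim f)
      then obtain S' where "psum f a c S'" "S - e/2 < S'" by auto
      then show ?case using elim(1) psum.psum_step[of f a c S' b] \<open>c \<le> b\<close>
        by (intro exI[of _ "S' + dist (f c) (f b)"]) auto
    qed
  qed
  from this[OF S(1) ab(3), of "e/2"] \<open>e > 0\<close>
  have "\<forall>\<^sub>F f in \<H>. \<exists>S'. psum f a b S' \<and> S - e/2 < S'" by auto
  with rc show ?thesis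
  proof eventually_elim
    case (elim f)
    then obtain S' where S': "psum f a b S'" "S - e/2 < S'" by auto
    have "S' \<le> plen f a b" by (rule plen_upper[OF elim(1) ab(1,3) S'(1)])
    then show ?case using S S' by linarith
  qed
qed

text \<open>On an arc so short that \<open>g\<close> varies by less than \<open>\<eta>\<close>, the
  integral is nearly a constant times the length, and length is lower semicontinuous. The common
  Lipschitz constant provides one subdivision that is fine enough for all the curves.\<close>

lemma line_integral_lsc:
  fixes \<gamma> :: "real \<Rightarrow> 'a::metric_space" and g :: "'a \<Rightarrow> real"
  assumes lim: "\<And>t. 0 \<le> t \<Longrightarrow> t \<le> 1 \<Longrightarrow> ((\<lambda>f. f t) \<longlongrightarrow> \<gamma> t) \<H>"
    and lip: "\<forall>\<^sub>F f in \<H>. (\<forall>s t. 0 \<le> s \<longrightarrow> s \<le> t \<longrightarrow> t \<le> 1 \<longrightarrow> dist (f s) (f t) \<le> L * (t - s)) \<and> (\<forall>t\<in>{0..1}. f t \<in> B)"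
    and lip\<gamma>: "\<And>s t. 0 \<le> s \<Longrightarrow> s \<le> t \<Longrightarrow> t \<le> 1 \<Longrightarrow> dist (\<gamma> s) (\<gamma> t) \<le> L * (t - s)" "\<And>t. t \<in> {0..1} \<Longrightarrow> \<gamma> t \<in> B"
    and B: "compact B" and g: "continuous_on UNIV g" "\<And>x. 0 \<le> g x" and "e > 0"
  shows "\<forall>\<^sub>F f in \<H>. line_integral \<gamma> (\<lambda>x. ennreal (g x)) \<le> line_integral f (\<lambda>x. ennreal (g x)) + ennreal e"
proof -
  let ?g = "\<lambda>x. ennreal (g x)"
  have gb: "?g \<in> borel_measurable borel"
    using borel_measurable_continuous_onI[OF g(1)] by measurable
  have L: "L \<ge> 0" using order_trans[OF zero_le_dist lip\<gamma>(1)[of 0 1]] by simp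
  have rc\<gamma>: "rectifiable_curve \<gamma>" by (rule lipschitz_rectifiable(1)[OF lip\<gamma>(1)])
  have rc: "\<forall>\<^sub>F f in \<H>. rectifiable_curve f"
    using lip by eventually_elim (rule lipschitz_rectifiable(1)[of _ L], auto)
  \<comment> \<open>On each arc the constants \<open>\<alpha> + \<eta>\<close> above and
    \<open>\<alpha> - 2 * \<eta>\<close> below differ by \<open>3 * \<eta>\<close>; over a total
    length of at most \<open>L\<close> this may cost \<open>e/2\<close>.\<close>
  define \<eta> where "\<eta> = e / (6 * (L + 1))"
  have \<eta>: "\<eta> > 0" "3 * \<eta> * L \<le> e / 2" using \<open>e > 0\<close> L by (auto simp: \<eta>_def field_simps)
  have "uniformly_continuous_on B g"
    using B g(1) by (intro compact_uniformly_continuous) (auto intro: continuous_on_subset)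
  then obtain \<delta> where \<delta>: "\<delta> > 0" "\<And>x y. x \<in> B \<Longrightarrow> y \<in> B \<Longrightarrow> dist x y < \<delta> \<Longrightarrow> \<bar>g x - g y\<bar> < \<eta>"
    unfolding uniformly_continuous_on_def dist_real_def using \<eta>(1) by metis
  have local: "\<forall>\<^sub>F f in \<H>. seg \<gamma> a b ?g \<le> seg f a b ?g + ennreal (\<epsilon> + 3 * \<eta> * L * (b - a))"
    if ab: "0 \<le> a" "a \<le> b" "b \<le> 1" "L * (b - a) < \<delta>" and \<epsilon>: "\<epsilon> > 0" for a b \<epsilon>
  proof -
    define \<alpha> where "\<alpha> = g (\<gamma> a)"
    have \<alpha>: "\<alpha> \<ge> 0" using g(2) by (simp add: \<alpha>_def)
    have "((\<lambda>f. g (f a)) \<longlongrightarrow> \<alpha>) \<H>" unfolding \<alpha>_def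
      using continuous_on_tendsto_compose[OF g(1) lim[of a]] ab by auto
    then have "\<forall>\<^sub>F f in \<H>. \<alpha> - \<eta> < g (f a)" using \<eta> by (intro order_tendstoD(1)) auto
    moreover have "\<forall>\<^sub>F f in \<H>. plen \<gamma> a b - \<epsilon> / (\<alpha> + 1) < plen f a b"
      using ab \<epsilon> \<alpha> by (intro plen_lsc lim rc) auto
    ultimately show ?thesis using lip rc
    proof eventually_elim
      case (elim f)
      have osc: "\<bar>g (f' t) - g (f' a)\<bar> < \<eta>"
        if "a \<le> t" "t \<le> b" "\<And>s t. 0 \<le> s \<Longrightarrow> s \<le> t \<Longrightarrow> t \<le> 1 \<Longrightarrow> dist (f' s) (f' t) \<le> L * (t - s)"
          "\<And>t. t \<in> {0..1} \<Longrightarrow> f' t \<in> B" for f' t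
      proof (rule \<delta>(2))
        have "dist (f' a) (f' t) \<le> L * (t - a)" using that ab by auto
        also have "\<dots> \<le> L * (b - a)" using that L by (intro mult_left_mono) auto
        finally show "dist (f' t) (f' a) < \<delta>" using ab by (simp add: dist_commute)
      qed (use that ab in auto)
      define P where "P = plen \<gamma> a b"
      have P: "0 \<le> P" "P \<le> L * (b - a)" unfolding P_def
        using plen_nonneg[OF rc\<gamma>] lipschitz_rectifiable(2)[OF lip\<gamma>(1)] ab by auto
      have Pf: "0 \<le> plen f a b" using plen_nonneg[OF elim(4)] ab by auto
      have up: "seg \<gamma> a b ?g \<le> ennreal ((\<alpha> + \<eta>) * P)" unfolding P_def
      proof (rule seg_upper[OF rc\<gamma>])
        show "ennreal (g (\<gamma> t)) \<le> ennreal (\<alpha> + \<eta>)" if "a \<le> t" "t \<le> b" for t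
          using osc[OF that lip\<gamma>] by (intro ennreal_leI) (auto simp: \<alpha>_def)
      qed (use ab \<alpha> \<eta> in auto)
      \<comment> \<open>One \<open>\<eta>\<close> is for the value at the start of the arc on
        \<open>f\<close> against that on \<open>\<gamma>\<close>, the other for the oscillation
        along \<open>f\<close>.\<close>
      define r where "r = max 0 (\<alpha> - 2 * \<eta>)"
      have lo: "ennreal (r * plen f a b) \<le> seg f a b ?g"
      proof (rule seg_lower[OF elim(4)])
        show "ennreal r \<le> ennreal (g (f t))" if "a \<le> t" "t \<le> b" for t
        proof (rule ennreal_leI)
          have "\<bar>g (f t) - g (f a)\<bar> < \<eta>" by (rule osc[OF that]) (use elim(3) in auto)
          then show "r \<le> g (f t)" using elim(1) g(2)[of "f t"] by (auto simp: r_def)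
        qed
      qed (use ab in \<open>auto simp: r_def\<close>)
      have "(\<alpha> - 2 * \<eta>) * P \<le> r * plen f a b + \<epsilon>"
      proof (cases "\<alpha> - 2 * \<eta> \<ge> 0")
        case True
        have "(\<alpha> - 2 * \<eta>) * (P - \<epsilon> / (\<alpha> + 1)) \<le> r * plen f a b"
          using True elim(2) by (auto simp: r_def P_def intro!: mult_left_mono)
        moreover have "(\<alpha> - 2 * \<eta>) * (\<epsilon> / (\<alpha> + 1)) \<le> (\<alpha> + 1) * (\<epsilon> / (\<alpha> + 1))"
          using True \<alpha> \<epsilon> \<eta> by (intro mult_right_mono) auto
        moreover have "(\<alpha> + 1) * (\<epsilon> / (\<alpha> + 1)) = \<epsilon>" using \<alpha> by simp
        ultimately show ?thesis unfolding right_diff_distrib by linarith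
      next
        case False
        then have "(\<alpha> - 2 * \<eta>) * P \<le> 0" using P by (intro mult_nonpos_nonneg) auto
        also have "0 \<le> r * plen f a b + \<epsilon>" using Pf \<epsilon> by (auto simp: r_def)
        finally show ?thesis .
      qed
      moreover have "3 * \<eta> * P \<le> 3 * \<eta> * (L * (b - a))" using P \<eta> by (intro mult_left_mono) auto
      ultimately have "(\<alpha> + \<eta>) * P \<le> r * plen f a b + (\<epsilon> + 3 * \<eta> * L * (b - a))" by (simp add: algebra_simps)
      then have "ennreal ((\<alpha> + \<eta>) * P) \<le> ennreal (r * plen f a b + (\<epsilon> + 3 * \<eta> * L * (b - a)))" by (rule ennreal_leI)
      also have "\<dots> = ennreal (r * plen f a b) + ennreal (\<epsilon> + 3 * \<eta> * L * (b - a))"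
        using Pf \<epsilon> \<eta> L ab by (intro ennreal_plus) (auto simp: r_def intro!: add_nonneg_nonneg mult_nonneg_nonneg)
      also have "\<dots> \<le> seg f a b ?g + ennreal (\<epsilon> + 3 * \<eta> * L * (b - a))" by (intro add_right_mono lo)
      finally show ?case using up by (rule order_trans[rotated])
    qed
  qed
  obtain N :: nat where N: "L / \<delta> < real N" using reals_Archimedean2 by blast
  then have "real N > 0" using L \<delta> by (meson divide_nonneg_pos le_less_trans)
  have step: "L * (real (Suc i) / real N - real i / real N) < \<delta>" for i
    using N \<open>real N > 0\<close> \<delta> by (simp add: field_simps)
  \<comment> \<open>The \<open>\<epsilon>\<close> is left free so that one half can go to the
    induction hypothesis and the other to the new arc.\<close>
  have "i \<le> N \<Longrightarrow> \<epsilon> > 0 \<Longrightarrow> \<forall>\<^sub>F f in \<H>. seg \<gamma> 0 (real i / real N) ?g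
      \<le> seg f 0 (real i / real N) ?g + ennreal (\<epsilon> + 3 * \<eta> * L * (real i / real N))" for i \<epsilon>
  proof (induction i arbitrary: \<epsilon>)
    case 0
    then show ?case using local[of 0 0 \<epsilon>] \<delta> by simp
  next
    case (Suc i)
    let ?a = "real i / real N" and ?b = "real (Suc i) / real N"
    have ab: "0 \<le> ?a" "?a \<le> ?b" "?b \<le> 1" using Suc \<open>real N > 0\<close> by (auto simp: divide_simps)
    have "\<forall>\<^sub>F f in \<H>. seg \<gamma> 0 ?a ?g \<le> seg f 0 ?a ?g + ennreal (\<epsilon>/2 + 3 * \<eta> * L * ?a)" using Suc by auto
    moreover have "\<forall>\<^sub>F f in \<H>. seg \<gamma> ?a ?b ?g \<le> seg f ?a ?b ?g + ennreal (\<epsilon>/2 + 3 * \<eta> * L * (?b - ?a))"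
      using Suc.prems by (intro local ab step) auto
    ultimately show ?case using rc
    proof eventually_elim
      case (elim f)
      have "seg \<gamma> 0 ?b ?g = seg \<gamma> 0 ?a ?g + seg \<gamma> ?a ?b ?g" using ab by (intro seg_split rc\<gamma> gb) auto
      also have "\<dots> \<le> (seg f 0 ?a ?g + ennreal (\<epsilon>/2 + 3 * \<eta> * L * ?a)) + (seg f ?a ?b ?g + ennreal (\<epsilon>/2 + 3 * \<eta> * L * (?b - ?a)))"
        by (intro add_mono elim)
      also have "\<dots> = (seg f 0 ?a ?g + seg f ?a ?b ?g) + (ennreal (\<epsilon>/2 + 3 * \<eta> * L * ?a) + ennreal (\<epsilon>/2 + 3 * \<eta> * L * (?b - ?a)))"
        by (simp add: ac_simps)
      also have "seg f 0 ?a ?g + seg f ?a ?b ?g = seg f 0 ?b ?g" using ab by (intro seg_split[symmetric] elim gb) auto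
      also have "ennreal (\<epsilon>/2 + 3 * \<eta> * L * ?a) + ennreal (\<epsilon>/2 + 3 * \<eta> * L * (?b - ?a))
          = ennreal ((\<epsilon>/2 + 3 * \<eta> * L * ?a) + (\<epsilon>/2 + 3 * \<eta> * L * (?b - ?a)))"
        using Suc.prems \<eta> L ab by (intro ennreal_plus[symmetric] add_nonneg_nonneg mult_nonneg_nonneg) auto
      also have "(\<epsilon>/2 + 3 * \<eta> * L * ?a) + (\<epsilon>/2 + 3 * \<eta> * L * (?b - ?a)) = \<epsilon> + 3 * \<eta> * L * ?b"
        by (simp only: right_diff_distrib)
      finally show ?case .
    qed
  qed
  from this[of N "e/2"] have "\<forall>\<^sub>F f in \<H>. seg \<gamma> 0 1 ?g \<le> seg f 0 1 ?g + ennreal (e/2 + 3 * \<eta> * L)"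
    using \<open>real N > 0\<close> \<open>e > 0\<close> by simp
  then show ?thesis
  proof eventually_elim
    case (elim f)
    have "ennreal (e/2 + 3 * \<eta> * L) \<le> ennreal e" using \<eta> by (intro ennreal_leI) auto
    then show ?case using elim unfolding line_integral_seg by (meson add_left_mono order_trans)
  qed
qed

section \<open>Limits of curves and the potential of a closed set\<close>

context doubling_space
begin

text \<open>The lower bound \<open>lam\<close> turns bounded integrals into bounded lengths. So the
  curves have parametrizations with a common Lipschitz constant in one compact ball, and Tychonoff
  gives a cluster point. Lower semicontinuity is used for each continuous \<open>K m\<close>; the
  supremum over \<open>m\<close> is taken at the end.\<close>

lemma curve_limit:
  fixes K :: "nat \<Rightarrow> 'a \<Rightarrow> real"
  assumes K: "\<And>m. continuous_on UNIV (K m)" "\<And>m x. lam \<le> K m x" "\<And>m n x. m \<le> n \<Longrightarrow> K m x \<le> K n x"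
    and "lam > 0" and "closed F"
    and rc: "\<And>n. rectifiable_curve (\<gamma> n)" and \<gamma>0: "(\<lambda>n. \<gamma> n 0) \<longlonglongrightarrow> x" and \<gamma>1: "\<And>n. \<gamma> n 1 \<in> F"
    and int: "\<And>n. line_integral (\<gamma> n) (\<lambda>x. SUP m. ennreal (K m x)) \<le> ennreal (c n)"
    and c: "c \<longlonglongrightarrow> C" "\<And>n. 0 \<le> c n"
  obtains \<sigma> where "rectifiable_curve \<sigma>" "\<sigma> 0 = x" "\<sigma> 1 \<in> F"
    "line_integral \<sigma> (\<lambda>x. SUP m. ennreal (K m x)) \<le> ennreal C"
proof -
  let ?k = "\<lambda>x. SUP m. ennreal (K m x)"
  have Kb: "(\<lambda>x. ennreal (K m x)) \<in> borel_measurable borel" for m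
    using borel_measurable_continuous_onI[OF K(1)] by measurable
  have kb: "?k \<in> borel_measurable borel" using Kb by measurable
  have k_lam: "ennreal lam \<le> ?k x" for x
    using K(2)[of 0 x] by (intro SUP_upper2[of 0]) (auto intro: ennreal_leI)
  obtain Q where Q': "\<And>n. norm (c n) \<le> Q"
    using convergent_imp_Bseq[OF convergentI[OF c(1)]] unfolding Bseq_def by auto
  have Q: "c n \<le> Q" for n using Q'[of n] by simp
  define L where "L = Q / lam"
  have Q0: "Q \<ge> 0" using Q[of 0] c(2)[of 0] by linarith
  then have L0: "L \<ge> 0" using \<open>lam > 0\<close> by (simp add: L_def)
  define P where "P n \<sigma> \<longleftrightarrow> \<sigma> 0 = \<gamma> n 0 \<and> \<sigma> 1 = \<gamma> n 1 \<and>
    (\<forall>s t. 0 \<le> s \<longrightarrow> s \<le> t \<longrightarrow> t \<le> 1 \<longrightarrow> dist (\<sigma> s) (\<sigma> t) \<le> L * (t - s)) \<and>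
    line_integral \<sigma> ?k \<le> ennreal (c n)" for n \<sigma>
  have "\<exists>\<sigma>. P n \<sigma>" for n
  proof -
    have "ennreal (lam * plen (\<gamma> n) 0 1) \<le> line_integral (\<gamma> n) ?k"
      using \<open>lam > 0\<close> k_lam by (intro line_integral_lower rc) auto
    also have "\<dots> \<le> ennreal Q" using int[of n] ennreal_leI[OF Q[of n]] by (rule order_trans)
    finally have "plen (\<gamma> n) 0 1 \<le> L" using \<open>lam > 0\<close> Q0 by (simp add: L_def field_simps)
    from arclength_parametrization[OF rc[of n]] obtain \<sigma> where
      \<sigma>: "\<sigma> 0 = \<gamma> n 0" "\<sigma> 1 = \<gamma> n 1"
      "\<forall>s t. 0 \<le> s \<longrightarrow> s \<le> t \<longrightarrow> t \<le> 1 \<longrightarrow> dist (\<sigma> s) (\<sigma> t) \<le> plen (\<gamma> n) 0 1 * (t - s)"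
      "\<forall>g. g \<in> borel_measurable borel \<longrightarrow> line_integral \<sigma> g = line_integral (\<gamma> n) g"
      by (elim exE conjE) (rule that)
    have "dist (\<sigma> s) (\<sigma> t) \<le> L * (t - s)" if "0 \<le> s" "s \<le> t" "t \<le> 1" for s t
      using \<sigma>(3)[rule_format, OF that] mult_right_mono[OF \<open>plen (\<gamma> n) 0 1 \<le> L\<close>, of "t - s"] that by auto
    then show ?thesis unfolding P_def using \<sigma>(1,2) \<sigma>(4)[rule_format, OF kb] int[of n] by (intro exI[of _ \<sigma>]) auto
  qed
  then obtain \<sigma>0 where "\<And>n. P n (\<sigma>0 n)" using choice[of P] by auto
  then have \<sigma>0: "\<And>n. \<sigma>0 n 0 = \<gamma> n 0" "\<And>n. \<sigma>0 n 1 = \<gamma> n 1"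
    "\<And>n s t. 0 \<le> s \<Longrightarrow> s \<le> t \<Longrightarrow> t \<le> 1 \<Longrightarrow> dist (\<sigma>0 n s) (\<sigma>0 n t) \<le> L * (t - s)"
    "\<And>n. line_integral (\<sigma>0 n) ?k \<le> ennreal (c n)" unfolding P_def by auto
  \<comment> \<open>Made constant outside \<open>{0..1}\<close>, so that the curves lie in a product
    of copies of the compact ball indexed by all reals.\<close>
  define \<sigma> where "\<sigma> n t = \<sigma>0 n (max 0 (min 1 t))" for n t
  have \<sigma>: "\<sigma> n t = \<sigma>0 n t" if "0 \<le> t" "t \<le> 1" for n t using that by (simp add: \<sigma>_def)
  have \<sigma>_lip: "dist (\<sigma> n s) (\<sigma> n t) \<le> L * (t - s)" if "0 \<le> s" "s \<le> t" "t \<le> 1" for n s t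
    using \<sigma>0(3) that by (simp add: \<sigma>)
  have \<sigma>_int: "line_integral (\<sigma> n) ?k \<le> ennreal (c n)" for n
    using \<sigma>0(4)[of n] line_integral_cong[of "\<sigma> n" "\<sigma>0 n" ?k] \<sigma> by auto
  obtain R where "\<And>n. norm (dist (\<gamma> n 0) x) \<le> R"
    using convergent_imp_Bseq[OF convergentI[OF tendsto_dist[OF \<gamma>0 tendsto_const]]] unfolding Bseq_def by blast
  then have R: "dist (\<gamma> n 0) x \<le> R" for n by simp
  define B where "B = cball x (R + L)"
  have cB: "compact B" unfolding B_def
    by (rule closed_bounded_compact[of _ x "R + L + 1"]) auto
  have \<sigma>B: "\<sigma> n t \<in> B" for n t
  proof -
    define s where "s = max 0 (min 1 t)"
    have s: "0 \<le> s" "s \<le> 1" by (auto simp: s_def)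
    have "dist (\<sigma>0 n 0) (\<sigma>0 n s) \<le> L * s" using \<sigma>0(3)[of 0 s n] s by simp
    also have "\<dots> \<le> L" using s L0 by (intro mult_left_le) auto
    finally have "dist (\<gamma> n 0) (\<sigma>0 n s) \<le> L" using \<sigma>0(1) by simp
    then show ?thesis using R[of n] dist_triangle[of x "\<sigma>0 n s" "\<gamma> n 0"]
      by (auto simp: B_def \<sigma>_def s_def dist_commute)
  qed
  define \<F> where "\<F> = filtermap \<sigma> sequentially"
  have "compactin (product_topology (\<lambda>i. euclidean) (UNIV::real set)) (PiE UNIV (\<lambda>_. B))"
    using cB by (subst compactin_PiE) auto
  then have cpt: "compact (PiE (UNIV::real set) (\<lambda>_. B))" by (simp add: euclidean_product_topology)
  moreover have "\<F> \<noteq> bot" by (simp add: \<F>_def filtermap_bot_iff)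
  moreover have "eventually (\<lambda>f. f \<in> PiE UNIV (\<lambda>_. B)) \<F>"
    using \<sigma>B by (auto simp: \<F>_def eventually_filtermap PiE_iff)
  ultimately have "\<exists>\<rho>\<in>PiE (UNIV::real set) (\<lambda>_. B). inf (nhds \<rho>) \<F> \<noteq> bot"
    using compact_filter[THEN iffD1, OF cpt, rule_format, of \<F>] by simp
  then obtain \<rho> where \<rho>: "\<rho> \<in> PiE (UNIV::real set) (\<lambda>_. B)" "inf (nhds \<rho>) \<F> \<noteq> bot" by (elim bexE)
  \<comment> \<open>Refines the sequence to a filter converging pointwise to the cluster point
    \<open>\<rho>\<close>; it takes the place of a convergent subsequence.\<close>
  define \<H> where "\<H> = inf (nhds \<rho>) \<F>"
  have \<H>: "\<H> \<noteq> bot" using \<rho> by (simp add: \<H>_def)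
  have lim: "((\<lambda>f. f t) \<longlongrightarrow> \<rho> t) \<H>" for t
  proof -
    have "((\<lambda>f. f t) \<longlongrightarrow> \<rho> t) (nhds \<rho>)"
    proof (rule topological_tendstoI)
      fix S :: "'a set" assume S: "open S" "\<rho> t \<in> S"
      have "open ((\<lambda>f. f t) -` S :: (real \<Rightarrow> 'a) set)"
        using S by (intro open_vimage continuous_on_product_coordinates)
      then show "\<forall>\<^sub>F f in nhds \<rho>. f t \<in> S" using S(2) by (auto simp: eventually_nhds)
    qed
    then show ?thesis unfolding \<H>_def by (rule tendsto_mono[rotated]) simp
  qed
  have ev: "eventually P \<H>" if "eventually (\<lambda>n. P (\<sigma> n)) sequentially" for P
    using that unfolding \<H>_def \<F>_def
    by (intro filter_leD[OF inf_le2]) (simp add: eventually_filtermap)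
  have \<rho>_lip: "dist (\<rho> s) (\<rho> t) \<le> L * (t - s)" if "0 \<le> s" "s \<le> t" "t \<le> 1" for s t
  proof (rule tendsto_upperbound[OF tendsto_dist[OF lim lim] _ \<H>])
    show "\<forall>\<^sub>F f in \<H>. dist (f s) (f t) \<le> L * (t - s)" using \<sigma>_lip that by (intro ev) auto
  qed
  show thesis
  proof (rule that[of \<rho>])
    show rc\<rho>: "rectifiable_curve \<rho>" by (rule lipschitz_rectifiable(1)[OF \<rho>_lip])
    have "((\<lambda>f. f 0) \<longlongrightarrow> x) \<F>" using \<gamma>0 unfolding \<F>_def by (simp add: filterlim_filtermap \<sigma> \<sigma>0)
    then have "((\<lambda>f. f 0) \<longlongrightarrow> x) \<H>" unfolding \<H>_def by (rule tendsto_mono[rotated]) simp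
    then show "\<rho> 0 = x" by (rule tendsto_unique[OF \<H> lim])
    show "\<rho> 1 \<in> F"
    proof (rule Lim_in_closed_set[OF \<open>closed F\<close> _ \<H> lim])
      show "\<forall>\<^sub>F f in \<H>. f 1 \<in> F" using \<gamma>1 by (intro ev) (auto simp: \<sigma> \<sigma>0)
    qed
    have Km: "line_integral \<rho> (\<lambda>x. ennreal (K m x)) \<le> ennreal C" for m
    proof (rule ennreal_le_epsilon)
      fix e :: real assume "e > 0"
      have C0: "C \<ge> 0" using c by (intro LIMSEQ_le_const) auto
      have "\<forall>\<^sub>F f in \<H>. line_integral \<rho> (\<lambda>x. ennreal (K m x)) \<le> line_integral f (\<lambda>x. ennreal (K m x)) + ennreal (e/2)"
      proof (rule line_integral_lsc[where B = B and L = L])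
        show "\<forall>\<^sub>F f in \<H>. (\<forall>s t. 0 \<le> s \<longrightarrow> s \<le> t \<longrightarrow> t \<le> 1 \<longrightarrow> dist (f s) (f t) \<le> L * (t - s)) \<and> (\<forall>t\<in>{0..1}. f t \<in> B)"
          using \<sigma>_lip \<sigma>B by (intro ev) auto
        show "0 \<le> K m x" for x using K(2)[of m x] \<open>lam > 0\<close> by linarith
      qed (use \<rho>_lip \<rho>(1) lim cB K \<open>e > 0\<close> in \<open>auto simp: PiE_iff\<close>)
      moreover have "\<forall>\<^sub>F f in \<H>. line_integral f (\<lambda>x. ennreal (K m x)) \<le> ennreal (C + e/2)"
      proof (rule ev)
        have "\<forall>\<^sub>F n in sequentially. c n < C + e/2" using c(1) \<open>e > 0\<close> by (intro order_tendstoD(2)) auto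
        then show "\<forall>\<^sub>F n in sequentially. line_integral (\<sigma> n) (\<lambda>x. ennreal (K m x)) \<le> ennreal (C + e/2)"
        proof eventually_elim
          case (elim n)
          have "line_integral (\<sigma> n) (\<lambda>x. ennreal (K m x)) \<le> line_integral (\<sigma> n) ?k"
            by (intro line_integral_mono' SUP_upper) auto
          also have "\<dots> \<le> ennreal (c n)" by (rule \<sigma>_int)
          also have "\<dots> \<le> ennreal (C + e/2)" using elim by (intro ennreal_leI) auto
          finally show ?case .
        qed
      qed
      ultimately have "\<forall>\<^sub>F f in \<H>. line_integral \<rho> (\<lambda>x. ennreal (K m x)) \<le> ennreal (C + e/2) + ennreal (e/2)"
        by eventually_elim (meson add_right_mono order_trans)
      then have "line_integral \<rho> (\<lambda>x. ennreal (K m x)) \<le> ennreal (C + e/2) + ennreal (e/2)"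
        using \<H> by (simp add: eventually_const)
      also have "\<dots> = ennreal C + ennreal e" using C0 \<open>e > 0\<close> by (simp add: ennreal_plus[symmetric] del: ennreal_plus)
      finally show "line_integral \<rho> (\<lambda>x. ennreal (K m x)) \<le> ennreal C + ennreal e" .
    qed
    have "line_integral \<rho> ?k = (\<integral>\<^sup>+ t. (SUP m. ennreal (K m (\<rho> t)) * indicator {0..1} t) \<partial>interval_measure (arclen \<rho>))"
      unfolding line_integral_def by (simp add: SUP_mult_right_ennreal)
    also have "\<dots> = (SUP m. line_integral \<rho> (\<lambda>x. ennreal (K m x)))"
      unfolding line_integral_def
    proof (rule nn_integral_monotone_convergence_SUP)
      show "incseq (\<lambda>m t. ennreal (K m (\<rho> t)) * indicator {0..1} t)"
        using K(3) by (auto simp: incseq_def le_fun_def indicator_def intro!: ennreal_leI)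
    qed (use seg_measurable[OF rc\<rho> Kb] in auto)
    also have "\<dots> \<le> ennreal C" by (intro SUP_least Km)
    finally show "line_integral \<rho> ?k \<le> ennreal C" .
  qed
qed

text \<open>\<open>h\<close> is a truncated weighted distance to \<open>F\<close>. Prepending a
  curve to a competitor gives the gradient bound, and closedness of \<open>{x. h x \<le> s}\<close>
  is \<open>curve_limit\<close> applied to nearly optimal curves.\<close>

lemma potential:
  fixes K :: "nat \<Rightarrow> 'a \<Rightarrow> real"
  assumes K: "\<And>m. continuous_on UNIV (K m)" "\<And>m x. lam \<le> K m x" "\<And>m n x. m \<le> n \<Longrightarrow> K m x \<le> K n x"
    and "lam > 0" and "closed F"
  defines "k \<equiv> \<lambda>x. SUP m. ennreal (K m x)"
  obtains h :: "'a \<Rightarrow> real" where "\<And>x. 0 \<le> h x" "\<And>x. h x \<le> 1" "\<And>x. x \<in> F \<Longrightarrow> h x = 0"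
    "\<And>s. 0 \<le> s \<Longrightarrow> open {x. h x > s}" "h \<in> borel_measurable borel" "ug h k"
    "\<And>x s. h x < s \<Longrightarrow> s \<le> 1 \<Longrightarrow> \<exists>\<gamma>. rectifiable_curve \<gamma> \<and> \<gamma> 0 = x \<and> \<gamma> 1 \<in> F \<and> line_integral \<gamma> k < ennreal s"
proof -
  have kb: "k \<in> borel_measurable borel" unfolding k_def
    using borel_measurable_continuous_onI[OF K(1)] by measurable
  \<comment> \<open>Without an admissible curve the infimum is infinite, and the truncation gives
    \<open>h x = 1\<close>.\<close>
  define H where "H x = (INF \<gamma>\<in>{\<gamma>. rectifiable_curve \<gamma> \<and> \<gamma> 0 = x \<and> \<gamma> 1 \<in> F}. line_integral \<gamma> k)" for x
  define h where "h x = enn2real (min 1 (H x))" for x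
  have hH: "ennreal (h x) = min 1 (H x)" for x
    unfolding h_def by (rule ennreal_enn2real) (auto simp: min_def less_top[symmetric] top_unique)
  have h01: "0 \<le> h x" "h x \<le> 1" for x
    unfolding h_def by (auto intro!: enn2real_leI)
  have near: "\<exists>\<gamma>. rectifiable_curve \<gamma> \<and> \<gamma> 0 = x \<and> \<gamma> 1 \<in> F \<and> line_integral \<gamma> k < ennreal s" if "h x < s" "s \<le> 1" for x s
  proof -
    have "min 1 (H x) < ennreal s" unfolding hH[symmetric] using that h01[of x] by (intro ennreal_lessI) auto
    moreover have "ennreal s \<le> 1" using that by (metis ennreal_1 ennreal_leI)
    ultimately have "H x < ennreal s" by (auto simp: min_def split: if_splits)
    then show ?thesis unfolding H_def INF_less_iff by blast
  qed
  have h_le: "h x \<le> s" if "rectifiable_curve \<gamma>" "\<gamma> 0 = x" "\<gamma> 1 \<in> F" "line_integral \<gamma> k \<le> ennreal s" "0 \<le> s" for \<gamma> x s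
  proof -
    have "H x \<le> ennreal s" unfolding H_def using that by (intro INF_lower2[of \<gamma>]) auto
    then have "ennreal (h x) \<le> ennreal s" unfolding hH by (rule min.coboundedI2)
    then show ?thesis using that by simp
  qed
  have op: "open {x. h x > s}" if "0 \<le> s" for s
  proof (cases "s < 1")
    case False
    then have "{x. h x > s} = {}" using h01(2) by (auto simp: not_less intro: order_trans)
    then show ?thesis by simp
  next
    case True
    have "closed {x. h x \<le> s}"
      unfolding closed_sequential_limits
    proof (intro allI impI)
      fix x l assume xl: "(\<forall>n. x n \<in> {x. h x \<le> s}) \<and> x \<longlonglongrightarrow> l"
      \<comment> \<open>The cap at 1 keeps \<open>c n\<close> in the range where \<open>h\<close>
        still determines the infimum.\<close>
      define c where "c n = min 1 (s + 1 / Suc n)" for n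
      have "\<exists>\<gamma>. rectifiable_curve \<gamma> \<and> \<gamma> 0 = x n \<and> \<gamma> 1 \<in> F \<and> line_integral \<gamma> k < ennreal (c n)" for n
      proof (rule near)
        have "s < s + 1 / Suc n" by simp
        moreover have "h (x n) \<le> s" using xl by simp
        ultimately show "h (x n) < c n" "c n \<le> 1" using True by (auto simp only: c_def min_less_iff_conj)
      qed
      then obtain \<gamma> where \<gamma>: "\<And>n. rectifiable_curve (\<gamma> n)" "\<And>n. \<gamma> n 0 = x n" "\<And>n. \<gamma> n 1 \<in> F"
        "\<And>n. line_integral (\<gamma> n) k < ennreal (c n)" by metis
      have "(\<lambda>n. s + 1 / Suc n) \<longlonglongrightarrow> s + 0" by (intro tendsto_add tendsto_const LIMSEQ_Suc lim_1_over_n)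
      then have "c \<longlonglongrightarrow> min 1 (s + 0)" unfolding c_def by (intro tendsto_min tendsto_const)
      then have c: "c \<longlonglongrightarrow> s" using True by simp
      have lim: "(\<lambda>n. \<gamma> n 0) \<longlonglongrightarrow> l" using xl \<gamma>(2) by simp
      have int: "line_integral (\<gamma> n) (\<lambda>x. SUP m. ennreal (K m x)) \<le> ennreal (c n)" for n
        using \<gamma>(4)[of n] unfolding k_def by (rule less_imp_le)
      have c0: "0 \<le> c n" for n using that by (simp add: c_def)
      obtain \<sigma> where "rectifiable_curve \<sigma>" "\<sigma> 0 = l" "\<sigma> 1 \<in> F" "line_integral \<sigma> k \<le> ennreal s"
        using curve_limit[OF K \<open>lam > 0\<close> \<open>closed F\<close> \<gamma>(1) lim \<gamma>(3) int c c0] unfolding k_def by blast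
      then show "l \<in> {x. h x \<le> s}" using h_le that by blast
    qed
    then have "open (- {x. h x \<le> s})" by (rule open_Compl)
    then show ?thesis by (simp add: Collect_neg_eq[symmetric] not_le)
  qed
  show thesis
  proof (rule that[of h])
    show "h x = 0" if "x \<in> F" for x
      using h_le[OF rectifiable_const, of x x 0] that h01(1)[of x] by (simp add: line_integral_const_curve)
    show "h \<in> borel_measurable borel"
    proof (rule borel_measurableI_greater)
      fix s show "{x\<in>space borel. s < h x} \<in> sets borel"
      proof (cases "0 \<le> s")
        case True then show ?thesis using op[OF True] by simp
      next
        case False then have "{x\<in>space borel. s < h x} = UNIV" using h01(1) by (auto simp: not_le intro: less_le_trans)
        then show ?thesis by simp
      qed
    qed
    show "ug h k" unfolding ug_def
    proof (intro conjI kb allI impI)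
      have one: "h (\<gamma> 0) \<le> I + h (\<gamma> 1)" if rc: "rectifiable_curve \<gamma>" and I: "line_integral \<gamma> k = ennreal I" "0 \<le> I" for \<gamma> I
      proof -
        have "H (\<gamma> 0) \<le> ennreal I + H (\<gamma> 1)"
        proof (rule ennreal_le_epsilon)
          fix e :: real assume fin: "ennreal I + H (\<gamma> 1) < top" and "e > 0"
          then have "H (\<gamma> 1) < H (\<gamma> 1) + ennreal e"
            by (cases "H (\<gamma> 1)" rule: ennreal_cases) (auto simp: ennreal_plus[symmetric] ennreal_lessI simp del: ennreal_plus)
          then obtain \<sigma> where \<sigma>: "rectifiable_curve \<sigma>" "\<sigma> 0 = \<gamma> 1" "\<sigma> 1 \<in> F" "line_integral \<sigma> k < H (\<gamma> 1) + ennreal e"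
            unfolding H_def INF_less_iff by auto
          have "H (\<gamma> 0) \<le> line_integral (\<gamma> +++ \<sigma>) k" unfolding H_def
            using rectifiable_join[OF rc \<sigma>(1)] \<sigma> by (intro INF_lower) (simp, simp add: joinpaths_def)
          also have "\<dots> = ennreal I + line_integral \<sigma> k" using rc \<sigma> I by (simp add: line_integral_join kb)
          also have "\<dots> \<le> ennreal I + H (\<gamma> 1) + ennreal e" using \<sigma>(4) by (simp add: add.assoc add_left_mono less_imp_le)
          finally show "H (\<gamma> 0) \<le> ennreal I + H (\<gamma> 1) + ennreal e" .
        qed
        then have "min 1 (H (\<gamma> 0)) \<le> ennreal I + min 1 (H (\<gamma> 1))"
          by (auto simp: min_def intro: order_trans add_increasing)
        then have "ennreal (h (\<gamma> 0)) \<le> ennreal (I + h (\<gamma> 1))" using I h01 by (simp add: hH[symmetric])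
        then show ?thesis using I h01 by (subst (asm) ennreal_le_iff) auto
      qed
      fix \<gamma> :: "real \<Rightarrow> 'a" assume rc: "rectifiable_curve \<gamma>"
      show "ennreal \<bar>h (\<gamma> 0) - h (\<gamma> 1)\<bar> \<le> line_integral \<gamma> k"
      proof (cases "line_integral \<gamma> k" rule: ennreal_cases)
        case (real I)
        have "line_integral (\<lambda>t. \<gamma> (1 - t)) k = ennreal I" using line_integral_reverse[OF rc kb] real by simp
        from one[OF rectifiable_reverse[OF rc] this] one[OF rc _ ] real
        have "\<bar>h (\<gamma> 0) - h (\<gamma> 1)\<bar> \<le> I" by (auto simp: abs_le_iff)
        then show ?thesis using real by (auto intro: ennreal_leI)
      qed simp
    qed
  qed (use h01 op near in auto)
qed

end

section \<open>Oscillation of Sobolev functions at small scales\<close>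

text \<open>Subadditivity as an integral over counting measure avoids enumerating the net and
  matches the form of \<open>overlap_bound\<close>.\<close>

lemma emeasure_UN_count_space_le:
  assumes "countable A" and N: "\<And>a. a \<in> A \<Longrightarrow> N a \<in> sets M"
  shows "emeasure M (\<Union>a\<in>A. N a) \<le> (\<integral>\<^sup>+ a. emeasure M (N a) \<partial>count_space A)"
proof -
  have "emeasure M (\<Union>a\<in>A. N a) = (\<integral>\<^sup>+ x. indicator (\<Union>a\<in>A. N a) x \<partial>M)"
    using assms by (subst nn_integral_indicator) auto
  also have "\<dots> \<le> (\<integral>\<^sup>+ x. \<integral>\<^sup>+ a. indicator (N a) x \<partial>count_space A \<partial>M)"
  proof (rule nn_integral_mono)
    fix x show "indicator (\<Union>a\<in>A. N a) x \<le> (\<integral>\<^sup>+ a. indicator (N a) x \<partial>count_space A :: ennreal)"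
    proof (cases "x \<in> (\<Union>a\<in>A. N a)")
      case True
      then obtain a where a: "a \<in> A" "x \<in> N a" by auto
      have "indicator (\<Union>a\<in>A. N a) x = (indicator (N a) x :: ennreal)" using True a(2) by (simp only: indicator_simps)
      then show ?thesis using nn_integral_ge_point[OF a(1), of "\<lambda>a. indicator (N a) x"] by simp
    qed simp
  qed
  also have "\<dots> = (\<integral>\<^sup>+ a. \<integral>\<^sup>+ x. indicator (N a) x \<partial>M \<partial>count_space A)"
    using assms by (intro nn_integral_count_space_nn_integral) auto
  also have "\<dots> = (\<integral>\<^sup>+ a. emeasure M (N a) \<partial>count_space A)"
    using N by (intro nn_integral_cong) simp
  finally show ?thesis .
qed

lemma ennreal_mult_mult: "0 \<le> a \<Longrightarrow> 0 \<le> b \<Longrightarrow> ennreal a * (ennreal b * x) = ennreal (a * b) * x"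
  by (simp add: ennreal_mult mult.assoc)

text \<open>Upper gradients have to be Borel, but superlevel sets of Sobolev functions are
  measurable only for the completion; a Borel hull with null surplus serves instead.\<close>

lemma completion_borel_superset:
  assumes "P \<in> sets (completion M)"
  obtains S where "S \<in> sets M" "P \<subseteq> S" "AE x in M. x \<in> S \<longleftrightarrow> x \<in> P"
proof -
  obtain N where N: "N \<in> null_sets M" "null_part M P \<subseteq> N" using null_part[OF assms] by auto
  have P: "main_part M P \<union> null_part M P = P" using assms by simp
  have "main_part M P \<union> N \<in> sets M" using assms N by auto
  moreover have "AE x in M. x \<in> main_part M P \<union> N \<longleftrightarrow> x \<in> P"
    using AE_not_in[OF N(1)] by eventually_elim (use P N in blast)
  ultimately show thesis using P N by (intro that[of "main_part M P \<union> N"]) auto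
qed

text \<open>The case of \<open>ug_glue\<close> in which \<open>\<phi>\<close> is the truncated
  function itself. Up to the term \<open>\<theta> * g\<close>, the gradient survives only on a hull
  of the set where the truncation is positive.\<close>

lemma ug_truncate:
  assumes ug: "ug f g" and "\<theta> > 0" and S: "S \<in> sets borel" "\<And>x. \<bar>f x - m\<bar> > \<eta> \<Longrightarrow> x \<in> S"
  shows "ug (\<lambda>x. max 0 (\<bar>f x - m\<bar> - \<eta>)) (\<lambda>x. g x * indicator S x + ennreal \<theta> * g x)"
proof (rule ug_glue[where \<phi> = "\<lambda>x. max 0 (\<bar>f x - m\<bar> - \<eta>)"])
  show "continuous_on {0..1} ((\<lambda>x. max 0 (\<bar>f x - m\<bar> - \<eta>)) \<circ> \<gamma>)"
    if "rectifiable_curve \<gamma>" "line_integral \<gamma> g < \<infinity>" for \<gamma>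
    using ug_continuous[OF ug that] unfolding o_def by (intro continuous_intros continuous_on_max)
  show "ennreal \<bar>max 0 (\<bar>f (\<sigma> 0) - m\<bar> - \<eta>) - max 0 (\<bar>f (\<sigma> 1) - m\<bar> - \<eta>)\<bar> \<le> line_integral \<sigma> g"
    if "rectifiable_curve \<sigma>" for \<sigma>
  proof -
    have "\<bar>max 0 (\<bar>f (\<sigma> 0) - m\<bar> - \<eta>) - max 0 (\<bar>f (\<sigma> 1) - m\<bar> - \<eta>)\<bar> \<le> \<bar>f (\<sigma> 0) - f (\<sigma> 1)\<bar>" by linarith
    then show ?thesis using ugD[OF ug that] by (meson ennreal_leI order_trans)
  qed
qed (use assms ug_borel[OF ug] in auto)

context doubling_space
begin

text \<open>By packing, a point lies in at most \<open>Cd^n\<close> of the dilated balls; then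
  exchange sum and integral. The condition on \<open>n\<close> is the one in
  \<open>separated_card\<close> divided by \<open>r\<close>.\<close>

lemma overlap_bound:
  assumes A: "separated r A" "r > 0" "4 * \<Lambda> + 1 \<le> 2^n" and k[measurable]: "k \<in> borel_measurable (completion M)"
  shows "(\<integral>\<^sup>+ a. \<integral>\<^sup>+ x. k x * indicator (ball a (\<Lambda> * r)) x \<partial>completion M \<partial>count_space A)
    \<le> ennreal (Cd^n) * (\<integral>\<^sup>+ x. k x \<partial>completion M)"
proof -
  have [measurable]: "ball a R \<in> sets (completion M)" for a :: 'a and R by (simp add: sets_M sets_completionI_sets)
  have cA: "countable A" using A by (intro separated_countable)
  have "(\<integral>\<^sup>+ a. \<integral>\<^sup>+ x. k x * indicator (ball a (\<Lambda> * r)) x \<partial>completion M \<partial>count_space A)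
      = (\<integral>\<^sup>+ x. \<integral>\<^sup>+ a. k x * indicator (ball a (\<Lambda> * r)) x \<partial>count_space A \<partial>completion M)"
    using cA by (intro nn_integral_count_space_nn_integral[symmetric]) auto
  also have "\<dots> \<le> (\<integral>\<^sup>+ x. ennreal (Cd^n) * k x \<partial>completion M)"
  proof (rule nn_integral_mono)
    fix x
    define Ax where "Ax = {a\<in>A. x \<in> ball a (\<Lambda> * r)}"
    have "4 * (\<Lambda> * r) + r \<le> 2^n * r" using mult_right_mono[OF A(3), of r] A(2) by (simp add: algebra_simps)
    then have fin: "finite Ax \<and> card Ax \<le> nat \<lfloor>Cd^n\<rfloor>"
      using A by (intro separated_card[of Ax x "\<Lambda> * r" r]) (auto simp: Ax_def separated_def dist_commute)
    have "(\<integral>\<^sup>+ a. k x * indicator (ball a (\<Lambda> * r)) x \<partial>count_space A) = (\<integral>\<^sup>+ a. k x * indicator Ax a \<partial>count_space A)"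
      by (intro nn_integral_cong) (auto simp: Ax_def indicator_def)
    also have "\<dots> = k x * of_nat (card Ax)"
      using fin by (subst nn_integral_cmult_indicator) (auto simp: Ax_def)
    also have "\<dots> \<le> k x * ennreal (Cd^n)"
    proof (rule mult_left_mono)
      have "real (card Ax) \<le> Cd^n" using fin Cd_pos by (simp add: le_nat_floor le_nat_iff le_floor_iff)
      then show "of_nat (card Ax) \<le> ennreal (Cd^n)" by (simp add: ennreal_of_nat_eq_real_of_nat ennreal_leI)
    qed simp
    finally show "(\<integral>\<^sup>+ a. k x * indicator (ball a (\<Lambda> * r)) x \<partial>count_space A) \<le> ennreal (Cd^n) * k x"
      by (simp add: mult.commute)
  qed
  also have "\<dots> = ennreal (Cd^n) * (\<integral>\<^sup>+ x. k x \<partial>completion M)" by (rule nn_integral_cmult) measurable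
  finally show ?thesis .
qed

end

section \<open>The Poincare inequality in integral form and its consequences at small scales\<close>

locale poincare_space = doubling_space M Cd
  for M :: "'a::{metric_space, complete_space} measure" and Cd :: real +
  fixes CP lam :: real
  assumes poincare: "poincare_1_1 M CP lam"
begin

abbreviation "CM \<equiv> completion M"

lemma CP_pos: "CP > 0" and lam_ge1: "lam \<ge> 1"
  using poincare by (auto simp: poincare_1_1_def)

lemma ball_sets [measurable]: "ball a r \<in> sets CM"
  by (simp add: sets_M sets_completionI_sets)

lemma borel_CM: "g \<in> borel_measurable borel \<Longrightarrow> g \<in> borel_measurable CM"
  using measurable_cong_sets[OF sets_M refl, of borel] by (auto intro: measurable_completion)

lemma emeasure_CM_ball: "emeasure CM (ball a r) = emeasure M (ball a r)"
  by (simp add: sets_M)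

lemma bounded_integrable_ball:
  assumes f: "f \<in> borel_measurable CM" and "\<And>x. \<bar>f x\<bar> \<le> K"
  shows "set_integrable CM (ball y r) (f::'a \<Rightarrow> real)"
  unfolding set_integrable_def
proof (rule integrableI_bounded_set[where A = "ball y r" and B = K])
  show "(\<lambda>x. indicator (ball y r) x *\<^sub>R f x) \<in> borel_measurable CM" using f by measurable
  show "emeasure CM (ball y r) < \<infinity>" by (simp only: emeasure_CM_ball ball_finite)
  show "AE x in CM. x \<in> ball y r \<longrightarrow> norm (indicator (ball y r) x *\<^sub>R f x) \<le> K"
    using assms(2) by (auto simp: indicator_def)
qed auto

lemma bounded_L1_loc:
  assumes "f \<in> borel_measurable CM" and "\<And>x. \<bar>f x\<bar> \<le> K"
  shows "L1_loc M (f::'a \<Rightarrow> real)"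
  unfolding L1_loc_def using bounded_integrable_ball[OF assms] assms(1) by (auto intro: exI[of _ 1])

lemma ball_mean_nn:
  assumes v: "v \<in> borel_measurable CM" "\<And>x. \<bar>v x\<bar> \<le> K" "\<And>x. 0 \<le> v x" and "r > 0"
  shows "ennreal (ball_mean M (ball y r) v) * emeasure M (ball y r)
    = (\<integral>\<^sup>+ x. ennreal (v x) * indicator (ball y r) x \<partial>CM)"
proof -
  let ?B = "ball y r"
  have i: "integrable CM (\<lambda>x. indicator ?B x *\<^sub>R v x)"
    using bounded_integrable_ball[OF v(1,2)] by (simp add: set_integrable_def)
  have I0: "0 \<le> (LINT x:?B|CM. v x)" unfolding set_lebesgue_integral_def
    using v(3) by (intro Bochner_Integration.integral_nonneg) auto
  obtain b where b: "emeasure M ?B = ennreal b" "b > 0"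
    using ball_pos[OF \<open>r > 0\<close>, of y] ball_finite[of y r] by (cases "emeasure M ?B" rule: ennreal_cases) auto
  have m: "measure CM ?B = b" using b by (simp add: measure_def sets_M)
  have "ennreal (ball_mean M ?B v) * emeasure M ?B = ennreal (LINT x:?B|CM. v x)"
    unfolding ball_mean_def m b(1) using b I0 by (simp add: ennreal_mult[symmetric])
  also have "\<dots> = (\<integral>\<^sup>+ x. ennreal (indicator ?B x *\<^sub>R v x) \<partial>CM)"
    unfolding set_lebesgue_integral_def using v(3) by (intro nn_integral_eq_integral[symmetric] i) auto
  also have "\<dots> = (\<integral>\<^sup>+ x. ennreal (v x) * indicator ?B x \<partial>CM)"
    by (intro nn_integral_cong) (auto simp: indicator_def)
  finally show ?thesis .
qed

lemma ball_mean_bounded: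
  assumes f: "f \<in> borel_measurable CM" "\<And>x. \<bar>f x\<bar> \<le> K" and "r > 0"
  obtains K' where "\<And>x. \<bar>f x - ball_mean M (ball y r) f\<bar> \<le> K'"
proof (rule that)
  fix x show "\<bar>f x - ball_mean M (ball y r) f\<bar> \<le> K + \<bar>ball_mean M (ball y r) f\<bar>"
    using f(2)[of x] by linarith
qed

text \<open>The means are cleared by multiplying with the measure of the ball, which is at most that
  of the dilated ball; no doubling constant enters.\<close>

lemma poincare_nn:
  assumes f: "f \<in> borel_measurable CM" "\<And>x. \<bar>f x\<bar> \<le> K" and ug: "ug f g" and "r > 0"
  shows "(\<integral>\<^sup>+ x. ennreal \<bar>f x - ball_mean M (ball y r) f\<bar> * indicator (ball y r) x \<partial>CM)
    \<le> ennreal (CP * r) * (\<integral>\<^sup>+ x. g x * indicator (ball y (lam * r)) x \<partial>CM)"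
proof -
  let ?B = "ball y r" and ?B' = "ball y (lam * r)"
  let ?v = "\<lambda>x. \<bar>f x - ball_mean M ?B f\<bar>"
  let ?I = "\<integral>\<^sup>+ x. g x * indicator ?B' x \<partial>CM"
  obtain K' where K': "\<And>x. ?v x \<le> K'" using ball_mean_bounded[OF f \<open>r > 0\<close>] by blast
  have "upper_gradient (\<lambda>x. ereal (f x)) g"
    using ug unfolding upper_gradient_def ug_def ug_ineq_def ediff_def by auto
  then have P: "ennreal (ball_mean M ?B ?v) \<le> ennreal (CP * r) * (?I / emeasure CM ?B')"
    using poincare bounded_L1_loc[OF f] \<open>r > 0\<close> unfolding poincare_1_1_def by blast
  have "?B \<subseteq> ?B'" using lam_ge1 \<open>r > 0\<close> mult_right_mono[of 1 lam r] by (intro subset_ball) auto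
  then have BB: "emeasure M ?B \<le> emeasure M ?B'" by (intro emeasure_mono) (auto simp: sets_M)
  obtain b where b: "emeasure M ?B' = ennreal b" "b > 0"
    using ball_pos[of "lam * r" y] ball_finite[of y "lam * r"] \<open>r > 0\<close> lam_ge1
    by (cases "emeasure M ?B'" rule: ennreal_cases) auto
  have "(\<integral>\<^sup>+ x. ennreal (?v x) * indicator ?B x \<partial>CM) = ennreal (ball_mean M ?B ?v) * emeasure M ?B"
    using f K' \<open>r > 0\<close> by (intro ball_mean_nn[symmetric, where K = K']) auto
  also have "\<dots> \<le> (ennreal (CP * r) * (?I / emeasure M ?B')) * emeasure M ?B'"
    using P BB by (intro mult_mono) (auto simp: emeasure_CM_ball)
  also have "\<dots> = ennreal (CP * r) * ?I"
  proof -
    have "?I / ennreal b * ennreal b = ?I"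
      using b(2) by (simp add: divide_ennreal_def mult.assoc inverse_ennreal ennreal_mult[symmetric])
    then show ?thesis by (simp add: b(1) mult.assoc)
  qed
  finally show ?thesis .
qed

lemma markov_ball:
  assumes v: "v \<in> borel_measurable CM" and "c > 0" and A: "A \<in> sets CM" and S: "S \<subseteq> A" "S \<in> sets CM"
    and vS: "\<And>x. x \<in> S \<Longrightarrow> c \<le> v x"
  shows "emeasure CM S \<le> ennreal (1/c) * (\<integral>\<^sup>+ x. ennreal (v x) * indicator A x \<partial>CM)"
proof -
  note [measurable] = v A
  have "emeasure CM S = (\<integral>\<^sup>+ x. indicator S x \<partial>CM)" using S by simp
  also have "\<dots> \<le> (\<integral>\<^sup>+ x. ennreal (1/c) * (ennreal (v x) * indicator A x) \<partial>CM)"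
  proof (rule nn_integral_mono)
    fix x show "indicator S x \<le> ennreal (1/c) * (ennreal (v x) * indicator A x)"
    proof (cases "x \<in> S")
      case True
      then have "1 \<le> 1/c * v x" "0 \<le> v x" using vS[OF True] \<open>c > 0\<close> by (auto simp: field_simps intro: order_trans[of 0 c])
      then have "1 \<le> ennreal (1/c) * ennreal (v x)"
        using \<open>c > 0\<close> by (subst ennreal_mult[symmetric]) (auto simp del: ennreal_1 simp: ennreal_1[symmetric] intro!: ennreal_leI)
      then show ?thesis using True S by auto
    qed simp
  qed
  also have "\<dots> = ennreal (1/c) * (\<integral>\<^sup>+ x. ennreal (v x) * indicator A x \<partial>CM)"
    by (intro nn_integral_cmult) measurable
  finally show ?thesis .
qed

text \<open>At a small scale \<open>r\<close> a Sobolev function oscillates little, apart from a set of measure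
  \<open>o(r)\<close>. A single application of the Poincare inequality on balls of a net gives only \<open>O(r)\<close>;
  it is improved by a second application, to truncations, whose upper gradients live on the
  exceptional set of the first step.\<close>

lemma small_oscillation:
  assumes f[measurable]: "f \<in> borel_measurable CM" and K: "\<And>x. \<bar>f x\<bar> \<le> K"
    and ug: "ug f g" and fin: "(\<integral>\<^sup>+ x. g x \<partial>M) < \<infinity>" and \<eta>: "\<eta> > 0" and \<delta>: "\<delta> > 0"
  obtains r N where "0 < r" "r \<le> \<delta>" "N \<in> sets borel" "emeasure M N \<le> ennreal (\<delta> * r)"
    "\<And>x y. x \<notin> N \<Longrightarrow> y \<notin> N \<Longrightarrow> dist x y < r \<Longrightarrow> \<bar>f x - f y\<bar> \<le> 4 * \<eta>"
proof -
  note gb = ug_borel[OF ug]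
  note [measurable] = borel_CM[OF gb]
  have nnC: "(\<integral>\<^sup>+ x. k x \<partial>CM) = (\<integral>\<^sup>+ x. k x \<partial>M)" for k by (rule nn_integral_completion)
  obtain G where G: "(\<integral>\<^sup>+ x. g x \<partial>CM) = ennreal G" "G \<ge> 0"
    using fin unfolding nnC by (cases "\<integral>\<^sup>+ x. g x \<partial>M" rule: ennreal_cases) auto
  \<comment> \<open>\<open>n\<close> is the packing exponent for the largest balls
    \<open>B3\<close>, of radius \<open>2 * lam * lam * r\<close>; \<open>j\<close> below compares
    their measure with that of \<open>B1\<close> by doubling.\<close>
  obtain n where n: "4 * (2 * lam * lam) + 1 \<le> (2::real)^n"
    using real_arch_pow[of 2 "4 * (2 * lam * lam) + 1"] by (auto intro: less_imp_le)
  obtain j where j: "lam * lam \<le> (2::real)^j"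
    using real_arch_pow[of 2 "lam * lam"] by (auto intro: less_imp_le)
  \<comment> \<open>The constant of the estimate for bad balls; it also dominates the constants for
    \<open>E a\<close> and for the good balls.\<close>
  define c2 where "c2 = 4 * CP * lam / \<eta>"
  \<comment> \<open>Adds the two kinds of pieces of \<open>T\<close>: the sets \<open>E a\<close>,
    and the dilated bad balls \<open>B3 a\<close> with a further factor \<open>Cd^j\<close>.\<close>
  define c1 where "c1 = c2 + Cd^j * c2"
  define D where "D = Cd^n"
  have pos: "c2 > 0" "c1 > 0" "D > 0" "CP > 0" "lam \<ge> 1" "Cd > 0"
    using CP_pos lam_ge1 \<eta> Cd_pos by (auto simp: c1_def c2_def D_def add_pos_pos)
  \<comment> \<open>\<open>\<theta>\<close> and the \<open>\<epsilon>\<close> below are each granted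
    half of the final bound \<open>\<delta> * r\<close>.\<close>
  define \<theta> where "\<theta> = \<delta> / (2 * c2 * D * (G + 1))"
  have \<theta>: "\<theta> > 0" "c2 * D * (\<theta> * G) \<le> \<delta> / 2" proof -
    show "\<theta> > 0" unfolding \<theta>_def using pos \<delta> G(2) by (intro divide_pos_pos mult_pos_pos) auto
    have "c2 * D * (\<theta> * G) = \<delta> / 2 * (G / (G + 1))" using pos by (simp add: \<theta>_def)
    also have "\<dots> \<le> \<delta> / 2 * 1" using \<delta> G(2) by (intro mult_left_mono) auto
    finally show "c2 * D * (\<theta> * G) \<le> \<delta> / 2" by simp
  qed
  define \<epsilon> where "\<epsilon> = \<delta> / (2 * c2 * D)"
  have \<epsilon>: "\<epsilon> > 0" "c2 * D * \<epsilon> = \<delta> / 2" using pos \<delta> by (auto simp: \<epsilon>_def)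
  obtain \<delta>' where \<delta>': "\<delta>' > 0"
    "\<And>A. A \<in> sets CM \<Longrightarrow> emeasure CM A \<le> ennreal \<delta>' \<Longrightarrow> (\<integral>\<^sup>+ x. g x * indicator A x \<partial>CM) \<le> ennreal \<epsilon>"
    using nn_integral_abs_cont[of g CM \<epsilon>] G \<epsilon>(1) by (auto simp: borel_CM[OF gb])
  \<comment> \<open>So small that \<open>T\<close>, of measure at most
    \<open>c1 * r * D * G\<close>, falls below the threshold \<open>\<delta>'\<close>; then
    \<open>g\<close> has integral at most \<open>\<epsilon>\<close> over \<open>T\<close>. This is
    the gain from O(r) to o(r).\<close>
  define r where "r = min \<delta> (\<delta>' / (c1 * D * (G + 1)))"
  have r: "r > 0" "r \<le> \<delta>" using pos \<delta> \<delta>' G by (auto simp: r_def)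
  have r2: "c1 * r * (D * G) \<le> \<delta>'"
  proof -
    have "c1 * r * (D * G) \<le> c1 * D * (G + 1) * r" using pos r G by (simp add: algebra_simps)
    also have "\<dots> \<le> c1 * D * (G + 1) * (\<delta>' / (c1 * D * (G + 1)))"
      using pos G by (intro mult_left_mono) (auto simp: r_def)
    also have "\<dots> = \<delta>'" using pos G by simp
    finally show ?thesis .
  qed
  obtain A :: "'a set" where A: "separated r A" "\<And>x. \<exists>a\<in>A. dist a x < r" using maximal_separated[OF r(1)] by blast
  have cA: "countable A" using A(1) r(1) by (rule separated_countable)
  \<comment> \<open>Radius \<open>2 * r\<close>, so that the ball around a net point within
    \<open>r\<close> of \<open>x\<close> contains all points within \<open>r\<close> of
    \<open>x\<close>.\<close>
  define B1 where "B1 a = ball a (2 * r)" for a :: 'a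
  define B2 where "B2 a = ball a (lam * (2 * r))" for a :: 'a
  define B3 where "B3 a = ball a (lam * (lam * (2 * r)))" for a :: 'a
  have Bm[measurable]: "B1 a \<in> sets CM" "B2 a \<in> sets CM" "B3 a \<in> sets CM" for a
    by (auto simp: B1_def B2_def B3_def ball_sets)
  have l1: "2 * r \<le> lam * (2 * r)" using mult_right_mono[of 1 lam "2 * r"] pos r by auto
  have l2: "lam * (2 * r) \<le> lam * (lam * (2 * r))" using mult_left_mono[OF l1, of lam] pos by auto
  have B12: "B1 a \<subseteq> B2 a" "B2 a \<subseteq> B3 a" for a using l1 l2 by (auto simp: B1_def B2_def B3_def)
  define I where "I S = (\<integral>\<^sup>+ x. g x * indicator S x \<partial>CM)" for S
  have Imono: "S \<subseteq> T \<Longrightarrow> I S \<le> I T" for S T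
    unfolding I_def by (intro nn_integral_mono mult_left_mono) (auto simp: indicator_def)
  define m where "m a = ball_mean M (B2 a) f" for a
  have p1: "(\<integral>\<^sup>+ x. ennreal \<bar>f x - m a\<bar> * indicator (B2 a) x \<partial>CM) \<le> ennreal (CP * (lam * (2 * r))) * I (B3 a)" for a
    unfolding m_def I_def B2_def B3_def using pos r by (intro poincare_nn[OF f K ug]) auto
  define E where "E a = {x\<in>B2 a. \<bar>f x - m a\<bar> > \<eta>}" for a
  have E_alt: "E a = B2 a \<inter> {x\<in>space CM. \<bar>f x - m a\<bar> > \<eta>}" for a by (auto simp: E_def)
  have Em[measurable]: "E a \<in> sets CM" for a unfolding E_alt by measurable
  have E1: "emeasure CM (E a) \<le> ennreal (c2 * r) * I (B3 a)" for a
  proof -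
    have "emeasure CM (E a) \<le> ennreal (1/\<eta>) * (\<integral>\<^sup>+ x. ennreal \<bar>f x - m a\<bar> * indicator (B2 a) x \<partial>CM)"
      using \<eta> by (intro markov_ball) (auto simp: E_def intro: less_imp_le)
    also have "\<dots> \<le> ennreal (1/\<eta>) * (ennreal (CP * (lam * (2 * r))) * I (B3 a))" by (intro mult_left_mono p1) auto
    also have "\<dots> = ennreal (1/\<eta> * (CP * (lam * (2 * r)))) * I (B3 a)"
      using \<eta> pos r by (intro ennreal_mult_mult) auto
    also have "\<dots> \<le> ennreal (c2 * r) * I (B3 a)"
      using \<eta> pos r by (intro mult_right_mono ennreal_leI) (auto simp: c2_def field_simps)
    finally show ?thesis .
  qed
  \<comment> \<open>The oscillation in excess of \<open>\<eta>\<close>; up to a small multiple of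
    \<open>g\<close>, its gradient lives on \<open>E a\<close> inside \<open>B2 a\<close>.\<close>
  define w where "w a x = max 0 (\<bar>f x - m a\<bar> - \<eta>)" for a x
  have wm[measurable]: "w a \<in> borel_measurable CM" for a unfolding w_def by measurable
  have w0: "0 \<le> w a x" for a x by (simp add: w_def)
  have wle: "w a x \<le> \<bar>f x - m a\<bar>" for a x using \<eta> by (auto simp: w_def)
  have wK: "\<bar>w a x\<bar> \<le> K + \<bar>m a\<bar>" for a x using wle[of a x] w0[of a x] K[of x] by linarith
  define q where "q a = ball_mean M (B1 a) (w a)" for a
  \<comment> \<open>A bad ball is charged as a whole to the first Poincare estimate. On the others
    \<open>w a x > \<eta>\<close> forces a deviation of at least \<open>\<eta>/2\<close> from the
    mean \<open>q a\<close>, to which the second estimate applies.\<close>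
  define bad where "bad a \<longleftrightarrow> q a > \<eta> / 2" for a
  define H where "H a = (\<integral>\<^sup>+ x. (g x * indicator (E a) x + ennreal \<theta> * g x) * indicator (B2 a) x \<partial>CM)" for a
  have p2: "(\<integral>\<^sup>+ x. ennreal \<bar>w a x - q a\<bar> * indicator (B1 a) x \<partial>CM) \<le> ennreal (CP * (2 * r)) * H a" for a
  proof -
    have "{x\<in>space CM. \<bar>f x - m a\<bar> > \<eta>} \<in> sets CM" by measurable
    then obtain S where S: "S \<in> sets M" "{x\<in>space CM. \<bar>f x - m a\<bar> > \<eta>} \<subseteq> S"
      "AE x in M. x \<in> S \<longleftrightarrow> x \<in> {x\<in>space CM. \<bar>f x - m a\<bar> > \<eta>}" using completion_borel_superset by blast
    have "ug (w a) (\<lambda>x. g x * indicator S x + ennreal \<theta> * g x)" unfolding w_def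
      using S(1,2) \<theta>(1) by (intro ug_truncate[OF ug]) (auto simp: sets_M)
    from poincare_nn[OF wm wK this, of "2 * r" a] r
    have "(\<integral>\<^sup>+ x. ennreal \<bar>w a x - q a\<bar> * indicator (B1 a) x \<partial>CM)
      \<le> ennreal (CP * (2 * r)) * (\<integral>\<^sup>+ x. (g x * indicator S x + ennreal \<theta> * g x) * indicator (B2 a) x \<partial>CM)"
      by (simp add: q_def B1_def B2_def)
    also have "(\<integral>\<^sup>+ x. (g x * indicator S x + ennreal \<theta> * g x) * indicator (B2 a) x \<partial>CM) = H a"
      unfolding H_def
    proof (rule nn_integral_cong_AE, use AE_completion[OF S(3)] in eventually_elim)
      case (elim x)
      then show ?case by (cases "x \<in> B2 a") (auto simp: E_def indicator_def)
    qed
    finally show ?thesis .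
  qed
  have bad1: "emeasure CM (B1 a) \<le> ennreal (c2 * r) * I (B3 a)" if "bad a" for a
  proof -
    have "ennreal (\<eta>/2) * emeasure M (B1 a) \<le> ennreal (q a) * emeasure M (B1 a)"
      using that by (intro mult_right_mono ennreal_leI) (auto simp: bad_def)
    also have "\<dots> = (\<integral>\<^sup>+ x. ennreal (w a x) * indicator (B1 a) x \<partial>CM)"
      unfolding q_def B1_def using r wK w0 by (intro ball_mean_nn) auto
    also have "\<dots> \<le> (\<integral>\<^sup>+ x. ennreal \<bar>f x - m a\<bar> * indicator (B2 a) x \<partial>CM)"
      using B12(1)[of a] wle by (intro nn_integral_mono mult_mono ennreal_leI) (auto simp: indicator_def)
    also have "\<dots> \<le> ennreal (CP * (lam * (2 * r))) * I (B3 a)" by (rule p1)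
    finally have *: "ennreal (\<eta>/2) * emeasure M (B1 a) \<le> ennreal (CP * (lam * (2 * r))) * I (B3 a)" .
    have "emeasure M (B1 a) = ennreal (2/\<eta>) * (ennreal (\<eta>/2) * emeasure M (B1 a))"
      using \<eta> by (simp add: mult.assoc[symmetric] ennreal_mult[symmetric])
    also have "\<dots> \<le> ennreal (2/\<eta>) * (ennreal (CP * (lam * (2 * r))) * I (B3 a))" by (intro mult_left_mono *) simp
    also have "\<dots> = ennreal (2/\<eta> * (CP * (lam * (2 * r)))) * I (B3 a)"
      using \<eta> pos r by (intro ennreal_mult_mult) auto
    also have "2/\<eta> * (CP * (lam * (2 * r))) = c2 * r" by (simp add: c2_def)
    finally show ?thesis by (simp add: B1_def emeasure_CM_ball)
  qed
  have bad3: "emeasure CM (B3 a) \<le> ennreal (Cd^j * c2 * r) * I (B3 a)" if "bad a" for a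
  proof -
    have "lam * (lam * (2 * r)) \<le> 2^j * (2 * r)" using mult_right_mono[OF j, of "2 * r"] r by (simp add: mult.assoc)
    then have "B3 a \<subseteq> ball a (2^j * (2 * r))" unfolding B3_def by (intro subset_ball)
    then have "emeasure M (B3 a) \<le> emeasure M (ball a (2^j * (2 * r)))" by (intro emeasure_mono) (auto simp: sets_M)
    also have "\<dots> \<le> ennreal (Cd^j) * emeasure M (B1 a)" unfolding B1_def using r by (intro doubling_iterate) auto
    also have "\<dots> \<le> ennreal (Cd^j) * (ennreal (c2 * r) * I (B3 a))"
      using bad1[OF that] by (intro mult_left_mono) (auto simp: B1_def emeasure_CM_ball)
    also have "\<dots> = ennreal (Cd^j * (c2 * r)) * I (B3 a)" using pos r by (intro ennreal_mult_mult) auto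
    also have "Cd^j * (c2 * r) = Cd^j * c2 * r" by simp
    finally show ?thesis by (simp add: B3_def emeasure_CM_ball)
  qed
  have sum3: "(\<integral>\<^sup>+ a. \<integral>\<^sup>+ x. k x * indicator (B3 a) x \<partial>CM \<partial>count_space A) \<le> ennreal D * (\<integral>\<^sup>+ x. k x \<partial>CM)"
    if "k \<in> borel_measurable CM" for k
    using overlap_bound[OF A(1) r(1) n that] by (simp add: B3_def D_def mult.assoc mult.commute mult.left_commute)
  have sumI: "(\<integral>\<^sup>+ a. I (B3 a) \<partial>count_space A) \<le> ennreal (D * G)"
    using sum3[OF borel_CM[OF gb]] G pos by (simp add: I_def ennreal_mult)
  \<comment> \<open>The dilated bad balls are included so that their charges
    \<open>I (B3 a)\<close>, too, are integrals of \<open>g\<close> over a set of small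
    measure.\<close>
  define T where "T = (\<Union>a\<in>A. E a \<union> (if bad a then B3 a else {}))"
  have Tm[measurable]: "T \<in> sets CM" unfolding T_def using cA by (intro sets.countable_UN'') auto
  have "emeasure CM T \<le> (\<integral>\<^sup>+ a. emeasure CM (E a \<union> (if bad a then B3 a else {})) \<partial>count_space A)"
    unfolding T_def using cA by (intro emeasure_UN_count_space_le) auto
  also have "\<dots> \<le> (\<integral>\<^sup>+ a. ennreal (c1 * r) * I (B3 a) \<partial>count_space A)"
  proof (rule nn_integral_mono)
    fix a
    have "emeasure CM (E a \<union> (if bad a then B3 a else {})) \<le> emeasure CM (E a) + emeasure CM (if bad a then B3 a else {})"
      by (intro emeasure_subadditive) auto
    also have "\<dots> \<le> ennreal (c2 * r) * I (B3 a) + ennreal (Cd^j * c2 * r) * I (B3 a)"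
      using E1[of a] bad3[of a] by (intro add_mono) auto
    also have "\<dots> = ennreal (c1 * r) * I (B3 a)"
      using pos r by (simp add: c1_def distrib_right[symmetric] ennreal_plus[symmetric] del: ennreal_plus)
    finally show "emeasure CM (E a \<union> (if bad a then B3 a else {})) \<le> ennreal (c1 * r) * I (B3 a)" .
  qed
  also have "\<dots> = ennreal (c1 * r) * (\<integral>\<^sup>+ a. I (B3 a) \<partial>count_space A)" by (rule nn_integral_cmult) simp
  also have "\<dots> \<le> ennreal (c1 * r) * ennreal (D * G)" by (intro mult_left_mono sumI) auto
  also have "\<dots> \<le> ennreal \<delta>'" using r2 pos r G by (simp add: ennreal_mult[symmetric] ennreal_leI)
  finally have IT: "I T \<le> ennreal \<epsilon>" unfolding I_def by (intro \<delta>'(2)) auto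
  \<comment> \<open>A point of \<open>B1 a\<close> outside \<open>N a\<close> satisfies
    \<open>\<bar>f x - m a\<bar> \<le> 2 * \<eta>\<close>, so two such points give the oscillation
    \<open>4 * \<eta>\<close>.\<close>
  define N where "N a = (if bad a then B1 a else {x\<in>B1 a. w a x > \<eta>})" for a
  have N_alt: "{x\<in>B1 a. w a x > \<eta>} = B1 a \<inter> {x\<in>space CM. w a x > \<eta>}" for a by auto
  have Nm0: "{x\<in>B1 a. w a x > \<eta>} \<in> sets CM" for a unfolding N_alt by measurable
  then have Nm[measurable]: "N a \<in> sets CM" for a unfolding N_def by auto
  define k where "k x = g x * indicator T x + ennreal \<theta> * g x" for x
  have km[measurable]: "k \<in> borel_measurable CM" unfolding k_def by measurable
  have Nk: "emeasure CM (N a) \<le> ennreal (c2 * r) * (\<integral>\<^sup>+ x. k x * indicator (B3 a) x \<partial>CM)" if a: "a \<in> A" for a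
  proof (cases "bad a")
    case True
    have "B3 a \<subseteq> T" using True a by (auto simp: T_def)
    then have "I (B3 a) \<le> (\<integral>\<^sup>+ x. k x * indicator (B3 a) x \<partial>CM)"
      unfolding I_def by (intro nn_integral_mono) (auto simp: k_def indicator_def)
    then have "ennreal (c2 * r) * I (B3 a) \<le> ennreal (c2 * r) * (\<integral>\<^sup>+ x. k x * indicator (B3 a) x \<partial>CM)"
      by (rule mult_left_mono) simp
    then show ?thesis using bad1[OF True] True unfolding N_def by auto
  next
    case False
    have "emeasure CM (N a) \<le> ennreal (1/(\<eta>/2)) * (\<integral>\<^sup>+ x. ennreal \<bar>w a x - q a\<bar> * indicator (B1 a) x \<partial>CM)"
      using False \<eta> Nm0 by (intro markov_ball) (auto simp: N_def bad_def)
    also have "\<dots> \<le> ennreal (1/(\<eta>/2)) * (ennreal (CP * (2 * r)) * H a)" by (intro mult_left_mono p2) auto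
    also have "\<dots> = ennreal (1/(\<eta>/2) * (CP * (2 * r))) * H a"
      using \<eta> pos r by (intro ennreal_mult_mult) auto
    also have "\<dots> \<le> ennreal (c2 * r) * H a"
      using \<eta> pos r by (intro mult_right_mono ennreal_leI) (auto simp: c2_def field_simps)
    also have "H a \<le> (\<integral>\<^sup>+ x. k x * indicator (B3 a) x \<partial>CM)"
      unfolding H_def k_def using B12(2)[of a] a
      by (intro nn_integral_mono mult_mono add_right_mono mult_left_mono) (auto simp: indicator_def T_def)
    finally show ?thesis by (simp add: mult_left_mono)
  qed
  have "emeasure CM (\<Union>a\<in>A. N a) \<le> (\<integral>\<^sup>+ a. emeasure CM (N a) \<partial>count_space A)"
    using cA by (intro emeasure_UN_count_space_le) auto
  also have "\<dots> \<le> (\<integral>\<^sup>+ a. ennreal (c2 * r) * (\<integral>\<^sup>+ x. k x * indicator (B3 a) x \<partial>CM) \<partial>count_space A)"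
    using Nk by (intro nn_integral_mono) auto
  also have "\<dots> = ennreal (c2 * r) * (\<integral>\<^sup>+ a. \<integral>\<^sup>+ x. k x * indicator (B3 a) x \<partial>CM \<partial>count_space A)"
    by (rule nn_integral_cmult) simp
  also have "\<dots> \<le> ennreal (c2 * r) * (ennreal D * (\<integral>\<^sup>+ x. k x \<partial>CM))" by (intro mult_left_mono sum3 km) auto
  also have "(\<integral>\<^sup>+ x. k x \<partial>CM) = I T + ennreal \<theta> * ennreal G"
    unfolding k_def I_def G(1)[symmetric] by (subst nn_integral_add) (auto simp: nn_integral_cmult)
  also have "ennreal (c2 * r) * (ennreal D * (I T + ennreal \<theta> * ennreal G))
      \<le> ennreal (c2 * r) * (ennreal D * (ennreal \<epsilon> + ennreal \<theta> * ennreal G))"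
    by (intro mult_left_mono add_right_mono IT) auto
  also have "\<dots> = ennreal (c2 * r * (D * (\<epsilon> + \<theta> * G)))"
    using pos r \<theta> \<epsilon> G by (simp add: ennreal_mult ennreal_plus)
  also have "c2 * r * (D * (\<epsilon> + \<theta> * G)) = (c2 * D * \<epsilon> + c2 * D * (\<theta> * G)) * r" by (simp add: algebra_simps)
  also have "ennreal \<dots> \<le> ennreal (\<delta> * r)"
    using \<epsilon>(2) \<theta>(2) r by (intro ennreal_leI mult_right_mono) auto
  finally have mN: "emeasure CM (\<Union>a\<in>A. N a) \<le> ennreal (\<delta> * r)" .
  have "(\<Union>a\<in>A. N a) \<in> sets CM" using cA by (intro sets.countable_UN'') auto
  then obtain N' where N': "N' \<in> sets M" "(\<Union>a\<in>A. N a) \<subseteq> N'" "emeasure CM (\<Union>a\<in>A. N a) = emeasure M N'"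
    using completion_upper by metis
  show thesis
  proof (rule that[OF r, of N'])
    show "N' \<in> sets borel" using N'(1) by (simp add: sets_M)
    show "emeasure M N' \<le> ennreal (\<delta> * r)" using mN N'(3) by simp
    fix x y assume xy: "x \<notin> N'" "y \<notin> N'" "dist x y < r"
    obtain a where a: "a \<in> A" "dist a x < r" using A(2) by blast
    have "x \<in> B1 a" using a r by (auto simp: B1_def)
    moreover have "y \<in> B1 a" using a xy(3) dist_triangle[of a y x] by (auto simp: B1_def)
    moreover have "x \<notin> N a" "y \<notin> N a" using xy N'(2) a by auto
    ultimately have "w a x \<le> \<eta>" "w a y \<le> \<eta>" by (auto simp: N_def split: if_splits)
    then show "\<bar>f x - f y\<bar> \<le> 4 * \<eta>" by (auto simp: w_def)
  qed
qed

end

section \<open>Capacity and quasicontinuity\<close>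

text \<open>A set that is relatively open off an open \<open>G\<close> becomes open when
  \<open>G\<close> is added; this is how superlevel sets of quasicontinuous functions are enclosed
  in open sets.\<close>

lemma open_superlevel_Un:
  fixes f :: "'a::topological_space \<Rightarrow> real"
  assumes "open G" "continuous_on (- G) f"
  shows "open ({x. f x > c} \<union> G)"
proof -
  obtain W where W: "open W" "W \<inter> (- G) = f -` {c<..} \<inter> (- G)"
    using assms(2) unfolding continuous_on_open_invariant by (metis open_greaterThan)
  then have "{x. f x > c} \<union> G = W \<union> G" by auto
  then show ?thesis using W(1) assms(1) by (metis open_Un)
qed

lemma ug_cmult:
  assumes "ug f g" "0 \<le> c" shows "ug (\<lambda>x. c * f x) (\<lambda>x. ennreal c * g x)"
  unfolding ug_def
proof (intro conjI allI impI)
  show "(\<lambda>x. ennreal c * g x) \<in> borel_measurable borel" using ug_borel[OF assms(1)] by measurable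
  fix \<gamma> :: "real \<Rightarrow> 'a" assume rc: "rectifiable_curve \<gamma>"
  have "ennreal \<bar>c * f (\<gamma> 0) - c * f (\<gamma> 1)\<bar> = ennreal c * ennreal \<bar>f (\<gamma> 0) - f (\<gamma> 1)\<bar>"
    using assms(2) by (simp add: right_diff_distrib[symmetric] abs_mult ennreal_mult)
  also have "\<dots> \<le> ennreal c * line_integral \<gamma> g" by (intro mult_left_mono ugD[OF assms(1) rc]) simp
  also have "\<dots> = line_integral \<gamma> (\<lambda>x. ennreal c * g x)"
    by (simp add: line_integral_cmult[OF rc ug_borel[OF assms(1)]])
  finally show "ennreal \<bar>c * f (\<gamma> 0) - c * f (\<gamma> 1)\<bar> \<le> line_integral \<gamma> (\<lambda>x. ennreal c * g x)" .
qed

lemma ennreal_mult_plus: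
  "0 \<le> a \<Longrightarrow> 0 \<le> b \<Longrightarrow> 0 \<le> c \<Longrightarrow> ennreal a * ennreal b + ennreal (a * c) = ennreal (a * b + a * c)"
  by (simp add: ennreal_mult)

lemma nonconstantI: "\<gamma> 0 \<noteq> \<gamma> 1 \<Longrightarrow> nonconstant_curve \<gamma>"
  unfolding nonconstant_curve_def by (rule bexI[of _ 1]) auto

section \<open>Test functions and subadditivity of the capacity\<close>

context doubling_space
begin

text \<open>An \<open>ug\<close> pair with finite integrals is admissible with an empty exceptional
  family; an infinite right side leaves nothing to prove.\<close>

lemma Cap1_le:
  fixes w :: "'a \<Rightarrow> real"
  assumes w: "w \<in> borel_measurable (completion M)" "\<And>x. 0 \<le> w x" "\<And>x. x \<in> A \<Longrightarrow> 1 \<le> w x" and ug: "ug w g"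
  shows "Cap1 M A \<le> (\<integral>\<^sup>+ x. ennreal (w x) \<partial>M) + (\<integral>\<^sup>+ x. g x \<partial>M)"
proof (cases "(\<integral>\<^sup>+ x. ennreal (w x) \<partial>M) + (\<integral>\<^sup>+ x. g x \<partial>M) < \<infinity>")
  case True
  let ?w = "\<lambda>x. ereal (w x)"
  have abs: "e2ennreal \<bar>?w x\<bar> = ennreal (w x)" for x using w(2)[of x] by (simp add: e2ennreal_ereal)
  have wug: "weak_upper_gradient_in M UNIV ?w g"
    unfolding weak_upper_gradient_in_def
  proof (intro conjI exI[of _ "{}"])
    show "zero_1_modulus M {}" unfolding zero_1_modulus_def by (intro exI[of _ "\<lambda>_. 0"]) auto
  qed (use ug in \<open>auto simp: ug_def ug_ineq_def ediff_def\<close>)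
  have "N11 M UNIV ?w"
    unfolding N11_def using wug True w(1)
    by (auto simp: abs nn_integral_completion ennreal_add_less_top abs_of_nonneg[OF w(2)] intro!: exI[of _ g])
  then have "(?w, g) \<in> {(w, g). N11 M UNIV w \<and> weak_upper_gradient_in M UNIV w g \<and> (\<forall>x\<in>A. w x \<ge> 1)}"
    using wug w(3) by (auto simp: one_ereal_def)
  then have "Cap1 M A \<le> (\<integral>\<^sup>+ x. e2ennreal \<bar>?w x\<bar> \<partial>completion M) + (\<integral>\<^sup>+ x. g x \<partial>completion M)"
    unfolding Cap1_def by (rule INF_lower2) simp
  then show ?thesis by (simp add: abs nn_integral_completion abs_of_nonneg[OF w(2)])
next
  case False
  then have eq: "(\<integral>\<^sup>+ x. ennreal (w x) \<partial>M) + (\<integral>\<^sup>+ x. g x \<partial>M) = top" by (simp add: less_top[symmetric])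
  show ?thesis unfolding eq by simp
qed

text \<open>Normal form of a nearly optimal test function: real valued, cut off to
  \<open>[0,1]\<close>, with exceptional curves absorbed. The strict inequality leaves room for the
  added multiple of \<open>\<rho>\<close>.\<close>

lemma Cap1_less:
  assumes "Cap1 M A < ennreal \<epsilon>"
  obtains w :: "'a \<Rightarrow> real" and g where "w \<in> borel_measurable (completion M)" "\<And>x. 0 \<le> w x" "\<And>x. w x \<le> 1"
    "\<And>x. x \<in> A \<Longrightarrow> w x = 1" "ug w g" "(\<integral>\<^sup>+ x. ennreal (w x) \<partial>M) + (\<integral>\<^sup>+ x. g x \<partial>M) < ennreal \<epsilon>"
proof -
  obtain w0 g0 where N: "N11 M UNIV w0" and wug: "weak_upper_gradient_in M UNIV w0 g0"
    and ge: "\<And>x. x \<in> A \<Longrightarrow> w0 x \<ge> 1"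
    and lt: "(\<integral>\<^sup>+ x. e2ennreal \<bar>w0 x\<bar> \<partial>M) + (\<integral>\<^sup>+ x. g0 x \<partial>M) < ennreal \<epsilon>"
    using assms unfolding Cap1_def INF_less_iff by (auto simp: nn_integral_completion)
  obtain \<Gamma> \<rho> where g0: "g0 \<in> borel_measurable borel" and \<rho>: "\<rho> \<in> borel_measurable borel" "(\<integral>\<^sup>+ x. \<rho> x \<partial>M) < \<infinity>"
    "\<And>\<gamma>. \<gamma> \<in> \<Gamma> \<Longrightarrow> line_integral \<gamma> \<rho> = \<infinity>"
    "\<And>\<gamma>. rectifiable_curve \<gamma> \<Longrightarrow> nonconstant_curve \<gamma> \<Longrightarrow> \<gamma> \<notin> \<Gamma> \<Longrightarrow> ug_ineq w0 g0 \<gamma>"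
    using wug unfolding weak_upper_gradient_in_def zero_1_modulus_def by (auto simp: nn_integral_completion)
  define S where "S = (\<integral>\<^sup>+ x. e2ennreal \<bar>w0 x\<bar> \<partial>M) + (\<integral>\<^sup>+ x. g0 x \<partial>M)"
  obtain s where s: "S = ennreal s" "0 \<le> s" using lt unfolding S_def[symmetric] by (cases S rule: ennreal_cases) auto
  then have "s < \<epsilon>" using lt unfolding S_def[symmetric] by (simp add: ennreal_less_iff)
  obtain R where R: "(\<integral>\<^sup>+ x. \<rho> x \<partial>M) = ennreal R" "0 \<le> R" using \<rho>(2) by (cases "\<integral>\<^sup>+ x. \<rho> x \<partial>M" rule: ennreal_cases) auto
  \<comment> \<open>Then \<open>c * R\<close> is at most half of the slack
    \<open>\<epsilon> - s\<close>; the \<open>+ 1\<close> covers \<open>R = 0\<close>.\<close>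
  define c where "c = (\<epsilon> - s) / (2 * (R + 1))"
  have "c > 0" using \<open>s < \<epsilon>\<close> R unfolding c_def by (intro divide_pos_pos) auto
  have "c * R = (\<epsilon> - s) / 2 * (R / (R + 1))" by (simp add: c_def)
  also have "\<dots> \<le> (\<epsilon> - s) / 2 * 1" using \<open>s < \<epsilon>\<close> R by (intro mult_left_mono) auto
  also have "\<dots> < \<epsilon> - s" using \<open>s < \<epsilon>\<close> by simp
  finally have cR: "s + c * R < \<epsilon>" by simp
  define w where "w x = real_of_ereal (max 0 (min 1 (w0 x)))" for x
  define g where "g x = g0 x + ennreal c * \<rho> x" for x
  have fin: "\<bar>max 0 (min 1 (w0 x))\<bar> \<noteq> \<infinity>" for x by (cases "w0 x") (auto simp: max_def min_def)
  have ew: "ereal (w x) = max 0 (min 1 (w0 x))" for x unfolding w_def using fin[of x] by (simp add: ereal_real)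
  have wM: "w0 \<in> borel_measurable (completion M)" using N by (simp add: N11_def)
  have w01: "0 \<le> w x" "w x \<le> 1" for x
    using ew[of x] by (cases "w0 x"; auto simp: max_def min_def zero_ereal_def one_ereal_def split: if_splits)+
  note [measurable] = borel_measurable_real_of_ereal
  have wm: "w \<in> borel_measurable (completion M)" unfolding w_def using wM by measurable
  have gM: "g0 \<in> borel_measurable M" "\<rho> \<in> borel_measurable M"
    using g0 \<rho> measurable_cong_sets[OF sets_M refl, of borel] by auto
  show thesis
  proof (rule that[OF wm w01])
    show "w x = 1" if "x \<in> A" for x using ge[OF that] ew[of x] by (simp add: min_absorb1 one_ereal_def)
    show "ug w g" unfolding ug_def
    proof (intro conjI allI impI)
      show "g \<in> borel_measurable borel" unfolding g_def using g0 \<rho> by measurable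
      fix \<gamma> :: "real \<Rightarrow> 'a" assume rc: "rectifiable_curve \<gamma>"
      have lg: "line_integral \<gamma> g = line_integral \<gamma> g0 + ennreal c * line_integral \<gamma> \<rho>"
        unfolding g_def using g0 \<rho> by (simp add: line_integral_add[OF rc] line_integral_cmult[OF rc])
      show "ennreal \<bar>w (\<gamma> 0) - w (\<gamma> 1)\<bar> \<le> line_integral \<gamma> g"
      proof (cases "\<gamma> 0 = \<gamma> 1 \<or> \<gamma> \<in> \<Gamma>")
        case True
        then show ?thesis using lg \<rho>(3)[of \<gamma>] \<open>c > 0\<close> by (auto simp: ennreal_mult_top)
      next
        case False
        then have "ediff (w0 (\<gamma> 0)) (w0 (\<gamma> 1)) \<le> line_integral \<gamma> g0"
          using \<rho>(4)[OF rc nonconstantI] by (auto simp: ug_ineq_def)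
        \<comment> \<open>Cutting off to \<open>[0,1]\<close> is a contraction, and with an infinite
          end value the right side is infinite.\<close>
        moreover have "ennreal \<bar>w (\<gamma> 0) - w (\<gamma> 1)\<bar> \<le> ediff (w0 (\<gamma> 0)) (w0 (\<gamma> 1))"
        proof (cases "\<bar>w0 (\<gamma> 0)\<bar> \<noteq> \<infinity> \<and> \<bar>w0 (\<gamma> 1)\<bar> \<noteq> \<infinity>")
          case True
          then obtain a b where ab: "w0 (\<gamma> 0) = ereal a" "w0 (\<gamma> 1) = ereal b" by (auto simp: ereal_infinity_cases)
          then have "w (\<gamma> 0) = max 0 (min 1 a)" "w (\<gamma> 1) = max 0 (min 1 b)"
            unfolding w_def by (auto simp: max_def min_def zero_ereal_def one_ereal_def)
          moreover have "\<bar>max 0 (min 1 a) - max 0 (min 1 b)\<bar> \<le> \<bar>a - b\<bar>" by linarith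
          ultimately show ?thesis using ab by (auto simp: ediff_def intro!: ennreal_leI)
        next
          case False
          then show ?thesis unfolding ediff_def by (simp only: False if_False) simp
        qed
        ultimately have "ennreal \<bar>w (\<gamma> 0) - w (\<gamma> 1)\<bar> \<le> line_integral \<gamma> g0" by (rule order_trans[rotated])
        then show ?thesis unfolding lg by (rule order_trans) simp
      qed
    qed
    have "(\<integral>\<^sup>+ x. ennreal (w x) \<partial>M) \<le> (\<integral>\<^sup>+ x. e2ennreal \<bar>w0 x\<bar> \<partial>M)"
    proof (rule nn_integral_mono)
      fix x
      have "ereal (w x) \<le> \<bar>w0 x\<bar>" unfolding ew by (cases "w0 x") (auto simp: max_def min_def zero_ereal_def one_ereal_def)
      then have "e2ennreal (ereal (w x)) \<le> e2ennreal \<bar>w0 x\<bar>" by (rule e2ennreal_mono)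
      then show "ennreal (w x) \<le> e2ennreal \<bar>w0 x\<bar>" by (simp add: e2ennreal_ereal)
    qed
    moreover have "(\<integral>\<^sup>+ x. g x \<partial>M) = (\<integral>\<^sup>+ x. g0 x \<partial>M) + ennreal (c * R)"
      unfolding g_def using gM \<open>c > 0\<close> R by (simp add: nn_integral_add nn_integral_cmult ennreal_mult)
    ultimately have "(\<integral>\<^sup>+ x. ennreal (w x) \<partial>M) + (\<integral>\<^sup>+ x. g x \<partial>M) \<le> S + ennreal (c * R)"
      unfolding S_def by (simp add: add.assoc[symmetric] add_right_mono)
    also have "\<dots> = ennreal (s + c * R)" using s R \<open>c > 0\<close> by simp
    also have "\<dots> < ennreal \<epsilon>" using cR s R \<open>c > 0\<close> by (intro ennreal_lessI) (auto intro: le_less_trans[rotated])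
    finally show "(\<integral>\<^sup>+ x. ennreal (w x) \<partial>M) + (\<integral>\<^sup>+ x. g x \<partial>M) < ennreal \<epsilon>" .
  qed
qed

lemma Cap1_Un_less:
  assumes "Cap1 M A < ennreal a" "Cap1 M B < ennreal b"
  shows "Cap1 M (A \<union> B) < ennreal (a + b)"
proof -
  obtain v g where v: "v \<in> borel_measurable (completion M)" "\<And>x. 0 \<le> v x" "\<And>x. v x \<le> 1"
    "\<And>x. x \<in> A \<Longrightarrow> v x = 1" "ug v g" "(\<integral>\<^sup>+ x. ennreal (v x) \<partial>M) + (\<integral>\<^sup>+ x. g x \<partial>M) < ennreal a"
    using Cap1_less[OF assms(1)] by blast
  obtain w k where w: "w \<in> borel_measurable (completion M)" "\<And>x. 0 \<le> w x" "\<And>x. w x \<le> 1"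
    "\<And>x. x \<in> B \<Longrightarrow> w x = 1" "ug w k" "(\<integral>\<^sup>+ x. ennreal (w x) \<partial>M) + (\<integral>\<^sup>+ x. k x \<partial>M) < ennreal b"
    using Cap1_less[OF assms(2)] by blast
  note [measurable] = v(1) w(1) ug_borel[OF v(5)] ug_borel[OF w(5)]
  have [measurable]: "g \<in> borel_measurable M" "k \<in> borel_measurable M"
    using ug_borel[OF v(5)] ug_borel[OF w(5)] measurable_cong_sets[OF sets_M refl, of borel] by auto
  have "ug (\<lambda>x. max (v x) (w x)) (\<lambda>x. g x + k x)" unfolding ug_def
  proof (intro conjI allI impI)
    fix \<gamma> :: "real \<Rightarrow> 'a" assume rc: "rectifiable_curve \<gamma>"
    have "ennreal \<bar>max (v (\<gamma> 0)) (w (\<gamma> 0)) - max (v (\<gamma> 1)) (w (\<gamma> 1))\<bar>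
        \<le> ennreal (\<bar>v (\<gamma> 0) - v (\<gamma> 1)\<bar> + \<bar>w (\<gamma> 0) - w (\<gamma> 1)\<bar>)" by (intro ennreal_leI) linarith
    also have "\<dots> = ennreal \<bar>v (\<gamma> 0) - v (\<gamma> 1)\<bar> + ennreal \<bar>w (\<gamma> 0) - w (\<gamma> 1)\<bar>" by simp
    also have "\<dots> \<le> line_integral \<gamma> g + line_integral \<gamma> k" by (intro add_mono ugD rc v w)
    finally show "ennreal \<bar>max (v (\<gamma> 0)) (w (\<gamma> 0)) - max (v (\<gamma> 1)) (w (\<gamma> 1))\<bar> \<le> line_integral \<gamma> (\<lambda>x. g x + k x)"
      by (simp add: line_integral_add[OF rc ug_borel[OF v(5)] ug_borel[OF w(5)]])
  qed measurable
  then have "Cap1 M (A \<union> B) \<le> (\<integral>\<^sup>+ x. ennreal (max (v x) (w x)) \<partial>M) + (\<integral>\<^sup>+ x. g x + k x \<partial>M)"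
    using v w by (intro Cap1_le) (auto simp: le_max_iff_disj)
  also have "(\<integral>\<^sup>+ x. ennreal (max (v x) (w x)) \<partial>M) \<le> (\<integral>\<^sup>+ x. ennreal (v x) + ennreal (w x) \<partial>completion M)"
    unfolding nn_integral_completion[symmetric, of M "\<lambda>x. ennreal (max (v x) (w x))"]
    using v(2) w(2) by (intro nn_integral_mono) (auto simp: ennreal_plus[symmetric] max_def simp del: ennreal_plus intro!: ennreal_leI)
  also have "\<dots> = (\<integral>\<^sup>+ x. ennreal (v x) \<partial>M) + (\<integral>\<^sup>+ x. ennreal (w x) \<partial>M)"
    by (subst nn_integral_add) (auto simp: nn_integral_completion)
  also have "(\<integral>\<^sup>+ x. g x + k x \<partial>M) = (\<integral>\<^sup>+ x. g x \<partial>M) + (\<integral>\<^sup>+ x. k x \<partial>M)" by (rule nn_integral_add) measurable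
  finally have "Cap1 M (A \<union> B) \<le> ((\<integral>\<^sup>+ x. ennreal (v x) \<partial>M) + (\<integral>\<^sup>+ x. g x \<partial>M)) + ((\<integral>\<^sup>+ x. ennreal (w x) \<partial>M) + (\<integral>\<^sup>+ x. k x \<partial>M))"
    by (simp add: ac_simps add_right_mono)
  also have "\<dots> < ennreal a + ennreal b" using v(6) w(6) by (rule add_strict_mono)
  also have "\<dots> = ennreal (a + b)"
  proof (rule ennreal_plus[symmetric])
    show "0 \<le> a" using v(6) by (cases "0 \<le> a") (auto simp: ennreal_neg)
    show "0 \<le> b" using w(6) by (cases "0 \<le> b") (auto simp: ennreal_neg)
  qed
  finally show ?thesis .
qed

text \<open>Along a curve each test function changes by at most the integral of the sum of all
  gradients, hence so does their supremum; the common bound 1 keeps it finite.\<close>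

lemma Cap1_UN_le:
  assumes "\<And>n::nat. Cap1 M (A n) < ennreal (e * (1/2)^Suc n)" "e > 0"
  shows "Cap1 M (\<Union>n. A n) \<le> ennreal e"
proof -
  have "\<exists>(w :: 'a \<Rightarrow> real) g. w \<in> borel_measurable (completion M) \<and> (\<forall>x. 0 \<le> w x) \<and> (\<forall>x. w x \<le> 1) \<and>
    (\<forall>x\<in>A n. w x = 1) \<and> ug w g \<and> (\<integral>\<^sup>+ x. ennreal (w x) \<partial>M) + (\<integral>\<^sup>+ x. g x \<partial>M) < ennreal (e * (1/2)^Suc n)" for n
    using Cap1_less[OF assms(1)[of n]] by metis
  then obtain w :: "nat \<Rightarrow> 'a \<Rightarrow> real" and g where wg: "\<And>n. w n \<in> borel_measurable (completion M)" "\<And>n x. 0 \<le> w n x" "\<And>n x. w n x \<le> 1"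
    "\<And>n x. x \<in> A n \<Longrightarrow> w n x = 1" "\<And>n. ug (w n) (g n)"
    "\<And>n. (\<integral>\<^sup>+ x. ennreal (w n x) \<partial>M) + (\<integral>\<^sup>+ x. g n x \<partial>M) < ennreal (e * (1/2)^Suc n)" by metis
  note [measurable] = wg(1) ug_borel[OF wg(5)]
  have [measurable]: "g n \<in> borel_measurable M" for n
    using ug_borel[OF wg(5)[of n]] measurable_cong_sets[OF sets_M refl, of borel] by auto
  define W where "W x = (SUP n. w n x)" for x
  have bdd: "bdd_above (range (\<lambda>n. w n x))" for x using wg(3) by (intro bdd_aboveI[of _ 1]) auto
  have wW: "w n x \<le> W x" for n x unfolding W_def by (intro cSUP_upper bdd) simp
  have W0: "0 \<le> W x" for x using wg(2)[of 0 x] wW[of 0 x] by linarith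
  have Wm: "W \<in> borel_measurable (completion M)" unfolding W_def
    using bdd by (intro borel_measurable_cSUP) auto
  have "ug W (\<lambda>x. \<Sum>n. g n x)" unfolding ug_def
  proof (intro conjI allI impI)
    fix \<gamma> :: "real \<Rightarrow> 'a" assume rc: "rectifiable_curve \<gamma>"
    show "ennreal \<bar>W (\<gamma> 0) - W (\<gamma> 1)\<bar> \<le> line_integral \<gamma> (\<lambda>x. \<Sum>n. g n x)"
    proof (cases "line_integral \<gamma> (\<lambda>x. \<Sum>n. g n x)" rule: ennreal_cases)
      case (real I)
      have d: "\<bar>w n (\<gamma> 0) - w n (\<gamma> 1)\<bar> \<le> I" for n
      proof -
        have "line_integral \<gamma> (g n) \<le> line_integral \<gamma> (\<lambda>x. \<Sum>n. g n x)"
        proof (rule line_integral_mono')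
          fix x show "g n x \<le> (\<Sum>n. g n x)" using sum_le_suminf[of "\<lambda>n. g n x" "{n}"] by simp
        qed
        then have "ennreal \<bar>w n (\<gamma> 0) - w n (\<gamma> 1)\<bar> \<le> ennreal I" using ugD[OF wg(5) rc, of n] real by (metis order_trans)
        then show ?thesis using real by simp
      qed
      have a: "w n (\<gamma> 0) \<le> I + W (\<gamma> 1)" for n using d[of n] wW[of n "\<gamma> 1"] by linarith
      have b: "w n (\<gamma> 1) \<le> I + W (\<gamma> 0)" for n using d[of n] wW[of n "\<gamma> 0"] by linarith
      have "W (\<gamma> 0) \<le> I + W (\<gamma> 1)" using cSUP_least[OF _ a, of UNIV] by (simp add: W_def)
      moreover have "W (\<gamma> 1) \<le> I + W (\<gamma> 0)" using cSUP_least[OF _ b, of UNIV] by (simp add: W_def)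
      ultimately show ?thesis using real by (auto intro!: ennreal_leI)
    qed simp
  qed measurable
  then have "Cap1 M (\<Union>n. A n) \<le> (\<integral>\<^sup>+ x. ennreal (W x) \<partial>M) + (\<integral>\<^sup>+ x. (\<Sum>n. g n x) \<partial>M)"
  proof (intro Cap1_le Wm W0)
    fix x assume "x \<in> (\<Union>n. A n)"
    then obtain n where "x \<in> A n" by auto
    then show "1 \<le> W x" using wg(4)[of x n] wW[of n x] by simp
  qed
  also have "(\<integral>\<^sup>+ x. (\<Sum>n. g n x) \<partial>M) = (\<Sum>n. \<integral>\<^sup>+ x. g n x \<partial>M)" by (rule nn_integral_suminf) measurable
  also have "(\<integral>\<^sup>+ x. ennreal (W x) \<partial>M) \<le> (\<integral>\<^sup>+ x. (\<Sum>n. ennreal (w n x)) \<partial>completion M)"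
    unfolding nn_integral_completion[symmetric, of M "\<lambda>x. ennreal (W x)"]
  proof (rule nn_integral_mono)
    fix x show "ennreal (W x) \<le> (\<Sum>n. ennreal (w n x))"
    proof (cases "\<Sum>n. ennreal (w n x)" rule: ennreal_cases)
      case (real I)
      have "w n x \<le> I" for n
      proof -
        have "ennreal (w n x) \<le> ennreal I" using sum_le_suminf[of "\<lambda>n. ennreal (w n x)" "{n}"] real by simp
        then show ?thesis using real by simp
      qed
      then have "W x \<le> I" unfolding W_def by (intro cSUP_least) auto
      then show ?thesis using real by (simp add: ennreal_leI)
    qed simp
  qed
  also have "\<dots> = (\<Sum>n. \<integral>\<^sup>+ x. ennreal (w n x) \<partial>M)"
    by (subst nn_integral_suminf) (auto simp: nn_integral_completion)
  finally have "Cap1 M (\<Union>n. A n) \<le> (\<Sum>n. \<integral>\<^sup>+ x. ennreal (w n x) \<partial>M) + (\<Sum>n. \<integral>\<^sup>+ x. g n x \<partial>M)" by (simp add: add_right_mono)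
  also have "\<dots> = (\<Sum>n. (\<integral>\<^sup>+ x. ennreal (w n x) \<partial>M) + (\<integral>\<^sup>+ x. g n x \<partial>M))" by (intro suminf_add) auto
  also have "\<dots> \<le> (\<Sum>n. ennreal (e * (1/2)^Suc n))" using wg(6) by (intro suminf_le) (auto intro: less_imp_le)
  also have "\<dots> = ennreal e"
    using sums_mult[OF power_half_series, of e] assms(2) by (intro suminf_ennreal_eq) auto
  finally show ?thesis .
qed

lemma Cap1_UN_less:
  assumes "\<And>n::nat. Cap1 M (A n) < ennreal (e/2 * (1/2)^Suc n)" "e > 0"
  shows "Cap1 M (\<Union>n. A n) < ennreal e"
proof -
  have "Cap1 M (\<Union>n. A n) \<le> ennreal (e/2)" using Cap1_UN_le[OF assms(1)] assms(2) by simp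
  also have "\<dots> < ennreal e" using assms(2) by (intro ennreal_lessI) auto
  finally show ?thesis .
qed

lemma emeasure_le_Cap1:
  assumes "open G" "Cap1 M G < ennreal e" shows "emeasure M G \<le> ennreal e"
proof -
  obtain w g where w: "w \<in> borel_measurable (completion M)" "\<And>x. 0 \<le> w x" "\<And>x. w x \<le> 1"
    "\<And>x. x \<in> G \<Longrightarrow> w x = 1" "ug w g" "(\<integral>\<^sup>+ x. ennreal (w x) \<partial>M) + (\<integral>\<^sup>+ x. g x \<partial>M) < ennreal e"
    using Cap1_less[OF assms(2)] by blast
  have "emeasure M G = (\<integral>\<^sup>+ x. indicator G x \<partial>M)" using assms(1) by (simp add: sets_M)
  also have "\<dots> \<le> (\<integral>\<^sup>+ x. ennreal (w x) \<partial>M)" using w(4) by (intro nn_integral_mono) (auto simp: indicator_def)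
  also have "\<dots> \<le> ennreal e" by (rule order_trans[OF _ less_imp_le[OF w(6)]]) simp
  finally show ?thesis .
qed

end

section \<open>Quasicontinuity of bounded functions on the whole space\<close>

context poincare_space
begin

text \<open>Off the superlevel set of the potential of the bad set, every point is joined to the
  good set by a short curve along which \<open>f\<close> varies little.\<close>

lemma Cap1_small_oscillation:
  assumes f: "f \<in> borel_measurable CM" and K: "\<And>x. \<bar>f x\<bar> \<le> K"
    and ug: "ug f g" and fin: "(\<integral>\<^sup>+ x. g x \<partial>M) < \<infinity>" and s: "s > 0" "2 * s \<le> 1" and \<epsilon>: "\<epsilon> > 0"
  obtains G r where "open G" "Cap1 M G < ennreal \<epsilon>" "r > 0"
    "\<forall>x y. x \<notin> G \<longrightarrow> y \<notin> G \<longrightarrow> dist x y < r \<longrightarrow> \<bar>f x - f y\<bar> \<le> 8 * s"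
proof -
  obtain L :: "nat \<Rightarrow> 'a \<Rightarrow> real" and e where L: "\<And>m. continuous_on UNIV (L m)" "\<And>m x. 0 \<le> L m x"
    "\<And>m n x. m \<le> n \<Longrightarrow> L m x \<le> L n x" "\<And>x. g x \<le> (SUP m. ennreal (L m x))"
    "\<And>x. (SUP m. ennreal (L m x)) \<le> 1 + e x" "e \<in> borel_measurable borel" "(\<integral>\<^sup>+ x. e x \<partial>M) < \<infinity>"
    using lsc_majorant[OF ug_borel[OF ug] fin] by blast
  have eM[measurable]: "e \<in> borel_measurable M" using L(6) measurable_cong_sets[OF sets_M refl, of borel] by auto
  obtain R where R: "(\<integral>\<^sup>+ x. e x \<partial>M) = ennreal R" "0 \<le> R" using L(7) by (cases "\<integral>\<^sup>+ x. e x \<partial>M" rule: ennreal_cases) auto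
  \<comment> \<open>\<open>\<epsilon>1\<close> and \<open>\<delta>\<close> are read off from the
    final bound, \<open>1/s\<close> times
    \<open>4 * (\<delta> * r) + 16 * s * \<delta> + 2 * \<epsilon>1\<close>: the first two terms are
    at most \<open>12 * \<delta>\<close>, and the last is \<open>\<epsilon> * s / 4\<close>.\<close>
  define \<epsilon>1 where "\<epsilon>1 = \<epsilon> * s / 8"
  have \<epsilon>1: "\<epsilon>1 > 0" using s \<epsilon> by (simp add: \<epsilon>1_def)
  obtain \<delta>e where \<delta>e: "\<delta>e > 0"
    "\<And>A. A \<in> sets M \<Longrightarrow> emeasure M A \<le> ennreal \<delta>e \<Longrightarrow> (\<integral>\<^sup>+ x. e x * indicator A x \<partial>M) \<le> ennreal \<epsilon>1"
    using nn_integral_abs_cont[OF eM L(7) \<epsilon>1] by blast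
  define \<delta> where "\<delta> = min (min 1 (\<delta>e / 2)) (\<epsilon> * s / 64)"
  have \<delta>: "\<delta> > 0" "\<delta> \<le> 1" "2 * \<delta> \<le> \<delta>e" "\<delta> \<le> \<epsilon> * s / 64" using \<delta>e s \<epsilon> by (auto simp: \<delta>_def min_def)
  obtain r N where r: "0 < r" "r \<le> \<delta>" and N: "N \<in> sets borel" "emeasure M N \<le> ennreal (\<delta> * r)"
    and osc: "\<And>x y. x \<notin> N \<Longrightarrow> y \<notin> N \<Longrightarrow> dist x y < r \<Longrightarrow> \<bar>f x - f y\<bar> \<le> 4 * s"
    using small_oscillation[OF f K ug fin s(1) \<delta>(1)] by blast
  have \<delta>r: "\<delta> * r > 0" "\<delta> * r \<le> \<delta>" using \<delta> r by (auto intro: mult_left_le)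
  obtain V where V: "open V" "N \<subseteq> V" "emeasure M (V - N) \<le> ennreal (\<delta> * r)"
    using outer_regular[OF N(1) \<delta>r(1)] by blast
  have Vm[measurable]: "V \<in> sets M" using V by (simp add: sets_M)
  have "emeasure M V = emeasure M N + emeasure M (V - N)"
    using V N by (subst plus_emeasure) (auto simp: sets_M Un_absorb1)
  also have "\<dots> \<le> ennreal (\<delta> * r) + ennreal (\<delta> * r)" by (intro add_mono N V)
  also have "\<dots> = ennreal (2 * \<delta> * r)" using \<delta>r by (simp add: ennreal_plus[symmetric] del: ennreal_plus)
  finally have mV: "emeasure M V \<le> ennreal (2 * \<delta> * r)" .
  have "2 * \<delta> * r \<le> \<delta>e" unfolding mult.assoc using \<delta>r(2) \<delta>(3) by linarith
  then have eV: "(\<integral>\<^sup>+ x. e x * indicator V x \<partial>M) \<le> ennreal \<epsilon>1"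
    using mV by (intro \<delta>e(2)) (auto intro: order_trans ennreal_leI)
  \<comment> \<open>A curve along which \<open>k\<close> has integral below \<open>2 * s\<close> is
    then shorter than \<open>r/4\<close>. The price is \<open>l\<close> times the measure of
    \<open>V\<close>, at most \<open>16 * s * \<delta>\<close> since that measure is at most
    \<open>2 * \<delta> * r\<close>.\<close>
  define l where "l = 8 * s / r"
  have l: "l > 0" "l * r = 8 * s" using s r by (auto simp: l_def)
  define J where "J m x = l + L m x" for m x
  define k where "k x = (SUP m. ennreal (J m x))" for x
  have J: "continuous_on UNIV (J m)" "l \<le> J m x" "m \<le> n \<Longrightarrow> J m x \<le> J n x" for m n x
    unfolding J_def using L by (auto intro!: continuous_intros)
  have kJ: "k x = ennreal l + (SUP m. ennreal (L m x))" for x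
  proof -
    have "k x = (SUP m. ennreal l + ennreal (L m x))" unfolding k_def J_def using l L(2) by simp
    then show ?thesis by (simp add: ennreal_SUP_add_right)
  qed
  have "closed (- V)" using V by auto
  obtain h :: "'a \<Rightarrow> real" where h: "\<And>x. 0 \<le> h x" "\<And>x. h x \<le> 1" "\<And>x. x \<in> - V \<Longrightarrow> h x = 0"
    "\<And>s. 0 \<le> s \<Longrightarrow> open {x. h x > s}" "h \<in> borel_measurable borel" "ug h k"
    "\<And>x s. h x < s \<Longrightarrow> s \<le> 1 \<Longrightarrow> \<exists>\<gamma>. rectifiable_curve \<gamma> \<and> \<gamma> 0 = x \<and> \<gamma> 1 \<in> - V \<and> line_integral \<gamma> k < ennreal s"
    using potential[of J l "- V", OF J l(1) \<open>closed (- V)\<close>] unfolding k_def[abs_def, symmetric] by blast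
  have kb: "k \<in> borel_measurable borel" using h(6) by (rule ug_borel)
  have k_le: "k x \<le> ennreal (l + 1) + e x" for x
    unfolding kJ using L(5)[of x] l by (simp add: add.assoc add_left_mono)
  define \<theta> where "\<theta> = \<epsilon>1 / (R + 1)"
  have \<theta>: "\<theta> > 0" "\<theta> * R \<le> \<epsilon>1"
  proof -
    show "\<theta> > 0" using \<epsilon>1 R by (simp add: \<theta>_def)
    have "\<theta> * R = \<epsilon>1 * (R / (R + 1))" by (simp add: \<theta>_def)
    also have "\<dots> \<le> \<epsilon>1 * 1" using \<epsilon>1 R by (intro mult_left_mono) auto
    finally show "\<theta> * R \<le> \<epsilon>1" by simp
  qed
  \<comment> \<open>\<open>h\<close> vanishes off \<open>V\<close>, so its gradient is cut down to
    \<open>V\<close>. The constant in \<open>k\<close> may fail to be integrable over the space, so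
    the correction term uses \<open>e\<close>; along a curve the constant adds only a multiple of
    the length.\<close>
  have ugh: "ug h (\<lambda>x. k x * indicator V x + ennreal \<theta> * e x)"
  proof (rule ug_glue[OF kb L(6) \<theta>(1)])
    show "\<bar>h x\<bar> \<le> h x" for x using h(1)[of x] by simp
    show "continuous_on {0..1} (h \<circ> \<gamma>)" if rc: "rectifiable_curve \<gamma>" and le: "line_integral \<gamma> e < \<infinity>" for \<gamma>
    proof (rule ug_continuous[OF h(6) rc])
      have "line_integral \<gamma> k \<le> line_integral \<gamma> (\<lambda>x. ennreal (l + 1) + e x)" by (rule line_integral_mono') (rule k_le)
      also have "\<dots> = line_integral \<gamma> (\<lambda>x. ennreal (l + 1)) + line_integral \<gamma> e"
        by (intro line_integral_add rc L(6)) simp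
      also have "line_integral \<gamma> (\<lambda>x. ennreal (l + 1)) \<le> ennreal ((l + 1) * plen \<gamma> 0 1)"
        unfolding line_integral_seg using l by (intro seg_upper rc) auto
      finally have "line_integral \<gamma> k \<le> ennreal ((l + 1) * plen \<gamma> 0 1) + line_integral \<gamma> e" by (simp add: add_right_mono)
      also have "\<dots> < \<infinity>" using le by (simp add: ennreal_add_less_top)
      finally show "line_integral \<gamma> k < \<infinity>" .
    qed
    show "V \<in> sets borel" using V by simp
    show "x \<in> V" if "h x > 0" for x using h(3)[of x] that by force
  qed (use ugD[OF h(6)] in auto)
  define G where "G = {x. h x > s}"
  show thesis
  proof (rule that[of G "r/4"])
    show "open G" unfolding G_def using s by (intro h) simp
    have nn: "0 \<le> 1/s" "0 \<le> l + 1" "0 \<le> 2 * \<delta> * r" "0 \<le> \<epsilon>1" "0 \<le> (l + 1) * (2 * \<delta> * r)"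
      "0 \<le> (l + 1) * (2 * \<delta> * r) + \<epsilon>1" "0 \<le> (l + 1) * (2 * \<delta> * r) + \<epsilon>1 + \<epsilon>1"
      using s l \<delta> r \<epsilon>1 by auto
    have "Cap1 M G \<le> (\<integral>\<^sup>+ x. ennreal (1/s * h x) \<partial>M) + (\<integral>\<^sup>+ x. ennreal (1/s) * (k x * indicator V x + ennreal \<theta> * e x) \<partial>M)"
    proof (rule Cap1_le)
      show "(\<lambda>x. 1/s * h x) \<in> borel_measurable CM" using borel_CM h(5)
        by (intro borel_measurable_times) (auto intro!: measurable_completion simp: measurable_cong_sets[OF sets_M refl])
      show "0 \<le> 1/s * h x" for x using h(1) s by simp
      show "1 \<le> 1/s * h x" if "x \<in> G" for x using that s by (simp add: G_def field_simps)
      show "ug (\<lambda>x. 1/s * h x) (\<lambda>x. ennreal (1/s) * (k x * indicator V x + ennreal \<theta> * e x))"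
        using s by (intro ug_cmult ugh) auto
    qed
    also have "(\<integral>\<^sup>+ x. ennreal (1/s * h x) \<partial>M) \<le> (\<integral>\<^sup>+ x. ennreal (1/s) * indicator V x \<partial>M)"
    proof (rule nn_integral_mono)
      fix x show "ennreal (1/s * h x) \<le> ennreal (1/s) * indicator V x"
        using h(2,3)[of x] s by (cases "x \<in> V") (auto intro!: ennreal_leI divide_right_mono)
    qed
    also have "\<dots> = ennreal (1/s) * emeasure M V" by (simp add: nn_integral_cmult_indicator)
    also have "\<dots> \<le> ennreal (1/s) * ennreal (2 * \<delta> * r)" by (intro mult_left_mono mV) simp
    also have "(\<integral>\<^sup>+ x. ennreal (1/s) * (k x * indicator V x + ennreal \<theta> * e x) \<partial>M)
        \<le> (\<integral>\<^sup>+ x. ennreal (1/s) * ((ennreal (l + 1) * indicator V x + e x * indicator V x) + ennreal \<theta> * e x) \<partial>M)"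
      using k_le by (intro nn_integral_mono mult_left_mono add_right_mono) (auto simp: indicator_def)
    also have "\<dots> = ennreal (1/s) * ((ennreal (l + 1) * emeasure M V + (\<integral>\<^sup>+ x. e x * indicator V x \<partial>M)) + ennreal \<theta> * ennreal R)"
      unfolding R(1)[symmetric]
      by (simp add: nn_integral_cmult nn_integral_add nn_integral_cmult_indicator)
    also have "\<dots> \<le> ennreal (1/s) * ((ennreal (l + 1) * ennreal (2 * \<delta> * r) + ennreal \<epsilon>1) + ennreal \<epsilon>1)"
      using \<theta> R by (intro mult_left_mono add_mono mV eV) (auto simp: ennreal_mult[symmetric] intro!: ennreal_leI)
    also have "\<dots> = ennreal (1/s * ((l + 1) * (2 * \<delta> * r) + \<epsilon>1 + \<epsilon>1))"
      using nn by (simp only: ennreal_mult ennreal_plus)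
    finally have "Cap1 M G \<le> ennreal (1/s) * ennreal (2 * \<delta> * r) + ennreal (1/s * ((l + 1) * (2 * \<delta> * r) + \<epsilon>1 + \<epsilon>1))"
      by (simp add: add_mono)
    also have "\<dots> = ennreal (1/s * (2 * \<delta> * r) + 1/s * ((l + 1) * (2 * \<delta> * r) + \<epsilon>1 + \<epsilon>1))"
      using nn by (intro ennreal_mult_plus) auto
    also have "1/s * (2 * \<delta> * r) + 1/s * ((l + 1) * (2 * \<delta> * r) + \<epsilon>1 + \<epsilon>1) = 1/s * (4 * (\<delta> * r) + 16 * s * \<delta> + 2 * \<epsilon>1)"
    proof -
      have "(l + 1) * (2 * \<delta> * r) = 2 * \<delta> * (l * r) + 2 * \<delta> * r" by (simp add: algebra_simps)
      then have "2 * \<delta> * r + ((l + 1) * (2 * \<delta> * r) + \<epsilon>1 + \<epsilon>1) = 4 * (\<delta> * r) + 16 * s * \<delta> + 2 * \<epsilon>1"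
        unfolding l(2) by simp
      then show ?thesis by (simp only: distrib_left[symmetric])
    qed
    finally have cap: "Cap1 M G \<le> ennreal (1/s * (4 * (\<delta> * r) + 16 * s * \<delta> + 2 * \<epsilon>1))" .
    have "1/s * (4 * (\<delta> * r) + 16 * s * \<delta> + 2 * \<epsilon>1) < \<epsilon>"
    proof -
      have "16 * s * \<delta> \<le> 8 * \<delta>" using s \<delta> mult_right_mono[of "2 * s" 1 "8 * \<delta>"] by simp
      then have "4 * (\<delta> * r) + 16 * s * \<delta> + 2 * \<epsilon>1 \<le> 12 * \<delta> + \<epsilon> * s / 4" using \<delta>r unfolding \<epsilon>1_def by linarith
      also have "\<dots> < \<epsilon> * s" using \<delta>(4) mult_pos_pos[OF \<epsilon> s(1)] by linarith
      finally show ?thesis using s by (simp add: field_simps)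
    qed
    then have "ennreal (1/s * (4 * (\<delta> * r) + 16 * s * \<delta> + 2 * \<epsilon>1)) < ennreal \<epsilon>"
      using \<epsilon> by (intro ennreal_lessI)
    with cap show "Cap1 M G < ennreal \<epsilon>" by (rule le_less_trans)
    show "r/4 > 0" using r by simp
    show "\<forall>x y. x \<notin> G \<longrightarrow> y \<notin> G \<longrightarrow> dist x y < r/4 \<longrightarrow> \<bar>f x - f y\<bar> \<le> 8 * s"
    proof (intro allI impI)
      fix x y assume xy: "x \<notin> G" "y \<notin> G" "dist x y < r/4"
      have near: "\<exists>x'. x' \<notin> N \<and> dist x x' < r/4 \<and> \<bar>f x - f x'\<bar> \<le> 2 * s" if "x \<notin> G" for x
      proof -
        have "h x < 2 * s" using that s by (simp add: G_def)
        then obtain \<gamma> where \<gamma>: "rectifiable_curve \<gamma>" "\<gamma> 0 = x" "\<gamma> 1 \<in> - V" "line_integral \<gamma> k < ennreal (2 * s)"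
          using h(7)[of x "2 * s"] s by auto
        have "ennreal (l * plen \<gamma> 0 1) \<le> line_integral \<gamma> k"
          using l by (intro line_integral_lower \<gamma>) (auto simp: kJ)
        then have "ennreal (l * plen \<gamma> 0 1) < ennreal (2 * s)" using \<gamma>(4) by (rule le_less_trans)
        then have "l * plen \<gamma> 0 1 < 2 * s" using l plen_nonneg[OF \<gamma>(1), of 0 1] by (subst (asm) ennreal_less_iff) auto
        then have "plen \<gamma> 0 1 < r/4" using r s by (simp add: l_def field_simps)
        then have "dist x (\<gamma> 1) < r/4" using plen_ge_dist[OF \<gamma>(1), of 0 1] \<gamma>(2) by auto
        moreover have "\<bar>f x - f (\<gamma> 1)\<bar> \<le> 2 * s"
        proof -
          have "ennreal \<bar>f x - f (\<gamma> 1)\<bar> \<le> line_integral \<gamma> g" using ugD[OF ug \<gamma>(1)] \<gamma>(2) by simp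
          also have "\<dots> \<le> line_integral \<gamma> k"
            using L(4) by (intro line_integral_mono') (auto simp: kJ intro: add_increasing)
          also have "\<dots> \<le> ennreal (2 * s)" using \<gamma>(4) by (rule less_imp_le)
          finally show ?thesis using s by simp
        qed
        ultimately show ?thesis using \<gamma>(3) V(2) by blast
      qed
      obtain x' where x': "x' \<notin> N" "dist x x' < r/4" "\<bar>f x - f x'\<bar> \<le> 2 * s" using near[OF xy(1)] by blast
      obtain y' where y': "y' \<notin> N" "dist y y' < r/4" "\<bar>f y - f y'\<bar> \<le> 2 * s" using near[OF xy(2)] by blast
      \<comment> \<open>Three distances below \<open>r/4\<close>; the corresponding oscillations
        \<open>2 * s\<close>, \<open>4 * s\<close> and \<open>2 * s\<close> add up to
        \<open>8 * s\<close>.\<close>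
      have "dist x' y' < r"
        using xy(3) x'(2) y'(2) dist_triangle[of x' y' x] dist_triangle[of x y' y] r(1) by (simp add: dist_commute)
      then have "\<bar>f x' - f y'\<bar> \<le> 4 * s" by (intro osc x' y')
      then show "\<bar>f x - f y\<bar> \<le> 8 * s" using x'(3) y'(3) by linarith
    qed
  qed
qed

text \<open>With \<open>s = 1 / (2 * Suc n)\<close> the oscillation bound is
  \<open>4 / Suc n\<close>, valid off an open set whose capacity is a geometric share of
  \<open>\<epsilon>\<close>. Off the union all these bounds hold at once.\<close>

lemma quasicontinuous_bounded:
  assumes f: "f \<in> borel_measurable CM" and K: "\<And>x. \<bar>f x\<bar> \<le> K"
    and ug: "ug f g" and fin: "(\<integral>\<^sup>+ x. g x \<partial>M) < \<infinity>" and \<epsilon>: "\<epsilon> > 0"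
  obtains G where "open G" "Cap1 M G < ennreal \<epsilon>" "continuous_on (- G) f"
proof -
  define P where "P n G r \<longleftrightarrow> open G \<and> Cap1 M G < ennreal (\<epsilon>/2 * (1/2)^Suc n) \<and> r > 0 \<and>
    (\<forall>x y. x \<notin> G \<longrightarrow> y \<notin> G \<longrightarrow> dist x y < r \<longrightarrow> \<bar>f x - f y\<bar> \<le> 8 * (1 / (2 * real (Suc n))))"
    for n :: nat and G :: "'a set" and r :: real
  have "\<exists>G r. P n G r" for n
  proof -
    have 1: "1 / (2 * real (Suc n)) > 0" "2 * (1 / (2 * real (Suc n))) \<le> 1" by auto
    have 2: "\<epsilon>/2 * (1/2)^Suc n > 0" using \<epsilon> by simp
    show ?thesis unfolding P_def
      by (rule Cap1_small_oscillation[OF f K ug fin 1 2]) (intro exI conjI; assumption)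
  qed
  then obtain G r where "\<And>n. P n (G n) (r n)" by metis
  then have Gr: "\<And>n. open (G n)" "\<And>n. Cap1 M (G n) < ennreal (\<epsilon>/2 * (1/2)^Suc n)" "\<And>n. r n > 0"
    "\<And>n x y. x \<notin> G n \<Longrightarrow> y \<notin> G n \<Longrightarrow> dist x y < r n \<Longrightarrow> \<bar>f x - f y\<bar> \<le> 8 * (1 / (2 * real (Suc n)))"
    unfolding P_def by auto
  show thesis
  proof (rule that[of "\<Union>n. G n"])
    show "open (\<Union>n. G n)" using Gr by auto
    show "Cap1 M (\<Union>n. G n) < ennreal \<epsilon>" by (rule Cap1_UN_less[OF Gr(2) \<epsilon>])
    show "continuous_on (- (\<Union>n. G n)) f" unfolding continuous_on_iff
    proof (intro ballI allI impI)
      fix x e assume x: "x \<in> - (\<Union>n. G n)" and "(e::real) > 0"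
      obtain n :: nat where n: "4 / e < n" using reals_Archimedean2 by blast
      then have n: "8 * (1 / (2 * real (Suc n))) < e" using \<open>e > 0\<close> by (simp add: field_simps)
      show "\<exists>d>0. \<forall>x'\<in>- (\<Union>n. G n). dist x' x < d \<longrightarrow> dist (f x') (f x) < e"
      proof (intro exI[of _ "r n"] conjI ballI impI Gr)
        fix y assume y: "y \<in> - (\<Union>n. G n)" "dist y x < r n"
        have "\<bar>f y - f x\<bar> \<le> 8 * (1 / (2 * real (Suc n)))" using x y by (intro Gr) auto
        then show "dist (f y) (f x) < e" using n by (simp add: dist_real_def)
      qed
    qed
  qed
qed

text \<open>For the set where \<open>f\<close> exceeds \<open>1 / Suc n\<close>, the multiple
  \<open>Suc n * f\<close> is a test function of zero integral, and its gradient can be cut to a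
  null set up to a small multiple of \<open>g\<close>. Quasicontinuity then makes the set open after
  adding an open set of small capacity. This will exclude infinite values.\<close>

lemma null_function_outer:
  assumes f[measurable]: "f \<in> borel_measurable CM" and K: "\<And>x. f x \<le> K" and f0: "\<And>x. 0 \<le> f x"
    and ug: "ug f g" and fin: "(\<integral>\<^sup>+ x. g x \<partial>M) < \<infinity>" and ae: "AE x in M. f x = 0" and \<epsilon>: "\<epsilon> > 0"
  obtains G where "open G" "Cap1 M G < ennreal \<epsilon>" "{x. f x > 0} \<subseteq> G"
proof -
  obtain R where R: "(\<integral>\<^sup>+ x. g x \<partial>M) = ennreal R" "0 \<le> R" using fin by (cases "\<integral>\<^sup>+ x. g x \<partial>M" rule: ennreal_cases) auto
  have gM[measurable]: "g \<in> borel_measurable M" using ug_borel[OF ug] measurable_cong_sets[OF sets_M refl, of borel] by auto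
  have "{x\<in>space CM. f x > 0} \<in> sets CM" by measurable
  then obtain S where S: "S \<in> sets M" "{x\<in>space CM. f x > 0} \<subseteq> S" "AE x in M. x \<in> S \<longleftrightarrow> x \<in> {x\<in>space CM. f x > 0}"
    using completion_borel_superset by blast
  have aeS: "AE x in M. x \<notin> S" using S(3) ae by eventually_elim auto
  have cap: "Cap1 M {x. f x > 1 / Suc n} < ennreal e" if "e > 0" for n e
  proof -
    define q where "q = real (Suc n)"
    have q: "q > 0" by (simp add: q_def)
    define \<theta> where "\<theta> = e / (2 * q * (R + 1))"
    have \<theta>: "\<theta> > 0" using that R q unfolding \<theta>_def by (intro divide_pos_pos mult_pos_pos) auto
    have "q * (\<theta> * R) = e / 2 * (R / (R + 1))" unfolding \<theta>_def using q by simp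
    also have "\<dots> \<le> e / 2 * 1" using that R by (intro mult_left_mono) auto
    finally have \<theta>R: "Suc n * (\<theta> * R) < e" using that by (simp add: q_def)
    have "ug f (\<lambda>x. g x * indicator S x + ennreal \<theta> * g x)"
    proof (rule ug_glue[where \<phi> = f, OF ug_borel[OF ug] ug_borel[OF ug] \<theta>])
      show "S \<in> sets borel" using S(1) by (simp add: sets_M)
    qed (use f0 S(2) ugD[OF ug] ug_continuous[OF ug] in auto)
    then have ug': "ug (\<lambda>x. real (Suc n) * f x) (\<lambda>x. ennreal (Suc n) * (g x * indicator S x + ennreal \<theta> * g x))"
      by (rule ug_cmult) simp
    have "Cap1 M {x. f x > 1 / Suc n} \<le> (\<integral>\<^sup>+ x. ennreal (real (Suc n) * f x) \<partial>M)
        + (\<integral>\<^sup>+ x. ennreal (Suc n) * (g x * indicator S x + ennreal \<theta> * g x) \<partial>M)"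
      using f0 by (intro Cap1_le ug') (auto simp: field_simps)
    also have "(\<integral>\<^sup>+ x. ennreal (real (Suc n) * f x) \<partial>M) = (\<integral>\<^sup>+ x. 0 \<partial>M)"
      by (rule nn_integral_cong_AE, use ae in eventually_elim) simp
    also have "(\<integral>\<^sup>+ x. ennreal (Suc n) * (g x * indicator S x + ennreal \<theta> * g x) \<partial>M)
        = (\<integral>\<^sup>+ x. ennreal (Suc n * \<theta>) * g x \<partial>M)"
    proof (rule nn_integral_cong_AE, use aeS in eventually_elim)
      case (elim x)
      then show ?case using \<theta> by (simp add: ennreal_mult mult.assoc del: of_nat_Suc)
    qed
    also have "\<dots> = ennreal (Suc n * (\<theta> * R))"
      using \<theta> R by (simp add: nn_integral_cmult ennreal_mult mult.assoc del: of_nat_Suc)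
    finally show ?thesis using \<theta>R that by (auto intro: le_less_trans ennreal_lessI simp del: of_nat_Suc)
  qed
  have "\<exists>G. open G \<and> Cap1 M G < ennreal (\<epsilon>/2 * (1/2)^Suc n) \<and> {x. f x > 1 / Suc n} \<subseteq> G" for n :: nat
  proof -
    let ?e = "\<epsilon>/2 * (1/2)^Suc n"
    have "?e / 2 > 0" using \<epsilon> by simp
    obtain G where G: "open G" "Cap1 M G < ennreal (?e/2)" "continuous_on (- G) f"
      using quasicontinuous_bounded[OF f _ ug fin \<open>?e / 2 > 0\<close>, of K] K f0 by auto
    have "Cap1 M ({x. f x > 1 / Suc n} \<union> G) < ennreal (?e/2 + ?e/2)"
      using \<epsilon> by (intro Cap1_Un_less G cap) auto
    moreover have "open ({x. f x > 1 / Suc n} \<union> G)" using G by (intro open_superlevel_Un)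
    ultimately show ?thesis by (intro exI[of _ "{x. f x > 1 / Suc n} \<union> G"]) auto
  qed
  then obtain G where G: "\<And>n. open (G n)" "\<And>n. Cap1 M (G n) < ennreal (\<epsilon>/2 * (1/2)^Suc n)"
    "\<And>n. {x. f x > 1 / Suc n} \<subseteq> G n" by metis
  show thesis
  proof (rule that[of "\<Union>n. G n"])
    show "{x. f x > 0} \<subseteq> (\<Union>n. G n)"
    proof
      fix x assume "x \<in> {x. f x > 0}"
      then obtain n where "1 / Suc n < f x" using nat_approx_posE by blast
      then show "x \<in> (\<Union>n. G n)" using G(3)[of n] by auto
    qed
  qed (use G Cap1_UN_less[OF G(2) \<epsilon>] in auto)
qed

end

section \<open>Functions on quasiopen sets\<close>

lemma ediff_infinite: "\<not> (\<bar>x\<bar> \<noteq> \<infinity> \<and> \<bar>y\<bar> \<noteq> \<infinity>) \<Longrightarrow> ediff x y = \<infinity>"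
  unfolding ediff_def by (simp only: if_False)

lemma line_integral_suminf:
  assumes "rectifiable_curve \<gamma>" "\<And>n. f n \<in> borel_measurable borel"
  shows "line_integral \<gamma> (\<lambda>x. \<Sum>n. f n x) = (\<Sum>n. line_integral \<gamma> (f n))"
  unfolding line_integral_def ennreal_suminf_multc[symmetric]
  using assms by (intro nn_integral_suminf seg_measurable) auto

lemma line_integral_one_ge_dist:
  assumes "rectifiable_curve \<gamma>" shows "ennreal (dist (\<gamma> 0) (\<gamma> 1)) \<le> line_integral \<gamma> (\<lambda>x. 1)"
proof -
  have "ennreal (dist (\<gamma> 0) (\<gamma> 1)) \<le> ennreal (1 * plen \<gamma> 0 1)"
    using plen_ge_dist[OF assms, of 0 1] by (intro ennreal_leI) auto
  also have "\<dots> \<le> line_integral \<gamma> (\<lambda>x. 1)" using assms by (intro line_integral_lower) auto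
  finally show ?thesis .
qed

lemma line_integral_one_finite:
  assumes "rectifiable_curve \<gamma>" shows "line_integral \<gamma> (\<lambda>x. 1) < \<infinity>"
proof -
  have "line_integral \<gamma> (\<lambda>x. 1) \<le> ennreal (1 * plen \<gamma> 0 1)"
    unfolding line_integral_seg using assms by (intro seg_upper) auto
  also have "\<dots> < \<infinity>" by simp
  finally show ?thesis .
qed

lemma ug_min_lipschitz:
  assumes w: "ug w k" and d: "\<And>x y. \<bar>d x - d y\<bar> \<le> dist x y"
  shows "ug (\<lambda>x. min (1 - w x) (d x)) (\<lambda>x. k x + 1)"
  unfolding ug_def
proof (intro conjI allI impI)
  show "(\<lambda>x. k x + 1) \<in> borel_measurable borel" using ug_borel[OF w] by measurable
  fix \<gamma> :: "real \<Rightarrow> 'a" assume rc: "rectifiable_curve \<gamma>"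
  have "\<bar>min (1 - w (\<gamma> 0)) (d (\<gamma> 0)) - min (1 - w (\<gamma> 1)) (d (\<gamma> 1))\<bar>
      \<le> \<bar>w (\<gamma> 0) - w (\<gamma> 1)\<bar> + dist (\<gamma> 0) (\<gamma> 1)"
    using d[of "\<gamma> 0" "\<gamma> 1"] zero_le_dist[of "\<gamma> 0" "\<gamma> 1"] by linarith
  then have "ennreal \<bar>min (1 - w (\<gamma> 0)) (d (\<gamma> 0)) - min (1 - w (\<gamma> 1)) (d (\<gamma> 1))\<bar>
      \<le> ennreal (\<bar>w (\<gamma> 0) - w (\<gamma> 1)\<bar> + dist (\<gamma> 0) (\<gamma> 1))" by (rule ennreal_leI)
  also have "\<dots> = ennreal \<bar>w (\<gamma> 0) - w (\<gamma> 1)\<bar> + ennreal (dist (\<gamma> 0) (\<gamma> 1))" by simp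
  also have "\<dots> \<le> line_integral \<gamma> k + line_integral \<gamma> (\<lambda>x. 1)"
    by (intro add_mono ugD[OF w rc] line_integral_one_ge_dist rc)
  also have "\<dots> = line_integral \<gamma> (\<lambda>x. k x + 1)"
    by (rule line_integral_add[symmetric]) (use rc ug_borel[OF w] in auto)
  finally show "ennreal \<bar>min (1 - w (\<gamma> 0)) (d (\<gamma> 0)) - min (1 - w (\<gamma> 1)) (d (\<gamma> 1))\<bar>
      \<le> line_integral \<gamma> (\<lambda>x. k x + 1)" .
qed

context doubling_space
begin

lemma borel_M: "g \<in> borel_measurable borel \<Longrightarrow> g \<in> borel_measurable M"
  using measurable_cong_sets[OF sets_M refl, of borel] by auto

text \<open>\<open>U\<close> differs from the intersection of the open sets
  \<open>U \<union> G n\<close> by a subset of the null set \<open>\<Inter>n. G n\<close>.\<close>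

lemma quasiopen_sets:
  assumes "quasiopen1 M U" shows "U \<in> sets (completion M)"
proof -
  have "\<exists>G. open G \<and> Cap1 M G < ennreal ((1/2)^n) \<and> open (U \<union> G)" for n :: nat
    using assms unfolding quasiopen1_def by (metis zero_less_power half_gt_zero zero_less_one)
  then obtain G where G: "\<And>n. open (G n)" "\<And>n. Cap1 M (G n) < ennreal ((1/2)^n)" "\<And>n. open (U \<union> G n)" by metis
  have Gs: "G n \<in> sets M" "U \<union> G n \<in> sets M" for n using G by (auto simp: sets_M)
  have "emeasure M (\<Inter>n. G n) \<le> ennreal ((1/2)^n)" for n
  proof -
    have "emeasure M (\<Inter>n. G n) \<le> emeasure M (G n)" using Gs by (intro emeasure_mono) auto
    also have "\<dots> \<le> ennreal ((1/2)^n)" by (rule emeasure_le_Cap1[OF G(1,2)])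
    finally show ?thesis .
  qed
  moreover have "(\<lambda>n. ennreal ((1/2)^n)) \<longlonglongrightarrow> ennreal 0"
    by (intro tendsto_ennrealI LIMSEQ_power_zero) simp
  ultimately have "emeasure M (\<Inter>n. G n) \<le> ennreal 0" by (intro LIMSEQ_le_const) auto
  then have "(\<Inter>n. G n) \<in> null_sets M" using Gs by (auto simp: null_sets_def)
  then have 1: "(\<Inter>n. U \<union> G n) - U \<in> sets (completion M)" by (rule sets_completionI_sub) auto
  have 2: "(\<Inter>n. U \<union> G n) \<in> sets (completion M)" 
    by (intro sets_completionI_sets sets.countable_INT'' Gs) (auto simp: sets_M)
  have "U = (\<Inter>n. U \<union> G n) - ((\<Inter>n. U \<union> G n) - U)" by auto
  then show ?thesis using 1 2 by (metis sets.Diff)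
qed

text \<open>A curve may run inside a null set, so the Borel representative is raised to infinity on
  a null set where it may fail to dominate \<open>f\<close>.\<close>

lemma borel_majorant:
  fixes f :: "'a \<Rightarrow> real"
  assumes "f \<in> borel_measurable (completion M)"
  obtains f' :: "'a \<Rightarrow> ennreal" where "f' \<in> borel_measurable borel" "\<And>x. ennreal (f x) \<le> f' x"
    "(\<integral>\<^sup>+ x. f' x \<partial>M) = (\<integral>\<^sup>+ x. ennreal (f x) \<partial>M)"
proof -
  obtain q where q: "q \<in> borel_measurable M" "AE x in M. f x = q x"
    using completion_ex_borel_measurable_real[OF assms] by blast
  obtain N where N: "{x\<in>space M. \<not> f x = q x} \<subseteq> N" "N \<in> sets M" "emeasure M N = 0" using AE_E[OF q(2)] by blast
  have qb: "q \<in> borel_measurable borel" using q(1) measurable_cong_sets[OF sets_M refl, of borel] by auto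
  have Nb: "N \<in> sets borel" using N(2) by (simp add: sets_M)
  show thesis
  proof (rule that[of "\<lambda>x. ennreal (q x) + top * indicator N x"])
    show "(\<lambda>x. ennreal (q x) + top * indicator N x) \<in> borel_measurable borel" using qb Nb by measurable
    show "ennreal (f x) \<le> ennreal (q x) + top * indicator N x" for x
    proof (cases "x \<in> N")
      case False
      then have "f x = q x" using N(1) by auto
      then show ?thesis by simp
    qed auto
    have "AE x in M. x \<notin> N" using N by (intro AE_not_in) (auto simp: null_sets_def)
    then show "(\<integral>\<^sup>+ x. ennreal (q x) + top * indicator N x \<partial>M) = (\<integral>\<^sup>+ x. ennreal (f x) \<partial>M)"
      using q(2) by (intro nn_integral_cong_AE) auto
  qed
qed

end

section \<open>The two implications\<close>

context poincare_space
begin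

text \<open>Near a point of \<open>U\<close> off the exceptional set, the clipping at height
  \<open>n * \<phi> n\<close> is inactive for a large \<open>n\<close>, so \<open>v\<close> inherits
  continuity from that one \<open>f n\<close>. Infinite values are excluded separately, by means of
  \<open>F\<close>.\<close>

lemma N11_quasicontinuous:
  assumes qo: "quasiopen1 M U" and N: "N11 M U v"
  shows "quasicontinuous1_on M U v"
  unfolding quasicontinuous1_on_def
proof (intro allI impI)
  fix \<epsilon> :: real assume \<epsilon>: "\<epsilon> > 0"
  have Um[measurable]: "U \<in> sets CM" by (rule quasiopen_sets[OF qo])
  define vU where "vU x = (if x \<in> U then v x else 0)" for x
  have vm[measurable]: "vU \<in> borel_measurable CM" using N by (simp add: N11_def vU_def[abs_def])
  have vint: "(\<integral>\<^sup>+ x. e2ennreal \<bar>v x\<bar> * indicator U x \<partial>CM) < \<infinity>" using N by (simp add: N11_def)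
  obtain g0 where wug: "weak_upper_gradient_in M U v g0" and g0int: "(\<integral>\<^sup>+ x. g0 x * indicator U x \<partial>CM) < \<infinity>"
    using N by (auto simp: N11_def)
  obtain \<Gamma> \<rho> where g0: "g0 \<in> borel_measurable borel" and \<rho>: "\<rho> \<in> borel_measurable borel" "(\<integral>\<^sup>+ x. \<rho> x \<partial>M) < \<infinity>"
    "\<forall>\<gamma>\<in>\<Gamma>. line_integral \<gamma> \<rho> = \<infinity>"
    "\<forall>\<gamma>. rectifiable_curve \<gamma> \<and> nonconstant_curve \<gamma> \<and> \<gamma> ` {0..1} \<subseteq> U \<and> \<gamma> \<notin> \<Gamma> \<longrightarrow> ug_ineq v g0 \<gamma>"
    using wug unfolding weak_upper_gradient_in_def zero_1_modulus_def by (auto simp: nn_integral_completion)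
  obtain S where S: "S \<in> sets M" "U \<subseteq> S" "AE x in M. x \<in> S \<longleftrightarrow> x \<in> U" using completion_borel_superset[OF Um] by blast
  have Sb[measurable]: "S \<in> sets borel" using S(1) by (simp add: sets_M)
  \<comment> \<open>\<open>g0\<close> is kept on the Borel hull \<open>S\<close> of
    \<open>U\<close>, over which it is integrable, and \<open>\<rho>\<close> absorbs the exceptional
    curves.\<close>
  define g where "g x = g0 x * indicator S x + \<rho> x" for x
  have gb[measurable]: "g \<in> borel_measurable borel" unfolding g_def using g0 \<rho>(1) by measurable
  have gint: "(\<integral>\<^sup>+ x. g x \<partial>M) < \<infinity>"
  proof -
    have "(\<integral>\<^sup>+ x. g x \<partial>M) = (\<integral>\<^sup>+ x. g0 x * indicator S x \<partial>M) + (\<integral>\<^sup>+ x. \<rho> x \<partial>M)"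
    proof -
      note [measurable] = borel_M[OF g0] borel_M[OF \<rho>(1)] S(1)
      show ?thesis unfolding g_def by (intro nn_integral_add) measurable
    qed
    also have "(\<integral>\<^sup>+ x. g0 x * indicator S x \<partial>M) = (\<integral>\<^sup>+ x. g0 x * indicator U x \<partial>M)"
      using S(3) by (intro nn_integral_cong_AE) (auto simp: indicator_def)
    finally show ?thesis using g0int \<rho>(2) by (simp add: nn_integral_completion ennreal_add_less_top)
  qed
  have v_ug: "ediff (v (\<sigma> 0)) (v (\<sigma> 1)) \<le> line_integral \<sigma> g"
    if rc: "rectifiable_curve \<sigma>" and U: "\<And>t. t \<in> {0..1} \<Longrightarrow> \<sigma> t \<in> U" and ne: "\<sigma> 0 \<noteq> \<sigma> 1" for \<sigma>
  proof (cases "\<sigma> \<in> \<Gamma>")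
    case True
    then have "\<infinity> = line_integral \<sigma> \<rho>" using \<rho>(3) by simp
    also have "\<dots> \<le> line_integral \<sigma> g" by (rule line_integral_mono') (simp add: g_def)
    finally show ?thesis by (simp add: top_unique)
  next
    case False
    have "ediff (v (\<sigma> 0)) (v (\<sigma> 1)) \<le> line_integral \<sigma> g0"
      using \<rho>(4) rc nonconstantI[of \<sigma>, OF ne] False U by (auto simp: ug_ineq_def image_subset_iff)
    also have "\<dots> \<le> line_integral \<sigma> g"
      using U S(2) by (intro line_integral_mono) (auto simp: g_def indicator_def)
    finally show ?thesis .
  qed
  obtain G0 where G0: "open G0" "Cap1 M G0 < ennreal (\<epsilon>/8)" "open (U \<union> G0)"
    using qo \<epsilon> unfolding quasiopen1_def by (metis zero_less_divide_iff zero_less_numeral)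
  obtain w k where w: "w \<in> borel_measurable CM" "\<And>x. 0 \<le> w x" "\<And>x. w x \<le> 1"
    "\<And>x. x \<in> G0 \<Longrightarrow> w x = 1" "ug w k" "(\<integral>\<^sup>+ x. ennreal (w x) \<partial>M) + (\<integral>\<^sup>+ x. k x \<partial>M) < ennreal (\<epsilon>/8)"
    using Cap1_less[OF G0(2)] by blast
  note [measurable] = w(1) ug_borel[OF w(5)]
  have kint: "(\<integral>\<^sup>+ x. k x \<partial>M) < \<infinity>"
  proof -
    have "(\<integral>\<^sup>+ x. k x \<partial>M) \<le> (\<integral>\<^sup>+ x. ennreal (w x) \<partial>M) + (\<integral>\<^sup>+ x. k x \<partial>M)" by simp
    also have "\<dots> < ennreal (\<epsilon>/8)" by (rule w(6))
    also have "\<dots> < \<infinity>" by simp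
    finally show ?thesis .
  qed
  define \<Omega> where "\<Omega> = U \<union> G0"
  fix z :: 'a
  \<comment> \<open>\<open>infdist\<close> to the empty set is 0, so the whole space gets the value
    1.\<close>
  define d\<Omega> where "d\<Omega> x = (if \<Omega> = UNIV then 1 else infdist x (- \<Omega>))" for x
  have d\<Omega>: "0 \<le> d\<Omega> x" "x \<notin> \<Omega> \<Longrightarrow> d\<Omega> x = 0" "x \<in> \<Omega> \<Longrightarrow> d\<Omega> x > 0" "\<bar>d\<Omega> x - d\<Omega> y\<bar> \<le> dist x y" for x y
  proof -
    have cl: "closed (- \<Omega>)" unfolding \<Omega>_def using G0(3) by (rule closed_Compl)
    show "0 \<le> d\<Omega> x" by (simp add: d\<Omega>_def infdist_nonneg)
    show "x \<notin> \<Omega> \<Longrightarrow> d\<Omega> x = 0" by (auto simp: d\<Omega>_def)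
    show "d\<Omega> x > 0" if "x \<in> \<Omega>"
    proof (cases "\<Omega> = UNIV")
      case False
      then have "- \<Omega> \<noteq> {}" by auto
      then show ?thesis using infdist_pos_not_in_closed[OF cl, of x] that False by (simp add: d\<Omega>_def)
    qed (simp add: d\<Omega>_def)
    show "\<bar>d\<Omega> x - d\<Omega> y\<bar> \<le> dist x y"
      using infdist_triangle_abs[of x "- \<Omega>" y] by (simp add: d\<Omega>_def)
  qed
  \<comment> \<open>In general the gradient \<open>k + 1\<close> of \<open>\<phi>\<close> is
    integrable over bounded sets only; hence the cutoff to the ball of radius \<open>n\<close>
    around \<open>z\<close>.\<close>
  define d where "d n x = min (d\<Omega> x) (max 0 (real n - dist x z))" for n x
  have d: "0 \<le> d n x" "\<bar>d n x - d n y\<bar> \<le> dist x y" for n x y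
  proof -
    show "0 \<le> d n x" using d\<Omega>(1)[of x] by (simp add: d_def)
    have "\<bar>dist x z - dist y z\<bar> \<le> dist x y"
      using dist_triangle[of x z y] dist_triangle[of y z x] by (simp add: dist_commute abs_le_iff)
    then show "\<bar>d n x - d n y\<bar> \<le> dist x y" using d\<Omega>(4)[of x y] unfolding d_def by linarith
  qed
  have dc: "continuous_on UNIV (d n)" for n
  proof -
    have "1-lipschitz_on UNIV (d n)" using d(2) by (intro lipschitz_onI) (auto simp: dist_real_def)
    then show ?thesis by (rule lipschitz_on_continuous_on)
  qed
  \<comment> \<open>\<open>1 - w\<close> vanishes on \<open>G0\<close> and \<open>d n\<close> off
    \<open>U \<union> G0\<close>, so \<open>\<phi> n\<close> is positive only at points of
    \<open>U\<close>.\<close>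
  define \<phi> where "\<phi> n x = min (1 - w x) (d n x)" for n x
  have \<phi>0: "0 \<le> \<phi> n x" "\<phi> n x \<le> 1" for n x using w(2,3)[of x] d(1)[of n x] by (auto simp: \<phi>_def)
  have \<phi>U: "x \<in> U" "dist x z < real n" if "\<phi> n x > 0" for n x
  proof -
    have "w x < 1" "d n x > 0" using that by (auto simp: \<phi>_def)
    then have "x \<notin> G0" "d\<Omega> x > 0" "dist x z < real n" using w(4)[of x] by (auto simp: d_def)
    then show "x \<in> U" "dist x z < real n" using d\<Omega>(2)[of x] by (auto simp: \<Omega>_def)
  qed
  have \<phi>m[measurable]: "\<phi> n \<in> borel_measurable CM" for n
  proof -
    have [measurable]: "d n \<in> borel_measurable CM" by (intro borel_CM borel_measurable_continuous_onI dc)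
    show ?thesis unfolding \<phi>_def by measurable
  qed
  have \<phi>ug: "ug (\<phi> n) (\<lambda>x. k x + 1)" for n unfolding \<phi>_def by (rule ug_min_lipschitz[OF w(5) d(2)])
  have k1: "line_integral \<gamma> (\<lambda>x. k x + 1) = line_integral \<gamma> k + line_integral \<gamma> (\<lambda>x. 1)" if "rectifiable_curve \<gamma>" for \<gamma>
    using that by (intro line_integral_add ug_borel[OF w(5)]) auto
  have \<phi>cont: "continuous_on {0..1} (\<phi> n \<circ> \<gamma>)" if "rectifiable_curve \<gamma>" "line_integral \<gamma> k < \<infinity>" for n \<gamma>
    using that line_integral_one_finite[OF that(1)]
    by (intro ug_continuous[OF \<phi>ug]) (auto simp: k1 ennreal_add_less_top)
  \<comment> \<open>The gradient of the clipped function on curves in \<open>U\<close>: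
    \<open>g\<close> for \<open>v\<close>, and \<open>c\<close> times the gradient of
    \<open>\<phi>\<close> for the moving bounds.\<close>
  define e where "e c x = g x + ennreal c * (k x + 1)" for c x
  have eb[measurable]: "e c \<in> borel_measurable borel" for c unfolding e_def by measurable
  have le: "line_integral \<gamma> (e c) = line_integral \<gamma> g + ennreal c * line_integral \<gamma> (\<lambda>x. k x + 1)"
    if "rectifiable_curve \<gamma>" for \<gamma> c
  proof -
    have kb: "(\<lambda>x. k x + 1) \<in> borel_measurable borel" by measurable
    have "line_integral \<gamma> (e c) = line_integral \<gamma> g + line_integral \<gamma> (\<lambda>x. ennreal c * (k x + 1))"
      unfolding e_def using that gb kb by (intro line_integral_add) measurable
    then show ?thesis by (simp add: line_integral_cmult[OF that kb])
  qed
  have eint: "(\<integral>\<^sup>+ x. e c x * indicator (ball z (real n)) x + ennreal 1 * k x \<partial>M) < \<infinity>" for c n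
  proof -
    have [measurable]: "g \<in> borel_measurable M" "k \<in> borel_measurable M" "ball z (real n) \<in> sets M"
      using borel_M[OF gb] borel_M[OF ug_borel[OF w(5)]] by (auto simp: sets_M)
    have "(\<integral>\<^sup>+ x. e c x * indicator (ball z (real n)) x + ennreal 1 * k x \<partial>M)
      \<le> (\<integral>\<^sup>+ x. g x + (ennreal c * k x + (ennreal c * indicator (ball z (real n)) x + k x)) \<partial>M)"
      unfolding e_def by (intro nn_integral_mono) (auto simp: indicator_def algebra_simps intro!: add_mono)
    also have "\<dots> = (\<integral>\<^sup>+ x. g x \<partial>M) + (ennreal c * (\<integral>\<^sup>+ x. k x \<partial>M) + (ennreal c * emeasure M (ball z (real n)) + (\<integral>\<^sup>+ x. k x \<partial>M)))"
      by (simp add: nn_integral_add nn_integral_cmult nn_integral_cmult_indicator)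
    also have "\<dots> < \<infinity>" using gint kint ball_finite[of z "real n"] by (simp add: ennreal_add_less_top ennreal_mult_less_top)
    finally show ?thesis .
  qed
  define f where "f n x = real_of_ereal (max (- ereal (n * \<phi> n x)) (min (ereal (n * \<phi> n x)) (vU x)))" for n :: nat and x
  have ef: "ereal (f n x) = max (- ereal (n * \<phi> n x)) (min (ereal (n * \<phi> n x)) (vU x))" for n x
  proof -
    have "\<bar>max (- ereal (n * \<phi> n x)) (min (ereal (n * \<phi> n x)) (vU x))\<bar> \<noteq> \<infinity>"
      by (cases "vU x") (auto simp: max_def min_def)
    then show ?thesis unfolding f_def by (simp add: ereal_real)
  qed
  have f_le: "\<bar>f n x\<bar> \<le> n * \<phi> n x" for n x
  proof -
    have "0 \<le> real n * \<phi> n x" using \<phi>0 by simp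
    then have "- ereal (n * \<phi> n x) \<le> ereal (f n x)" "ereal (f n x) \<le> ereal (n * \<phi> n x)"
      unfolding ef by (auto simp: max_def min_def)
    then show ?thesis by (simp add: abs_le_iff)
  qed
  \<comment> \<open>Strictly between its bounds the clipping does nothing, so the value is that of
    \<open>v\<close>.\<close>
  have f_eq: "vU x = ereal (f n x)" if "\<bar>f n x\<bar> < n * \<phi> n x" for n x
  proof -
    have "- ereal (n * \<phi> n x) < ereal (f n x)" "ereal (f n x) < ereal (n * \<phi> n x)" using that by (auto simp: abs_less_iff)
    then show ?thesis using ef[of n x] by (auto simp: max_def min_def split: if_splits)
  qed
  have f_clip: "f n x = max (- (n * \<phi> n x)) (min (n * \<phi> n x) a)" if "vU x = ereal a" for n x a
    using ef[of n x] that by (auto simp: max_def min_def split: if_splits)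
  have fm: "f n \<in> borel_measurable CM" for n unfolding f_def by measurable
  have fug: "ug (f n) (\<lambda>x. e (real n) x * indicator (ball z (real n)) x + ennreal 1 * k x)" for n
  proof (rule ug_glue[where \<phi> = "\<lambda>x. n * \<phi> n x", OF eb ug_borel[OF w(5)] _ f_le])
    show "continuous_on {0..1} ((\<lambda>x. n * \<phi> n x) \<circ> \<gamma>)" if "rectifiable_curve \<gamma>" "line_integral \<gamma> k < \<infinity>" for \<gamma>
      using \<phi>cont[OF that, of n] unfolding o_def by (intro continuous_intros)
    show "x \<in> ball z (real n)" if "0 < n * \<phi> n x" for x
      using \<phi>U(2)[of n x] that by (auto simp: zero_less_mult_iff dist_commute)
    fix \<sigma> :: "real \<Rightarrow> 'a" assume rc: "rectifiable_curve \<sigma>" and pos: "\<And>t. t \<in> {0..1} \<Longrightarrow> 0 < n * \<phi> n (\<sigma> t)"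
    have inU: "\<sigma> t \<in> U" if "t \<in> {0..1}" for t using pos[OF that] \<phi>U(1) by (auto simp: zero_less_mult_iff)
    show "ennreal \<bar>f n (\<sigma> 0) - f n (\<sigma> 1)\<bar> \<le> line_integral \<sigma> (e (real n))"
    proof (cases "\<sigma> 0 = \<sigma> 1")
      case False
      note ed = v_ug[OF rc inU False]
      show ?thesis
      proof (cases "\<bar>v (\<sigma> 0)\<bar> \<noteq> \<infinity> \<and> \<bar>v (\<sigma> 1)\<bar> \<noteq> \<infinity>")
        case True
        then obtain a b where ab: "v (\<sigma> 0) = ereal a" "v (\<sigma> 1) = ereal b" by (auto simp: ereal_infinity_cases)
        then have f01: "f n (\<sigma> 0) = max (- (n * \<phi> n (\<sigma> 0))) (min (n * \<phi> n (\<sigma> 0)) a)"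
          "f n (\<sigma> 1) = max (- (n * \<phi> n (\<sigma> 1))) (min (n * \<phi> n (\<sigma> 1)) b)"
          using inU by (auto intro!: f_clip simp: vU_def)
        have "\<bar>f n (\<sigma> 0) - f n (\<sigma> 1)\<bar> \<le> \<bar>a - b\<bar> + \<bar>n * \<phi> n (\<sigma> 0) - n * \<phi> n (\<sigma> 1)\<bar>" unfolding f01 by linarith
        also have "\<bar>n * \<phi> n (\<sigma> 0) - n * \<phi> n (\<sigma> 1)\<bar> = n * \<bar>\<phi> n (\<sigma> 0) - \<phi> n (\<sigma> 1)\<bar>"
          by (simp add: right_diff_distrib[symmetric] abs_mult)
        finally have "ennreal \<bar>f n (\<sigma> 0) - f n (\<sigma> 1)\<bar> \<le> ennreal (\<bar>a - b\<bar> + n * \<bar>\<phi> n (\<sigma> 0) - \<phi> n (\<sigma> 1)\<bar>)" by (rule ennreal_leI)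
        also have "\<dots> = ennreal \<bar>a - b\<bar> + ennreal n * ennreal \<bar>\<phi> n (\<sigma> 0) - \<phi> n (\<sigma> 1)\<bar>" by (simp add: ennreal_mult)
        also have "\<dots> \<le> line_integral \<sigma> g + ennreal n * line_integral \<sigma> (\<lambda>x. k x + 1)"
          using ed ab by (intro add_mono mult_left_mono ugD[OF \<phi>ug rc]) (auto simp: ediff_def)
        finally show ?thesis by (simp add: le[OF rc])
      next
        case False
        then show ?thesis using ed ediff_infinite[OF False] by (simp add: le[OF rc] top_unique)
      qed
    qed simp
  qed auto
  \<comment> \<open>Marks infinite values of \<open>v\<close>. For a curve in \<open>U\<close> with
    distinct ends, either the marker vanishes at both, or \<open>ediff\<close>, and with it the line
    integral of \<open>g\<close>, is infinite.\<close>
  define F where "F n x = (if \<bar>vU x\<bar> = \<infinity> then \<phi> n x else 0)" for n x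
  have Fm: "F n \<in> borel_measurable CM" for n unfolding F_def by measurable
  have F0: "0 \<le> F n x" "F n x \<le> 1" for n x using \<phi>0 by (auto simp: F_def)
  have Fug: "ug (F n) (\<lambda>x. e 1 x * indicator (ball z (real n)) x + ennreal 1 * k x)" for n
  proof (rule ug_glue[where \<phi> = "\<phi> n", OF eb ug_borel[OF w(5)] _ _ \<phi>cont])
    show "\<bar>F n x\<bar> \<le> \<phi> n x" for x using \<phi>0(1)[of n x] by (simp add: F_def)
    show "x \<in> ball z (real n)" if "0 < \<phi> n x" for x using \<phi>U(2)[OF that] by (simp add: dist_commute)
    fix \<sigma> :: "real \<Rightarrow> 'a" assume rc: "rectifiable_curve \<sigma>" and pos: "\<And>t. t \<in> {0..1} \<Longrightarrow> 0 < \<phi> n (\<sigma> t)"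
    have inU: "\<sigma> t \<in> U" if "t \<in> {0..1}" for t using pos[OF that] \<phi>U(1) by auto
    show "ennreal \<bar>F n (\<sigma> 0) - F n (\<sigma> 1)\<bar> \<le> line_integral \<sigma> (e 1)"
    proof (cases "\<sigma> 0 = \<sigma> 1")
      case False
      note ed = v_ug[OF rc inU False]
      show ?thesis
      proof (cases "\<bar>v (\<sigma> 0)\<bar> \<noteq> \<infinity> \<and> \<bar>v (\<sigma> 1)\<bar> \<noteq> \<infinity>")
        case True
        then show ?thesis using inU by (auto simp: F_def vU_def)
      next
        case False
        then show ?thesis using ed ediff_infinite[OF False] by (simp add: le[OF rc] top_unique)
      qed
    qed simp
  qed auto
  have Fae: "AE x in M. F n x = 0" for n
  proof -
    have "(\<integral>\<^sup>+ x. e2ennreal \<bar>vU x\<bar> \<partial>CM) = (\<integral>\<^sup>+ x. e2ennreal \<bar>v x\<bar> * indicator U x \<partial>CM)"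
      by (intro nn_integral_cong) (auto simp: vU_def indicator_def e2ennreal_neg)
    then have "(\<integral>\<^sup>+ x. e2ennreal \<bar>vU x\<bar> \<partial>CM) \<noteq> \<infinity>" using vint by auto
    moreover have "(\<lambda>x. e2ennreal \<bar>vU x\<bar>) \<in> borel_measurable CM" by measurable
    ultimately have "AE x in CM. e2ennreal \<bar>vU x\<bar> \<noteq> \<infinity>" by (intro nn_integral_PInf_AE)
    then have "AE x in CM. F n x = 0" by eventually_elim (auto simp: F_def)
    then show ?thesis by (simp add: AE_completion_iff)
  qed
  \<comment> \<open>The last division by 2 is there because \<open>G n\<close> and
    \<open>W n\<close> share one term of the series for \<open>\<epsilon>/4\<close>.\<close>
  define \<epsilon>n where "\<epsilon>n n = (\<epsilon>/4)/2 * (1/2)^Suc n / 2" for n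
  have \<epsilon>n: "\<epsilon>n n > 0" for n using \<epsilon> by (simp add: \<epsilon>n_def)
  have "\<exists>G. open G \<and> Cap1 M G < ennreal (\<epsilon>n n) \<and> continuous_on (- G) (f n)" for n
  proof -
    have "\<bar>f n x\<bar> \<le> real n" for x
    proof -
      have "real n * \<phi> n x \<le> real n * 1" using \<phi>0 by (intro mult_left_mono) auto
      then show ?thesis using f_le[of n x] by linarith
    qed
    from quasicontinuous_bounded[OF fm this fug eint \<epsilon>n[of n]] show ?thesis by blast
  qed
  then obtain G where G: "\<And>n. open (G n)" "\<And>n. Cap1 M (G n) < ennreal (\<epsilon>n n)" "\<And>n. continuous_on (- G n) (f n)" by metis
  have "\<exists>W. open W \<and> Cap1 M W < ennreal (\<epsilon>n n) \<and> {x. F n x > 0} \<subseteq> W" for n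
    using null_function_outer[OF Fm F0(2) F0(1) Fug eint Fae \<epsilon>n[of n]] by blast
  then obtain W where W: "\<And>n. open (W n)" "\<And>n. Cap1 M (W n) < ennreal (\<epsilon>n n)" "\<And>n. {x. F n x > 0} \<subseteq> W n" by metis
  have "\<bar>w x\<bar> \<le> 1" for x using w(2,3)[of x] by simp
  then obtain Gw where Gw: "open Gw" "Cap1 M Gw < ennreal (\<epsilon>/4)" "continuous_on (- Gw) w"
    using quasicontinuous_bounded[OF w(1) _ w(5) kint, of 1 "\<epsilon>/4"] \<epsilon> by auto
  \<comment> \<open>\<open>2 * w\<close> is a test function, so the bound
    \<open>\<epsilon>/8\<close> for \<open>G0\<close> doubles.\<close>
  have capw: "Cap1 M {x. w x > 1/2} < ennreal (\<epsilon>/4)"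
  proof -
    have "Cap1 M {x. w x > 1/2} \<le> (\<integral>\<^sup>+ x. ennreal (2 * w x) \<partial>M) + (\<integral>\<^sup>+ x. ennreal 2 * k x \<partial>M)"
      using w by (intro Cap1_le ug_cmult) auto
    also have "(\<integral>\<^sup>+ x. ennreal (2 * w x) \<partial>M) = 2 * (\<integral>\<^sup>+ x. ennreal (w x) \<partial>M)"
      unfolding nn_integral_completion[symmetric, of M] using w(2)
      by (subst nn_integral_cmult[symmetric]) (auto simp: ennreal_mult)
    also have "(\<integral>\<^sup>+ x. ennreal 2 * k x \<partial>M) = 2 * (\<integral>\<^sup>+ x. k x \<partial>M)"
      using borel_M[OF ug_borel[OF w(5)]] by (simp add: nn_integral_cmult)
    also have "2 * (\<integral>\<^sup>+ x. ennreal (w x) \<partial>M) + 2 * (\<integral>\<^sup>+ x. k x \<partial>M)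
        = 2 * ((\<integral>\<^sup>+ x. ennreal (w x) \<partial>M) + (\<integral>\<^sup>+ x. k x \<partial>M))" by (simp add: distrib_left)
    also have "\<dots> < 2 * ennreal (\<epsilon>/8)" using w(6) by (intro ennreal_mult_strict_left_mono) auto
    also have "\<dots> = ennreal (\<epsilon>/4)" using \<epsilon> ennreal_mult[of 2 "\<epsilon>/8"] by simp
    finally show ?thesis .
  qed
  \<comment> \<open>Three portions of \<open>\<epsilon>/4\<close>. Off \<open>H\<close>,
    \<open>w\<close> is at most 1/2 and continuous, every \<open>f n\<close> is continuous, and each
    \<open>F n\<close> vanishes.\<close>
  define H where "H = ({x. w x > 1/2} \<union> Gw) \<union> (\<Union>n. G n \<union> W n)"
  show "\<exists>G. open G \<and> Cap1 M G < ennreal \<epsilon> \<and> (\<forall>x\<in>U - G. \<bar>v x\<bar> \<noteq> \<infinity>) \<and> continuous_on (U - G) (\<lambda>x. real_of_ereal (v x))"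
  proof (intro exI[of _ H] conjI ballI)
    have "open ({x. w x > 1/2} \<union> Gw)" using Gw by (intro open_superlevel_Un)
    then show "open H" unfolding H_def by (rule open_Un) (intro open_UN ballI open_Un G(1) W(1))
    have "Cap1 M (\<Union>n. G n \<union> W n) < ennreal (\<epsilon>/4)"
    proof (rule Cap1_UN_less)
      fix n
      have "Cap1 M (G n \<union> W n) < ennreal (\<epsilon>n n + \<epsilon>n n)" by (intro Cap1_Un_less G W)
      then show "Cap1 M (G n \<union> W n) < ennreal ((\<epsilon>/4)/2 * (1/2)^Suc n)" by (simp add: \<epsilon>n_def)
    qed (use \<epsilon> in simp)
    then have "Cap1 M H < ennreal ((\<epsilon>/4 + \<epsilon>/4) + \<epsilon>/4)" unfolding H_def by (intro Cap1_Un_less capw Gw)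
    also have "\<dots> \<le> ennreal \<epsilon>" using \<epsilon> by (intro ennreal_leI) auto
    finally show "Cap1 M H < ennreal \<epsilon>" .
    have wH: "w x \<le> 1/2" if "x \<notin> H" for x using that by (auto simp: H_def)
    \<comment> \<open>The lower bound does not depend on \<open>n\<close>, so
      \<open>n * \<phi> n x\<close> tends to infinity at each point of \<open>U - H\<close>.\<close>
    have \<phi>low: "min (1/2) (d\<Omega> x) \<le> \<phi> n x" if "x \<notin> H" "dist x z + 1 \<le> real n" for x n
      using wH[OF that(1)] that(2) by (auto simp: \<phi>_def d_def)
    have low: "min (1/2) (d\<Omega> x) > 0" if "x \<in> U" for x using d\<Omega>(3)[of x] that by (auto simp: \<Omega>_def)
    show vfin: "\<bar>v x\<bar> \<noteq> \<infinity>" if "x \<in> U - H" for x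
    proof
      assume inf: "\<bar>v x\<bar> = \<infinity>"
      obtain n :: nat where n: "dist x z + 1 \<le> real n" using real_arch_simple by blast
      have "\<phi> n x > 0" using \<phi>low[of x n] low[of x] that n by auto
      then have "F n x > 0" using inf that by (simp add: F_def vU_def)
      then show False using W(3)[of n] that by (auto simp: H_def)
    qed
    show "continuous_on (U - H) (\<lambda>x. real_of_ereal (v x))"
      unfolding continuous_on_def
    proof
      fix x assume x: "x \<in> U - H"
      define m where "m = min (1/2) (d\<Omega> x)"
      have m: "m > 0" using low[of x] x by (auto simp: m_def)
      obtain a where a: "v x = ereal a" using vfin[OF x] by (auto simp: ereal_infinity_cases)
      \<comment> \<open>The first entry brings \<open>x\<close> into the range of
        \<open>\<phi>low\<close>; the second gives \<open>\<bar>a\<bar> < n * m\<close>.\<close>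
      obtain n :: nat where n: "max (dist x z + 1) (\<bar>a\<bar> / m + 1) \<le> real n" using real_arch_simple by blast
      have "m \<le> \<phi> n x" using \<phi>low[of x n] n x by (auto simp: m_def)
      moreover have "\<bar>a\<bar> / m < real n" using n by auto
      then have "\<bar>a\<bar> < real n * m" using m by (simp add: field_simps)
      ultimately have na: "\<bar>a\<bar> < real n * \<phi> n x" by (meson less_le_trans mult_left_mono of_nat_0_le_iff)
      have fx: "f n x = a" using f_clip[of x a n] a x na by (auto simp: vU_def)
      have sub: "U - H \<subseteq> - G n" "U - H \<subseteq> - Gw" by (auto simp: H_def)
      have cf: "continuous_on (U - H) (f n)" by (rule continuous_on_subset[OF G(3) sub(1)])
      have cw: "continuous_on (U - H) w" by (rule continuous_on_subset[OF Gw(3) sub(2)])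
      have cd: "continuous_on (U - H) (d n)" by (rule continuous_on_subset[OF dc]) simp
      \<comment> \<open>The margin between \<open>f n\<close> and its bounds is continuous and
        positive at \<open>x\<close>, hence positive nearby, where \<open>f n\<close> therefore
        equals \<open>v\<close>.\<close>
      have "continuous_on (U - H) (\<lambda>y. real n * \<phi> n y - \<bar>f n y\<bar>)" unfolding \<phi>_def
        by (intro continuous_intros cf cw cd continuous_on_min)
      then have "((\<lambda>y. real n * \<phi> n y - \<bar>f n y\<bar>) \<longlongrightarrow> real n * \<phi> n x - \<bar>f n x\<bar>) (at x within U - H)"
        using x by (simp add: continuous_on_def)
      then have "\<forall>\<^sub>F y in at x within U - H. 0 < real n * \<phi> n y - \<bar>f n y\<bar>"
        using na fx by (intro order_tendstoD(1)) auto
      moreover have "\<forall>\<^sub>F y in at x within U - H. y \<in> U" by (auto simp: eventually_at_filter)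
      ultimately have ev: "\<forall>\<^sub>F y in at x within U - H. f n y = real_of_ereal (v y)"
      proof eventually_elim
        case (elim y)
        then have "v y = ereal (f n y)" using f_eq[of n y] by (auto simp: vU_def)
        then show ?case by simp
      qed
      have "(f n \<longlongrightarrow> f n x) (at x within U - H)" using cf x by (simp add: continuous_on_def)
      then have "((\<lambda>y. real_of_ereal (v y)) \<longlongrightarrow> f n x) (at x within U - H)"
        using ev by (rule Lim_transform_eventually)
      then show "((\<lambda>y. real_of_ereal (v y)) \<longlongrightarrow> real_of_ereal (v x)) (at x within U - H)" by (simp add: a fx)
    qed
  qed
qed

text \<open>Two quasicontinuous functions which agree almost everywhere differ on a set \<open>E\<close> such that
  \<open>E \<union> G\<close> is open for suitable open \<open>G\<close> of small capacity. A curve leaving a point of \<open>E\<close>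
  either runs in \<open>E\<close> for a while, or meets every \<open>G\<close> arbitrarily early.\<close>

lemma negligible_curves:
  assumes Em: "E \<subseteq> E'" "E' \<in> null_sets M"
    and G: "\<And>n. Cap1 M (G n) < ennreal ((1/2)^n)" "\<And>n. open (E \<union> G n)"
  obtains \<rho> :: "'a \<Rightarrow> ennreal" where "\<rho> \<in> borel_measurable borel" "(\<integral>\<^sup>+ x. \<rho> x \<partial>M) < \<infinity>"
    "\<forall>\<gamma>. rectifiable_curve \<gamma> \<longrightarrow> nonconstant_curve \<gamma> \<longrightarrow> \<gamma> 0 \<in> E \<longrightarrow> line_integral \<gamma> \<rho> = \<infinity>"
proof -
  define P where "P n w w' k \<longleftrightarrow> (\<forall>x. w x \<le> 1) \<and> (\<forall>x\<in>G n. w x = 1) \<and> ug w k \<and>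
    w' \<in> borel_measurable borel \<and> (\<forall>x. ennreal (w x) \<le> w' x) \<and>
    (\<integral>\<^sup>+ x. w' x \<partial>M) + (\<integral>\<^sup>+ x. k x \<partial>M) < ennreal ((1/2)^n)"
    for n and w :: "'a \<Rightarrow> real" and w' k :: "'a \<Rightarrow> ennreal"
  have "\<exists>w w' k. P n w w' k" for n
  proof -
    obtain w k where w: "w \<in> borel_measurable CM" "\<And>x. 0 \<le> w x" "\<And>x. w x \<le> 1"
      "\<And>x. x \<in> G n \<Longrightarrow> w x = 1" "ug w k" "(\<integral>\<^sup>+ x. ennreal (w x) \<partial>M) + (\<integral>\<^sup>+ x. k x \<partial>M) < ennreal ((1/2)^n)"
      using Cap1_less[OF G(1)[of n]] by blast
    obtain w' where "w' \<in> borel_measurable borel" "\<And>x. ennreal (w x) \<le> w' x"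
      "(\<integral>\<^sup>+ x. w' x \<partial>M) = (\<integral>\<^sup>+ x. ennreal (w x) \<partial>M)" using borel_majorant[OF w(1)] by blast
    then have "P n w w' k" using w by (simp add: P_def)
    then show ?thesis by blast
  qed
  then obtain w w' k where "\<And>n. P n (w n) (w' n) (k n)" by metis
  then have w: "\<And>n x. w n x \<le> 1" "\<And>n x. x \<in> G n \<Longrightarrow> w n x = 1" "\<And>n. ug (w n) (k n)"
    "\<And>n. w' n \<in> borel_measurable borel" "\<And>n x. ennreal (w n x) \<le> w' n x"
    "\<And>n. (\<integral>\<^sup>+ x. w' n x \<partial>M) + (\<integral>\<^sup>+ x. k n x \<partial>M) < ennreal ((1/2)^n)"
    unfolding P_def by auto
  have kb: "k n \<in> borel_measurable borel" for n using w(3) by (rule ug_borel)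
  have E'b: "E' \<in> sets borel" using Em(2) by (auto simp: null_sets_def sets_M)
  define q where "q n x = w' n x + k n x" for n x
  have qb: "q n \<in> borel_measurable borel" for n unfolding q_def using w(4) kb by measurable
  \<comment> \<open>Infinite on the null set \<open>E'\<close>, which rules out arcs of positive
    length in \<open>E\<close>. The series diverges along a nonconstant curve that starts where
    every \<open>w n\<close> equals 1.\<close>
  define \<rho> where "\<rho> x = (\<Sum>n. q n x) + top * indicator E' x" for x
  have \<rho>b: "\<rho> \<in> borel_measurable borel" unfolding \<rho>_def using qb E'b by measurable
  have "AE x in M. x \<notin> E'" using Em(2) by (rule AE_not_in)
  then have "(\<integral>\<^sup>+ x. \<rho> x \<partial>M) = (\<integral>\<^sup>+ x. (\<Sum>n. q n x) \<partial>M)"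
    unfolding \<rho>_def by (intro nn_integral_cong_AE) auto
  also have "\<dots> = (\<Sum>n. \<integral>\<^sup>+ x. q n x \<partial>M)" by (rule nn_integral_suminf) (rule borel_M[OF qb])
  also have "\<dots> = (\<Sum>n. (\<integral>\<^sup>+ x. w' n x \<partial>M) + (\<integral>\<^sup>+ x. k n x \<partial>M))"
    unfolding q_def using borel_M[OF w(4)] borel_M[OF kb] by (simp add: nn_integral_add)
  also have "\<dots> \<le> (\<Sum>n. ennreal ((1/2)^n))" using w(6) by (intro suminf_le) (auto intro: less_imp_le)
  also have "\<dots> = ennreal (1 / (1 - 1/2))" by (intro suminf_ennreal_eq geometric_sums) auto
  also have "\<dots> < \<infinity>" by simp
  finally have \<rho>int: "(\<integral>\<^sup>+ x. \<rho> x \<partial>M) < \<infinity>" .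
  have "line_integral \<gamma> \<rho> = \<infinity>" if rc: "rectifiable_curve \<gamma>" and nc: "nonconstant_curve \<gamma>" and "\<gamma> 0 \<in> E" for \<gamma>
  proof (rule ccontr)
    assume "line_integral \<gamma> \<rho> \<noteq> \<infinity>"
    then have fin: "line_integral \<gamma> \<rho> < \<infinity>" by (simp add: less_top[symmetric])
    define p where "p = plen \<gamma> 0"
    have cp: "continuous_on {0..1} p" unfolding p_def by (rule continuous_plen[OF rc])
    have p0: "0 \<le> p t" if "0 \<le> t" "t \<le> 1" for t unfolding p_def using plen_nonneg[OF rc] that by auto
    obtain t' where t': "0 \<le> t'" "t' \<le> 1" "\<gamma> t' \<noteq> \<gamma> 0" using nc by (auto simp: nonconstant_curve_def)
    have "0 < dist (\<gamma> 0) (\<gamma> t')" using t' by simp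
    also have "\<dots> \<le> p t'" unfolding p_def using t' by (intro plen_ge_dist[OF rc]) auto
    also have "\<dots> \<le> p 1" unfolding p_def using t' by (intro plen_mono[OF rc]) auto
    finally have p1: "p 1 > 0" .
    \<comment> \<open>The parameters up to which no length has been used. After the last of them,
      \<open>a\<close>, every arc has positive length, while still
      \<open>\<gamma> a = \<gamma> 0\<close>.\<close>
    define Z where "Z = {0..1} \<inter> p -` {..0}"
    have "closed Z" unfolding Z_def by (intro continuous_closed_preimage[OF cp] closed_atLeastAtMost closed_atMost)
    moreover have "bounded Z" by (rule bounded_subset[of "{0..1}"]) (auto simp: Z_def)
    ultimately have cZ: "compact Z" by (simp add: compact_eq_bounded_closed)
    have "0 \<in> Z" by (auto simp: Z_def p_def)
    then obtain a where a: "a \<in> Z" "\<And>t. t \<in> Z \<Longrightarrow> t \<le> a" using compact_attains_sup[OF cZ] by blast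
    have a01: "0 \<le> a" "a < 1" "p a = 0"
    proof -
      show "0 \<le> a" "p a = 0" using a(1) p0[of a] by (auto simp: Z_def)
      show "a < 1" using a(1) p1 by (cases "a = 1") (auto simp: Z_def)
    qed
    have pa: "plen \<gamma> a t > 0" if "a < t" "t \<le> 1" for t
    proof -
      have "t \<notin> Z" using a(2)[of t] that by auto
      then have "p t > 0" using that a01 by (auto simp: Z_def)
      then show ?thesis using plen_add[OF rc, of 0 a t] that a01 by (simp add: p_def)
    qed
    have \<gamma>a: "\<gamma> a = \<gamma> 0" using plen_ge_dist[OF rc, of 0 a] a01 by (simp add: p_def)
    have q_le: "q n x \<le> \<rho> x" for n x
    proof -
      have "q n x \<le> (\<Sum>n. q n x)" using sum_le_suminf[of "\<lambda>n. q n x" "{n}"] by simp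
      then show ?thesis unfolding \<rho>_def by (rule order_trans) simp
    qed
    \<comment> \<open>If \<open>w n < 1\<close> at the start, continuity keeps the curve off
      \<open>G n\<close> for a while, hence in \<open>E\<close> because
      \<open>E \<union> G n\<close> is open. Such an arc has positive length and lies in
      \<open>E'\<close>, so its integral of \<open>\<rho>\<close> is infinite.\<close>
    have w1: "w n (\<gamma> 0) = 1" for n
    proof (rule ccontr)
      assume "w n (\<gamma> 0) \<noteq> 1"
      then have lt: "w n (\<gamma> a) < 1" using w(1)[of n "\<gamma> 0"] by (simp add: \<gamma>a)
      have "line_integral \<gamma> (k n) \<le> line_integral \<gamma> \<rho>"
      proof (rule line_integral_mono')
        fix x show "k n x \<le> \<rho> x" using q_le[of n x] by (rule order_trans[rotated]) (simp add: q_def)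
      qed
      then have "continuous_on {0..1} (w n \<circ> \<gamma>)" using fin by (intro ug_continuous[OF w(3) rc]) (rule le_less_trans)
      then have "((\<lambda>t. w n (\<gamma> t)) \<longlongrightarrow> w n (\<gamma> a)) (at a within {0..1})" using a01 by (simp add: continuous_on_def)
      then have e1: "\<forall>\<^sub>F t in at a within {0..1}. w n (\<gamma> t) < 1" using lt by (rule order_tendstoD(2))
      have "continuous_on {0..1} \<gamma>" using rc by (simp add: rectifiable_curve_def)
      then have "(\<gamma> \<longlongrightarrow> \<gamma> a) (at a within {0..1})" using a01 by (simp add: continuous_on_def)
      then have e2: "\<forall>\<^sub>F t in at a within {0..1}. \<gamma> t \<in> E \<union> G n"
        using G(2)[of n] \<open>\<gamma> 0 \<in> E\<close> by (intro topological_tendstoD) (auto simp: \<gamma>a)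
      from e1 e2 have "\<forall>\<^sub>F t in at a within {0..1}. \<gamma> t \<in> E"
        by eventually_elim (use w(2) in force)
      then obtain d where d: "d > 0" "\<And>t. t \<in> {0..1} \<Longrightarrow> t \<noteq> a \<Longrightarrow> dist t a < d \<Longrightarrow> \<gamma> t \<in> E"
        unfolding eventually_at by blast
      define b where "b = min 1 (a + d/2)"
      have b: "a < b" "b \<le> 1" "b - a < d" using d(1) a01 by (auto simp: b_def min_def)
      have inE: "\<gamma> t \<in> E'" if "a \<le> t" "t \<le> b" for t
      proof (cases "t = a")
        case True then show ?thesis using \<open>\<gamma> 0 \<in> E\<close> Em(1) by (auto simp: \<gamma>a)
      next
        case False
        then show ?thesis using d(2)[of t] that b a01 Em(1) by (auto simp: dist_real_def)
      qed
      have big: "ennreal (r * plen \<gamma> a b) \<le> line_integral \<gamma> \<rho>" if "r \<ge> 0" for r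
      proof -
        have "ennreal (r * plen \<gamma> a b) \<le> seg \<gamma> a b \<rho>"
          using inE a01 b that by (intro seg_lower rc) (auto simp: \<rho>_def)
        also have "\<dots> \<le> line_integral \<gamma> \<rho>"
          unfolding line_integral_def using a01 b by (intro nn_integral_mono) (auto simp: indicator_def)
        finally show ?thesis .
      qed
      obtain I where I: "line_integral \<gamma> \<rho> = ennreal I" "0 \<le> I" using fin by (cases "line_integral \<gamma> \<rho>" rule: ennreal_cases) auto
      have P: "plen \<gamma> a b > 0" using pa b by auto
      have "ennreal ((I + 1) / plen \<gamma> a b * plen \<gamma> a b) \<le> ennreal I"
        using big[of "(I + 1) / plen \<gamma> a b"] I P by simp
      then show False using I P by simp
    qed
    \<comment> \<open>A contribution common to all \<open>n\<close>: either \<open>k n\<close> has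
      integral above 1/2 along the curve, or \<open>w n\<close> stays at least 1/2 on all of it and
      half the length is counted.\<close>
    define c where "c = min (1/2) (1/2 * plen \<gamma> 0 1)"
    have c: "c > 0" using p1 by (simp add: c_def p_def)
    have qc: "ennreal c \<le> line_integral \<gamma> (q n)" for n
    proof -
      have lq: "line_integral \<gamma> (q n) = line_integral \<gamma> (w' n) + line_integral \<gamma> (k n)"
        unfolding q_def by (intro line_integral_add rc w kb)
      show ?thesis
      proof (cases "line_integral \<gamma> (k n) \<le> ennreal (1/2)")
        case False
        have "ennreal c \<le> ennreal (1/2)" by (intro ennreal_leI) (simp add: c_def)
        also have "\<dots> \<le> line_integral \<gamma> (k n)" using False by simp
        also have "\<dots> \<le> line_integral \<gamma> (q n)" unfolding lq by simp
        finally show ?thesis .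
      next
        case True
        have half: "1/2 \<le> w n (\<gamma> t)" if t: "0 \<le> t" "t \<le> 1" for t
        proof -
          have "ennreal \<bar>w n (\<gamma> 0) - w n (\<gamma> t)\<bar> \<le> seg \<gamma> 0 t (k n)" using t by (intro ug_seg[OF w(3) rc]) auto
          also have "\<dots> \<le> line_integral \<gamma> (k n)" unfolding line_integral_def
            using t by (intro nn_integral_mono) (auto simp: indicator_def)
          also have "\<dots> \<le> ennreal (1/2)" by (rule True)
          finally have "\<bar>w n (\<gamma> 0) - w n (\<gamma> t)\<bar> \<le> 1/2" by (subst (asm) ennreal_le_iff) auto
          then show ?thesis unfolding w1 by linarith
        qed
        have "ennreal c \<le> ennreal (1/2 * plen \<gamma> 0 1)" by (intro ennreal_leI) (simp add: c_def)
        also have "\<dots> \<le> line_integral \<gamma> (w' n)" unfolding line_integral_seg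
        proof (intro seg_lower rc)
          show "ennreal (1/2) \<le> w' n (\<gamma> t)" if "0 \<le> t" "t \<le> 1" for t
            using half[OF that] w(5)[of n "\<gamma> t"] by (meson ennreal_leI order_trans)
        qed auto
        also have "\<dots> \<le> line_integral \<gamma> (q n)" unfolding lq by simp
        finally show ?thesis .
      qed
    qed
    obtain I where I: "line_integral \<gamma> \<rho> = ennreal I" "0 \<le> I" using fin by (cases "line_integral \<gamma> \<rho>" rule: ennreal_cases) auto
    obtain N :: nat where N: "I / c < real N" using reals_Archimedean2 by blast
    have "ennreal (real N * c) = (\<Sum>n<N. ennreal c)" using c by (simp add: ennreal_mult ennreal_of_nat_eq_real_of_nat)
    also have "\<dots> \<le> (\<Sum>n<N. line_integral \<gamma> (q n))" by (intro sum_mono qc)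
    also have "\<dots> \<le> (\<Sum>n. line_integral \<gamma> (q n))" by (intro sum_le_suminf) auto
    also have "\<dots> = line_integral \<gamma> (\<lambda>x. \<Sum>n. q n x)" by (rule line_integral_suminf[symmetric, OF rc qb])
    also have "\<dots> \<le> line_integral \<gamma> \<rho>" by (rule line_integral_mono') (simp add: \<rho>_def)
    finally have "real N * c \<le> I" using I by simp
    then show False using N c by (simp add: field_simps)
  qed
  then show thesis using \<rho>b \<rho>int by (intro that[of \<rho>]) auto
qed

text \<open>The upper gradient inequality involves end values only. A gradient of \<open>v\<close>
  therefore serves for \<open>u\<close> on curves with both ends off \<open>E\<close>, and
  \<open>negligible_curves\<close> disposes of the others. Its hypothesis holds because
  \<open>u\<close> and \<open>v\<close> are both quasicontinuous, so that
  \<open>u \<noteq> v\<close> is an open condition relative to \<open>U - G\<close>.\<close>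

lemma quasicontinuous_N11:
  assumes qo: "quasiopen1 M U" and hat: "N11_hat M U u" and qc: "quasicontinuous1_on M U u"
  shows "N11 M U u"
proof -
  obtain v where N: "N11 M U v" and ae: "AE x in CM. x \<in> U \<longrightarrow> u x = v x" using hat by (auto simp: N11_hat_def)
  have qcv: "quasicontinuous1_on M U v" by (rule N11_quasicontinuous[OF qo N])
  define E where "E = {x\<in>U. u x \<noteq> v x}"
  have "AE x in M. x \<in> U \<longrightarrow> u x = v x" using ae by (simp add: AE_completion_iff)
  from AE_E[OF this] obtain E' where E': "{x\<in>space M. \<not> (x \<in> U \<longrightarrow> u x = v x)} \<subseteq> E'" "emeasure M E' = 0" "E' \<in> sets M" .
  have EE': "E \<subseteq> E'" "E' \<in> null_sets M" using E' by (auto simp: E_def null_sets_def)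
  have "\<exists>G. Cap1 M G < ennreal ((1/2)^n) \<and> open (E \<union> G)" for n :: nat
  proof -
    \<comment> \<open>Three exceptional sets share the bound: those for \<open>U\<close>, for
      \<open>u\<close> and for \<open>v\<close>.\<close>
    define \<epsilon> where "\<epsilon> = (1/2::real)^n / 3"
    have \<epsilon>: "\<epsilon> > 0" by (simp add: \<epsilon>_def)
    obtain G1 where G1: "open G1" "Cap1 M G1 < ennreal \<epsilon>" "open (U \<union> G1)"
      using qo \<epsilon> unfolding quasiopen1_def by blast
    obtain G2 where G2: "open G2" "Cap1 M G2 < ennreal \<epsilon>" "\<forall>x\<in>U - G2. \<bar>u x\<bar> \<noteq> \<infinity>"
      "continuous_on (U - G2) (\<lambda>x. real_of_ereal (u x))" using qc \<epsilon> unfolding quasicontinuous1_on_def by blast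
    obtain G3 where G3: "open G3" "Cap1 M G3 < ennreal \<epsilon>" "\<forall>x\<in>U - G3. \<bar>v x\<bar> \<noteq> \<infinity>"
      "continuous_on (U - G3) (\<lambda>x. real_of_ereal (v x))" using qcv \<epsilon> unfolding quasicontinuous1_on_def by blast
    define G where "G = (G1 \<union> G2) \<union> G3"
    have "Cap1 M G < ennreal ((\<epsilon> + \<epsilon>) + \<epsilon>)" unfolding G_def by (intro Cap1_Un_less G1 G2 G3)
    then have cap: "Cap1 M G < ennreal ((1/2)^n)" by (simp add: \<epsilon>_def)
    have oG: "open G" using G1 G2 G3 by (auto simp: G_def)
    have oUG: "open (U \<union> G)"
    proof -
      have "U \<union> G = (U \<union> G1) \<union> (G2 \<union> G3)" by (auto simp: G_def)
      then show ?thesis using G1(3) G2(1) G3(1) by (metis open_Un)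
    qed
    have "continuous_on (U - G) (\<lambda>x. real_of_ereal (u x))"
      by (rule continuous_on_subset[OF G2(4)]) (auto simp: G_def)
    moreover have "continuous_on (U - G) (\<lambda>x. real_of_ereal (v x))"
      by (rule continuous_on_subset[OF G3(4)]) (auto simp: G_def)
    ultimately have "continuous_on (U - G) (\<lambda>x. real_of_ereal (u x) - real_of_ereal (v x))" by (rule continuous_on_diff)
    then obtain W where W: "open W" "W \<inter> (U - G) = (\<lambda>x. real_of_ereal (u x) - real_of_ereal (v x)) -` (- {0}) \<inter> (U - G)"
      unfolding continuous_on_open_invariant by (metis open_Compl closed_singleton)
    have "W \<inter> (U - G) = E - G"
    proof -
      have "real_of_ereal (u x) - real_of_ereal (v x) \<noteq> 0 \<longleftrightarrow> u x \<noteq> v x" if "x \<in> U - G" for x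
      proof -
        have "\<bar>u x\<bar> \<noteq> \<infinity>" "\<bar>v x\<bar> \<noteq> \<infinity>" using that G2(3) G3(3) by (auto simp: G_def)
        then show ?thesis by (cases "u x"; cases "v x") auto
      qed
      then show ?thesis unfolding W(2) by (auto simp: E_def)
    qed
    then have "E \<union> G = (W \<inter> (U \<union> G)) \<union> G" by blast
    moreover have "open ((W \<inter> (U \<union> G)) \<union> G)" by (intro open_Un open_Int W oUG oG)
    ultimately have "open (E \<union> G)" by simp
    then show ?thesis using cap by blast
  qed
  then obtain G where G: "\<And>n. Cap1 M (G n) < ennreal ((1/2)^n)" "\<And>n. open (E \<union> G n)" by metis
  obtain \<rho>1 where \<rho>1: "\<rho>1 \<in> borel_measurable borel" "(\<integral>\<^sup>+ x. \<rho>1 x \<partial>M) < \<infinity>"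
    "\<forall>\<gamma>. rectifiable_curve \<gamma> \<longrightarrow> nonconstant_curve \<gamma> \<longrightarrow> \<gamma> 0 \<in> E \<longrightarrow> line_integral \<gamma> \<rho>1 = \<infinity>"
    using negligible_curves[OF EE' G] by blast
  obtain g where wug: "weak_upper_gradient_in M U v g" and gint: "(\<integral>\<^sup>+ x. g x * indicator U x \<partial>CM) < \<infinity>"
    using N by (auto simp: N11_def)
  obtain \<Gamma> \<rho> where g: "g \<in> borel_measurable borel" and \<rho>: "\<rho> \<in> borel_measurable borel" "(\<integral>\<^sup>+ x. \<rho> x \<partial>M) < \<infinity>"
    "\<forall>\<gamma>\<in>\<Gamma>. line_integral \<gamma> \<rho> = \<infinity>"
    "\<forall>\<gamma>. rectifiable_curve \<gamma> \<and> nonconstant_curve \<gamma> \<and> \<gamma> ` {0..1} \<subseteq> U \<and> \<gamma> \<notin> \<Gamma> \<longrightarrow> ug_ineq v g \<gamma>"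
    using wug unfolding weak_upper_gradient_in_def zero_1_modulus_def by (auto simp: nn_integral_completion)
  define \<Gamma>1 where "\<Gamma>1 = {\<gamma>. rectifiable_curve \<gamma> \<and> nonconstant_curve \<gamma> \<and> (\<gamma> 0 \<in> E \<or> \<gamma> 1 \<in> E)}"
  have \<Gamma>1: "line_integral \<gamma> \<rho>1 = \<infinity>" if "\<gamma> \<in> \<Gamma>1" for \<gamma>
  proof (cases "\<gamma> 0 \<in> E")
    case True then show ?thesis using that \<rho>1(3) by (auto simp: \<Gamma>1_def)
  next
    case False
    then have rc: "rectifiable_curve \<gamma>" and nc: "nonconstant_curve \<gamma>" and "\<gamma> 1 \<in> E" using that by (auto simp: \<Gamma>1_def)
    \<comment> \<open>Reversal reduces a terminal point in \<open>E\<close> to an initial one.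
      Nonconstancy is defined relative to the initial point and has to be rechecked.\<close>
    have "nonconstant_curve (\<lambda>t. \<gamma> (1 - t))"
    proof (rule ccontr)
      assume "\<not> nonconstant_curve (\<lambda>t. \<gamma> (1 - t))"
      then have c: "\<forall>t\<in>{0..1}. \<gamma> (1 - t) = \<gamma> 1" by (simp add: nonconstant_curve_def)
      have c': "\<gamma> t = \<gamma> 1" if "t \<in> {0..1}" for t using bspec[OF c, of "1 - t"] that by simp
      obtain t where "t \<in> {0..1}" "\<gamma> t \<noteq> \<gamma> 0" using nc unfolding nonconstant_curve_def by blast
      then show False using c'[of t] c'[of 0] by simp
    qed
    then have "line_integral (\<lambda>t. \<gamma> (1 - t)) \<rho>1 = \<infinity>"
      using \<rho>1(3) rectifiable_reverse[OF rc] \<open>\<gamma> 1 \<in> E\<close> by simp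
    then show ?thesis by (simp add: line_integral_reverse[OF rc \<rho>1(1)])
  qed
  have mod: "zero_1_modulus M (\<Gamma> \<union> \<Gamma>1)" unfolding zero_1_modulus_def
  proof (intro exI[of _ "\<lambda>x. \<rho> x + \<rho>1 x"] conjI ballI)
    show "(\<lambda>x. \<rho> x + \<rho>1 x) \<in> borel_measurable borel" using \<rho>(1) \<rho>1(1) by measurable
    show "(\<integral>\<^sup>+ x. \<rho> x + \<rho>1 x \<partial>CM) < \<infinity>"
      using \<rho>(2) \<rho>1(2) borel_M[OF \<rho>(1)] borel_M[OF \<rho>1(1)]
      by (simp add: nn_integral_completion nn_integral_add ennreal_add_less_top)
    fix \<gamma> assume "\<gamma> \<in> \<Gamma> \<union> \<Gamma>1"
    then consider "line_integral \<gamma> \<rho> = \<infinity>" | "line_integral \<gamma> \<rho>1 = \<infinity>" using \<rho>(3) \<Gamma>1 by auto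
    then show "line_integral \<gamma> (\<lambda>x. \<rho> x + \<rho>1 x) = \<infinity>"
    proof cases
      case 1
      have "line_integral \<gamma> \<rho> \<le> line_integral \<gamma> (\<lambda>x. \<rho> x + \<rho>1 x)" by (rule line_integral_mono') simp
      then show ?thesis using 1 by (simp add: top_unique)
    next
      case 2
      have "line_integral \<gamma> \<rho>1 \<le> line_integral \<gamma> (\<lambda>x. \<rho> x + \<rho>1 x)" by (rule line_integral_mono') simp
      then show ?thesis using 2 by (simp add: top_unique)
    qed
  qed
  have wu: "weak_upper_gradient_in M U u g" unfolding weak_upper_gradient_in_def
  proof (intro conjI g exI[of _ "\<Gamma> \<union> \<Gamma>1"] mod allI impI)
    fix \<gamma> assume \<gamma>: "rectifiable_curve \<gamma> \<and> nonconstant_curve \<gamma> \<and> \<gamma> ` {0..1} \<subseteq> U \<and> \<gamma> \<notin> \<Gamma> \<union> \<Gamma>1"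
    then have "ug_ineq v g \<gamma>" using \<rho>(4) by auto
    moreover have "\<gamma> 0 \<in> U" "\<gamma> 1 \<in> U" using \<gamma> by (auto simp: image_subset_iff)
    then have "u (\<gamma> 0) = v (\<gamma> 0)" "u (\<gamma> 1) = v (\<gamma> 1)" using \<gamma> by (auto simp: \<Gamma>1_def E_def)
    ultimately show "ug_ineq u g \<gamma>" by (simp add: ug_ineq_def)
  qed
  have um: "(\<lambda>x. if x \<in> U then u x else 0) \<in> borel_measurable CM"
  proof (rule measurableI)
    fix A :: "ereal set" assume A: "A \<in> sets borel"
    have vm: "(\<lambda>x. if x \<in> U then v x else 0) \<in> borel_measurable CM" using N by (simp add: N11_def)
    \<comment> \<open>In a complete measure space a set that agrees almost everywhere with a
      measurable one is measurable.\<close>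
    have "AE x in CM. x \<in> (\<lambda>x. if x \<in> U then v x else 0) -` A \<inter> space CM \<longleftrightarrow> x \<in> (\<lambda>x. if x \<in> U then u x else 0) -` A \<inter> space CM"
      using ae by eventually_elim auto
    then show "(\<lambda>x. if x \<in> U then u x else 0) -` A \<inter> space CM \<in> sets CM"
      by (rule complete_measure.in_sets_AE[OF completion.complete_measure_axioms])
        (use measurable_sets[OF vm A] in auto)
  qed simp
  have "(\<integral>\<^sup>+ x. e2ennreal \<bar>u x\<bar> * indicator U x \<partial>CM) = (\<integral>\<^sup>+ x. e2ennreal \<bar>v x\<bar> * indicator U x \<partial>CM)"
    by (rule nn_integral_cong_AE, use ae in eventually_elim) (auto simp: indicator_def)
  also have "\<dots> < \<infinity>" using N by (simp add: N11_def)
  finally show ?thesis unfolding N11_def using um wu gint by blast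
qed

end

theorem theorem5p12:
  fixes M :: "'a::{metric_space, complete_space} measure"
    and U :: "'a set" and u :: "'a \<Rightarrow> ereal"
    and Cd CP lam :: real
  assumes two_points: "\<exists>x y::'a. x \<noteq> y"
    and borel_M: "sets M = sets borel"
    and doubling: "doubling M Cd"
    and poincare: "poincare_1_1 M CP lam"
    and U_qo: "quasiopen1 M U"
    and u_hat: "N11_hat M U u"
  shows "N11 M U u \<longleftrightarrow> quasicontinuous1_on M U u"
proof -
  interpret poincare_space M Cd CP lam
    using borel_M doubling poincare by unfold_locales
  show ?thesis using N11_quasicontinuous[OF U_qo] quasicontinuous_N11[OF U_qo u_hat] by blast
qed

end
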